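(* Let $n>m\ge1$, let $\boldsymbol\lambda=(\lambda_1,\dots,\lambda_m)\in\mathbb{C}^m$ satisfy $\operatorname{Re}\lambda_j>j-m-1$ for all $j=1,\dots,m$, and let $P_k$ be an $H$-polynomial of degree $k$ on $\mathbb{R}^{n\times m}$. Then $$(T^{\boldsymbol\lambda}P_k)(v)=c\,\mu_k(\boldsymbol\lambda)\,P_k(v),\qquad v\in V_{n,m},$$ where $c=\pi^{m(n-m)/2}\,i^{km}\,\sigma_{m,m}$ and $$\mu_k(\boldsymbol\lambda)=\frac{\Gamma_\Omega(\boldsymbol\lambda+\mathbf{m}_0)\,\Gamma_\Omega(\mathbf{k}_0-\boldsymbol\lambda_* )}{\Gamma_\Omega(-\boldsymbol\lambda_* )\,\Gamma_\Omega(\boldsymbol\lambda+\mathbf{k}_0+\mathbf{n}_0)}.$$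
   Context: $\mathbb{R}^{n\times m}$ is the space of real $n\times m$ matrices; $x'$ is the transpose. $V_{n,m}=\{v\in\mathbb{R}^{n\times m}:v'v=I_m\}$ is the Stiefel manifold with the $O(n)$-invariant measure $dv$ of total mass $\sigma_{n,m}=\prod_{i=1}^m|S^{n-i}|$, $|S^{i}|=2\pi^{(i+1)/2}/\Gamma((i+1)/2)$; $\sigma_{m,m}$ is the case $n=m$. For a positive definite symmetric real $m\times m$ matrix $r$ with leading principal minors $\Delta_0(r)=1,\Delta_1(r),\dots,\Delta_m(r)=\det r$, put $r^{\boldsymbol\lambda}=\prod_{i=1}^m[\Delta_i(r)/\Delta_{i-1}(r)]^{\lambda_i/2}$. The composite cosine transform is $(T^{\boldsymbol\lambda}f)(u)=\int_{V_{n,m}}f(v)(u'vv'u)^{\boldsymbol\lambda}dv$, $u\in V_{n,m}$. $\boldsymbol\lambda_*=(\lambda_m,\dots,\lambda_1)$; $\mathbf{n}_0=(n,\dots,n)$, $\mathbf{m}_0=(m,\dots,m)$, $\mathbf{k}_0=(k,\dots,k)\in\mathbb{C}^m$; $\Gamma_\Omega(\boldsymbol\lambda)=\pi^{m(m-1)/4}\prod_{j=1}^m\Gamma((\lambda_j-j+1)/2)$. Where individual gamma factors have poles, $\mu_k(\boldsymbol\lambda)$ is understood as a meromorphic function of $\boldsymbol\lambda$ (removable singularities being removed). An $H$-polynomial of degree $k$ is a polynomial $P_k$ on $\mathbb{R}^{n\times m}$ that is $O(m)$ right-invariant ($P_k(x\gamma)=P_k(x)$ for $\gamma\in O(m)$),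 harmonic as a function on $\mathbb{R}^{nm}$, and determinantally homogeneous of degree $k$: $P_k(xg)=\det(g)^kP_k(x)$ for all $g\in GL(m,\mathbb{R})$. $T^{\boldsymbol\lambda}P_k$ means $T^{\boldsymbol\lambda}$ applied to the restriction of $P_k$ to $V_{n,m}$. *)

theory Defs
  imports "HOL-Analysis.Analysis"
begin

text \<open>
  A real \<open>n \<times> m\<close> matrix has type \<^typ>\<open>real^'m^'n\<close>, so that \<open>n\<close> is \<open>CARD('n)\<close> and \<open>m\<close> is
  \<open>CARD('m)\<close>. Leading principal minors refer to the order of the column indices, hence
  \<open>'m\<close> carries a linear order, and \<open>\<lambda> \<in> \<complex>\<^sup>m\<close> is indexed by the same type.
\<close>

definition position :: "'m::{finite,linorder} \<Rightarrow> nat"  \<comment> \<open>from \<open>1\<close> to \<open>m\<close>\<close>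
  where "position a = card {..a}"

definition reverse_index :: "'m::{finite,linorder} \<Rightarrow> 'm"
  where "reverse_index a = (THE b. position b = CARD('m) + 1 - position a)"

definition reverse_vec :: "complex^('m::{finite,linorder}) \<Rightarrow> complex^('m::{finite,linorder})"  \<comment> \<open>\<open>\<lambda>\<^sub>*\<close>\<close>
  where "reverse_vec l = (\<chi> a. l $ reverse_index a)"

text \<open>Leibniz' formula, as in \<open>det_def\<close>, for the submatrix with rows and columns in \<open>S\<close>.\<close>

definition principal_minor :: "'m::finite set \<Rightarrow> real^'m^'m \<Rightarrow> real"
  where "principal_minor S r =
    (\<Sum>p | p permutes S. of_int (sign p) * (\<Prod>i\<in>S. r $ i $ p i))"

lemma principal_minor_UNIV: "principal_minor UNIV r = det r"
  by (simp add: principal_minor_def det_def)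

lemma principal_minor_empty: "principal_minor {} r = 1"
  by (simp add: principal_minor_def)

text \<open>
  With \<open>i\<close> the position of \<open>a\<close>, \<open>principal_minor {..a}\<close> is \<open>\<Delta>\<^sub>i\<close> and
  \<open>principal_minor {..<a}\<close> is \<open>\<Delta>\<close> with index \<open>i - 1\<close>. The value is meaningful only for
  positive definite \<open>r\<close>.
\<close>

definition matrix_power :: "real^('m::{finite,linorder})^('m::{finite,linorder}) \<Rightarrow> complex^('m::{finite,linorder}) \<Rightarrow> complex"
  where "matrix_power r l =
    (\<Prod>a\<in>UNIV. complex_of_real (principal_minor {..a} r / principal_minor {..<a} r) powr (l $ a / 2))"

definition stiefel :: "(real^'m^'n) set"
  where "stiefel = {v. transpose v ** v = mat 1}"

definition sphere_area :: "nat \<Rightarrow> real"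
  where "sphere_area i = 2 * pi powr ((real i + 1) / 2) / Gamma ((real i + 1) / 2)"

definition stiefel_mass :: "nat \<Rightarrow> nat \<Rightarrow> real"  \<comment> \<open>\<open>\<sigma>\<close>, for \<open>m \<le> n\<close>\<close>
  where "stiefel_mass n m = (\<Prod>i=1..m. sphere_area (n - i))"

text \<open>These properties determine the Borel measure \<open>dv\<close>, because \<open>O(n)\<close> is compact and acts
  transitively on the Stiefel manifold.\<close>

definition is_stiefel_measure :: "(real^'m^'n) measure \<Rightarrow> bool"
  where "is_stiefel_measure M \<longleftrightarrow>
    sets M = sets (restrict_space borel stiefel) \<and>
    (\<forall>\<gamma>::real^'n^'n. orthogonal_matrix \<gamma> \<longrightarrow> distr M M (\<lambda>v. \<gamma> ** v) = M) \<and>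
    emeasure M (space M) = ennreal (stiefel_mass CARD('n) CARD('m))"

definition cosine_kernel ::
    "complex^('m::{finite,linorder}) \<Rightarrow> real^('m::{finite,linorder})^'n \<Rightarrow> real^('m::{finite,linorder})^'n \<Rightarrow> complex"
  where "cosine_kernel l u v = matrix_power (transpose u ** v ** transpose v ** u) l"

text \<open>The kernel argument is always positive semidefinite, and it is singular only for \<open>v\<close> in a
  null set, on which the value of the kernel is immaterial.\<close>

definition composite_cosine ::
    "(real^('m::{finite,linorder})^'n) measure \<Rightarrow> complex^('m::{finite,linorder}) \<Rightarrow> (real^('m::{finite,linorder})^'n \<Rightarrow> complex) \<Rightarrow> real^('m::{finite,linorder})^'n \<Rightarrow> complex"
  where "composite_cosine M l f u = (LINT v|M. f v * cosine_kernel l u v)"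

definition laplacian :: "('a::euclidean_space \<Rightarrow> complex) \<Rightarrow> 'a \<Rightarrow> complex"
  where "laplacian f x =
    (\<Sum>b\<in>Basis. vector_derivative (\<lambda>t. vector_derivative (\<lambda>s. f (x + s *\<^sub>R b)) (at t)) (at 0))"

definition H_polynomial :: "nat \<Rightarrow> (real^'m^'n \<Rightarrow> complex) \<Rightarrow> bool"
  where "H_polynomial k P \<longleftrightarrow>
    polynomial_function P \<and>
    (\<forall>x \<gamma>. orthogonal_matrix \<gamma> \<longrightarrow> P (x ** \<gamma>) = P x) \<and>
    (\<forall>x. laplacian P x = 0) \<and>
    (\<forall>x g. invertible g \<longrightarrow> P (x ** g) = complex_of_real (det g ^ k) * P x)"

definition Gamma_Omega_arg :: "complex^('m::{finite,linorder}) \<Rightarrow> 'm \<Rightarrow> complex"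
  where "Gamma_Omega_arg l a = (l $ a - of_nat (position a) + 1) / 2"

definition Gamma_Omega :: "complex^('m::{finite,linorder}) \<Rightarrow> complex"
  where "Gamma_Omega l =
    complex_of_real (pi powr (real CARD('m) * (real CARD('m) - 1) / 4)) *
    (\<Prod>a\<in>UNIV. Gamma (Gamma_Omega_arg l a))"

definition Gamma_Omega_regular :: "(complex^('m::{finite,linorder})) set"
  where "Gamma_Omega_regular = {l. \<forall>a. Gamma_Omega_arg l a \<notin> \<int>\<^sub>\<le>\<^sub>0}"

text \<open>\<^const>\<open>Gamma\<close> is \<open>0\<close> at its poles, so this quotient is the intended one only where
  none of the gamma factors has a pole.\<close>

definition mu_quotient :: "nat \<Rightarrow> nat \<Rightarrow> complex^('m::{finite,linorder}) \<Rightarrow> complex"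
  where "mu_quotient n k l =
    (Gamma_Omega (l + vec (of_nat CARD('m))) * Gamma_Omega (vec (of_nat k) - reverse_vec l)) /
    (Gamma_Omega (- reverse_vec l) * Gamma_Omega (l + vec (of_nat k) + vec (of_nat n)))"

definition mu_regular :: "nat \<Rightarrow> nat \<Rightarrow> (complex^('m::{finite,linorder})) set"
  where "mu_regular n k = {l.
    l + vec (of_nat CARD('m)) \<in> Gamma_Omega_regular \<and>
    vec (of_nat k) - reverse_vec l \<in> Gamma_Omega_regular \<and>
    - reverse_vec l \<in> Gamma_Omega_regular \<and>
    l + vec (of_nat k) + vec (of_nat n) \<in> Gamma_Omega_regular}"

text \<open>
  The meromorphic function \<open>\<mu>\<^sub>k\<close> with its removable singularities removed: the quotient is
  continuous on the dense open set of points where no gamma factor has a pole, and its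
  value elsewhere is the limit along that set.
\<close>

definition mu :: "nat \<Rightarrow> nat \<Rightarrow> complex^('m::{finite,linorder}) \<Rightarrow> complex"
  where "mu n k l = Lim (at l within mu_regular n k) (mu_quotient n k)"

end

theory Submission
  imports Defs "HOL-Probability.Distributions"
begin

text \<open>
  Let \<open>x\<close> be a standard Gaussian \<open>n \<times> m\<close> matrix and \<open>v\<close> a point of the Stiefel manifold. Then
  \<open>z = v' x\<close> is a square Gaussian matrix independent of \<open>x - v z\<close>. The mean value property of the
  harmonic polynomial \<open>P\<close> shows that the average of \<open>P (v z + (x - v z))\<close> over the second summand
  is \<open>P v\<close> times the Hermite-type polynomial \<open>E (det (z + i b))\<^sup>k\<close>, with \<open>b\<close> a further square
  Gaussian matrix. Householder reflections of the rows of \<open>z\<close> make \<open>z\<close> lower triangular with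
  independent diagonal entries, so that the Gaussian average of \<open>P x\<close> times the power function of
  \<open>z z' = v' x x' v\<close> becomes \<open>P v\<close> times a product of one-dimensional gamma integrals. Polar
  coordinates \<open>x = w g\<close>, in which \<open>w\<close> has the invariant distribution and \<open>g\<close> has a density
  proportional to \<open>|det g|\<^sup>n\<^sup>-\<^sup>m\<close> times a Gaussian factor, identify the same average with a
  product of gamma factors times the composite cosine transform of \<open>P\<close>. For odd \<open>k\<close>,
  right invariance under a reflection gives \<open>P = 0\<close>.
\<close>

subsection \<open>Linear changes of variables\<close>

text \<open>The kernel depends on \<open>w\<close> only through \<open>transpose v ** w\<close>. For
  Gaussian \<open>x\<close> the matrix \<open>z = transpose v ** x\<close> has independent rows,
  which the invariant measure does not offer. The price: \<open>P (v ** z + y)\<close> is not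
  \<open>det z ^ k * P v\<close>. Averaging over \<open>y\<close> yields instead the polynomial in
  \<open>z\<close> whose Gaussian convolution is the \<open>k\<close>-th power of
  \<open>det\<close>; it is unique because convolution is injective on polynomials. For m = 1 it is
  the Hermite polynomial.

  The diagonal entry in row \<open>a\<close> is a chi variable with \<nu> =
  \<open>card {a..}\<close> = m + 1 - p degrees of freedom, p the position of \<open>a\<close>. So
  the bound on the real part of the p-th exponent is the convergence of the corresponding moment.
  For k = 2 j, the Hermite polynomial contributes the product of (exponent + \<nu> - 1 - 2 i) over i
  < j. This is the quotient of the gamma functions at k minus, and at minus, the reversed exponents.
  It stays regular at their poles, and its sign supplies the power of the imaginary unit. The
  constants of the radial densities and of polar coordinates are fixed by total mass; the power of
  pi comes from a ratio of sphere areas.\<close>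

definition lborel_scaling :: "('a::euclidean_space \<Rightarrow> 'a) \<Rightarrow> ennreal \<Rightarrow> bool" where
  "lborel_scaling f c \<longleftrightarrow>
    (\<forall>g\<in>borel_measurable borel. (\<integral>\<^sup>+x. g (f x) \<partial>lborel) = c * (\<integral>\<^sup>+x. g x \<partial>lborel))"

lemma borel_measurable_linear [measurable (raw)]:
  fixes f :: "'a::euclidean_space \<Rightarrow> 'b::real_normed_vector"
  assumes "linear f"
  shows "f \<in> borel_measurable borel"
  using assms linear_continuous_on linear_conv_bounded_linear borel_measurable_continuous_onI by metis

lemma nn_integral_lborel_translate:
  fixes g :: "'a::euclidean_space \<Rightarrow> ennreal"
  assumes [measurable]: "g \<in> borel_measurable borel"
  shows "(\<integral>\<^sup>+x. g (a + x) \<partial>lborel) = (\<integral>\<^sup>+x. g x \<partial>lborel)"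
  using nn_integral_distr[of "(+) a" lborel borel g] lborel_distr_plus[of a] by simp

text \<open>
  The image of Lebesgue measure under \<open>f\<close> is translation invariant. Two such measures \<open>N\<close> and
  \<open>L\<close> are proportional, as one sees by evaluating the double integral of \<open>g (x + y) b (y)\<close> in
  both orders.
\<close>

lemma lborel_scaling_exists:
  fixes f :: "'a::euclidean_space \<Rightarrow> 'a"
  assumes lin: "linear f" and surj: "surj f"
  shows "\<exists>c. lborel_scaling f c"
proof -
  define b :: "'a \<Rightarrow> ennreal" where "b = indicator (cbox 0 One)"
  have [measurable]: "b \<in> borel_measurable borel" "f \<in> borel_measurable borel"
    using lin by (auto simp: b_def intro: borel_measurable_linear)
  have b1: "(\<integral>\<^sup>+x. b x \<partial>lborel) = 1"
    by (simp add: b_def emeasure_lborel_cbox_eq)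
  have inv: "(\<integral>\<^sup>+x. h (f x + y) \<partial>lborel) = (\<integral>\<^sup>+x. h (f x) \<partial>lborel)"
    if [measurable]: "h \<in> borel_measurable borel" for h :: "'a \<Rightarrow> ennreal" and y
  proof -
    obtain z where "y = f z" using surj by blast
    then have "f x + y = f (z + x)" for x
      using lin by (simp add: linear_add add.commute)
    then show ?thesis
      using nn_integral_lborel_translate[of "\<lambda>x. h (f x)" z] by simp
  qed
  have "(\<integral>\<^sup>+x. g (f x) \<partial>lborel) = (\<integral>\<^sup>+x. b (- f x) \<partial>lborel) * (\<integral>\<^sup>+x. g x \<partial>lborel)"
    if [measurable]: "g \<in> borel_measurable borel" for g :: "'a \<Rightarrow> ennreal"
  proof -
    have "(\<integral>\<^sup>+x. g (f x) \<partial>lborel) = (\<integral>\<^sup>+y. b y * (\<integral>\<^sup>+x. g (f x) \<partial>lborel) \<partial>lborel)"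
      by (simp add: nn_integral_multc b1)
    also have "\<dots> = (\<integral>\<^sup>+y. b y * (\<integral>\<^sup>+x. g (f x + y) \<partial>lborel) \<partial>lborel)"
      by (simp add: inv)
    also have "\<dots> = (\<integral>\<^sup>+y. (\<integral>\<^sup>+x. b y * g (f x + y) \<partial>lborel) \<partial>lborel)"
      by (simp add: nn_integral_cmult)
    also have "\<dots> = (\<integral>\<^sup>+x. (\<integral>\<^sup>+y. b y * g (f x + y) \<partial>lborel) \<partial>lborel)"
      by (intro lborel_pair.Fubini') measurable
    also have "\<dots> = (\<integral>\<^sup>+x. (\<integral>\<^sup>+y. b (- f x + y) * g y \<partial>lborel) \<partial>lborel)"
      using nn_integral_lborel_translate[of "\<lambda>y. b (- f x + y) * g y" "f x" for x] by simp
    also have "\<dots> = (\<integral>\<^sup>+y. (\<integral>\<^sup>+x. b (- f x + y) * g y \<partial>lborel) \<partial>lborel)"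
      by (intro lborel_pair.Fubini') measurable
    also have "\<dots> = (\<integral>\<^sup>+y. (\<integral>\<^sup>+x. b (- f x) \<partial>lborel) * g y \<partial>lborel)"
    proof (rule nn_integral_cong)
      fix y
      have "(\<integral>\<^sup>+x. b (- (f x + (- y))) \<partial>lborel) = (\<integral>\<^sup>+x. b (- f x) \<partial>lborel)"
        by (intro inv) measurable
      then show "(\<integral>\<^sup>+x. b (- f x + y) * g y \<partial>lborel) = (\<integral>\<^sup>+x. b (- f x) \<partial>lborel) * g y"
        by (simp add: nn_integral_multc add.commute)
    qed
    also have "\<dots> = (\<integral>\<^sup>+x. b (- f x) \<partial>lborel) * (\<integral>\<^sup>+x. g x \<partial>lborel)"
      by (simp add: nn_integral_cmult)
    finally show ?thesis .
  qed
  then show ?thesis unfolding lborel_scaling_def by blast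
qed

lemma lborel_scaling_unique:
  assumes "lborel_scaling f c" "lborel_scaling f d"
  shows "c = d"
proof -
  let ?b = "indicator (cbox 0 One) :: 'a \<Rightarrow> ennreal"
  have "(\<integral>\<^sup>+x. ?b x \<partial>lborel) = 1"
    by (simp add: emeasure_lborel_cbox_eq)
  then have "(\<integral>\<^sup>+x. ?b (f x) \<partial>lborel) = c" "(\<integral>\<^sup>+x. ?b (f x) \<partial>lborel) = d"
    using assms[unfolded lborel_scaling_def, rule_format, of ?b] by simp_all
  then show ?thesis by simp
qed

lemma lborel_scaling_id: "lborel_scaling (\<lambda>x. x) 1"
  by (simp add: lborel_scaling_def)

lemma lborel_scaling_compose:
  assumes "lborel_scaling f c" "lborel_scaling h d" "linear h"
  shows "lborel_scaling (\<lambda>x. h (f x)) (c * d)"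
proof -
  have [measurable]: "h \<in> borel_measurable borel"
    using assms by (intro borel_measurable_linear)
  show ?thesis
    using assms(1)[unfolded lborel_scaling_def, rule_format, of "\<lambda>x. g (h x)" for g]
      assms(2)[unfolded lborel_scaling_def, rule_format]
    by (auto simp: lborel_scaling_def mult.assoc)
qed

lemma surj_norm_preserving:
  fixes f :: "'a::euclidean_space \<Rightarrow> 'a"
  assumes "linear f" "\<And>x. norm (f x) = norm x"
  shows "surj f"
  using assms by (metis linear_injective_0 linear_injective_imp_surjective norm_eq_zero)

text \<open>The unit ball is its own preimage and has positive finite measure, so the unknown factor
  cancels.\<close>

lemma lborel_scaling_norm_preserving:
  fixes f :: "'a::euclidean_space \<Rightarrow> 'a"
  assumes f: "linear f" "\<And>x. norm (f x) = norm x"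
  shows "lborel_scaling f 1"
proof -
  obtain c where c: "lborel_scaling f c"
    using lborel_scaling_exists surj_norm_preserving f by blast
  let ?b = "indicator (cball 0 1) :: 'a \<Rightarrow> ennreal"
  have "(\<lambda>x. ?b (f x)) = ?b"
    using f by (auto simp: fun_eq_iff indicator_def)
  then have "emeasure lborel (cball (0::'a) 1) = c * emeasure lborel (cball (0::'a) 1)"
    using c[unfolded lborel_scaling_def, rule_format, of ?b] borel_measurable_indicator[of "cball (0::'a) 1" borel]
    by simp
  moreover have "emeasure lborel (cball (0::'a) 1) = ennreal (measure lborel (cball (0::'a) 1))"
    by (intro emeasure_eq_ennreal_measure) (metis emeasure_bounded_finite bounded_cball infinity_ennreal_def top.not_eq_extremum)
  moreover have "measure lborel (cball (0::'a) 1) > 0" by simp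
  moreover define m where "m = measure lborel (cball (0::'a) 1)"
  ultimately have "1 * ennreal m = c * ennreal m" "m > 0"
    by (simp_all add: m_def)
  then have "c = 1"
    by (simp only: mult_right_ennreal_cancel) auto
  then show ?thesis using c by simp
qed

section \<open>Matrix products as changes of variables\<close>

lemma linear_matrix_mult_right: "linear (\<lambda>x::real^'m^'n. x ** (t::real^'k^'m))"
  by (rule linearI) (simp_all add: matrix_matrix_mult_def vec_eq_iff sum.distrib ring_distribs sum_distrib_left mult.assoc)

lemma linear_matrix_mult_left: "linear (\<lambda>x::real^'k^'m. (t::real^'m^'n) ** x)"
  by (rule linearI) (simp_all add: matrix_matrix_mult_def vec_eq_iff sum.distrib ring_distribs sum_distrib_left mult.left_commute)

lemma linear_transpose: "linear (\<lambda>x::real^'m^'n. transpose x)"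
  by (rule linearI) (simp_all add: transpose_def vec_eq_iff)

lemma inner_matrix: "(x::real^'m^'n) \<bullet> y = (\<Sum>i\<in>UNIV. \<Sum>j\<in>UNIV. x$i$j * y$i$j)"
  by (simp add: inner_vec_def)

lemma norm_matrix_sq: "(norm (x::real^'m^'n))\<^sup>2 = (\<Sum>i\<in>UNIV. \<Sum>j\<in>UNIV. (x$i$j)\<^sup>2)"
  unfolding power2_norm_eq_inner inner_matrix by (simp add: power2_eq_square)

lemma norm_transpose: "norm (transpose (x::real^'m^'n)) = norm x"
proof -
  have "(norm (transpose x))\<^sup>2 = (norm x)\<^sup>2"
    unfolding norm_matrix_sq by (subst sum.swap) (simp add: transpose_def)
  then show ?thesis by simp
qed

lemma norm_stiefel_mult:
  fixes v :: "real^'m^'n" and x :: "real^'k^'m"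
  assumes "transpose v ** v = mat 1"
  shows "norm (v ** x) = norm x"
proof -
  have "(\<Sum>l\<in>UNIV. v$l$i * v$l$j) = (if i = j then 1 else 0)" for i j
    using assms by (simp add: vec_eq_iff matrix_matrix_mult_def transpose_def mat_def)
  note o = this
  have "(norm (v ** x))\<^sup>2 = (\<Sum>l\<in>UNIV. \<Sum>a\<in>UNIV. \<Sum>i\<in>UNIV. \<Sum>j\<in>UNIV. v$l$i * v$l$j * (x$i$a * x$j$a))"
    unfolding norm_matrix_sq
    by (simp add: matrix_matrix_mult_def power2_eq_square sum_product mult_ac)
  also have "\<dots> = (\<Sum>a\<in>UNIV. \<Sum>i\<in>UNIV. \<Sum>j\<in>UNIV. (\<Sum>l\<in>UNIV. v$l$i * v$l$j) * (x$i$a * x$j$a))"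
    apply (subst sum.swap, rule sum.cong[OF refl])
    apply (subst sum.swap, rule sum.cong[OF refl])
    apply (subst sum.swap, rule sum.cong[OF refl])
    by (simp add: sum_distrib_right)
  also have "\<dots> = (\<Sum>a\<in>UNIV. \<Sum>i\<in>UNIV. (x$i$a)\<^sup>2)"
    by (simp add: o if_distrib[of "\<lambda>u. u * _"] power2_eq_square cong: if_cong)
  also have "\<dots> = (norm x)\<^sup>2"
    unfolding norm_matrix_sq by (rule sum.swap)
  finally show ?thesis by simp
qed

lemma norm_orthogonal_mult:
  "orthogonal_matrix (q::real^'m^'m) \<Longrightarrow> norm (q ** (x::real^'k^'m)) = norm x"
  by (intro norm_stiefel_mult) (simp add: orthogonal_matrix_def)

lemma norm_mult_orthogonal:
  assumes "orthogonal_matrix (q::real^'m^'m)"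
  shows "norm ((x::real^'m^'k) ** q) = norm x"
proof -
  have "norm (x ** q) = norm (transpose q ** transpose x)"
    by (metis norm_transpose matrix_transpose_mul)
  also have "\<dots> = norm x"
    using assms by (simp add: norm_orthogonal_mult norm_transpose)
  finally show ?thesis .
qed

lemma lborel_scaling_diagonal_map:
  fixes c :: "'a::euclidean_space \<Rightarrow> real"
  assumes c: "\<And>b. b \<in> Basis \<Longrightarrow> c b \<noteq> 0"
  shows "lborel_scaling (\<lambda>x. \<Sum>b\<in>Basis. (c b * (x \<bullet> b)) *\<^sub>R b) (ennreal (1 / (\<Prod>b\<in>Basis. \<bar>c b\<bar>)))"
  unfolding lborel_scaling_def
proof
  let ?T = "\<lambda>x::'a. \<Sum>b\<in>Basis. (c b * (x \<bullet> b)) *\<^sub>R b" and ?p = "\<Prod>b\<in>Basis. \<bar>c b\<bar>"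
  fix g :: "'a \<Rightarrow> ennreal" assume [measurable]: "g \<in> borel_measurable borel"
  have p: "?p > 0" using c by (intro prod_pos) auto
  have [measurable]: "?T \<in> borel_measurable borel" by simp
  have "lborel = density (distr lborel borel ?T) (\<lambda>_. ennreal ?p)"
    using lborel_affine_euclidean[of c 0] c by simp
  then have "(\<integral>\<^sup>+x. g x \<partial>lborel) = (\<integral>\<^sup>+x. g x \<partial>density (distr lborel borel ?T) (\<lambda>_. ennreal ?p))"
    by simp
  also have "\<dots> = ennreal ?p * (\<integral>\<^sup>+x. g (?T x) \<partial>lborel)"
    by (simp add: nn_integral_density nn_integral_distr nn_integral_cmult)
  finally have "ennreal (1 / ?p) * (\<integral>\<^sup>+x. g x \<partial>lborel)
      = (ennreal (1 / ?p) * ennreal ?p) * (\<integral>\<^sup>+x. g (?T x) \<partial>lborel)"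
    by (simp add: mult.assoc)
  also have "ennreal (1 / ?p) * ennreal ?p = ennreal (1 / ?p * ?p)"
    using p by (intro ennreal_mult[symmetric]) auto
  also have "1 / ?p * ?p = 1"
    using p by (metis less_irrefl nonzero_eq_divide_eq)
  finally show "(\<integral>\<^sup>+x. g (?T x) \<partial>lborel) = ennreal (1 / ?p) * (\<integral>\<^sup>+x. g x \<partial>lborel)"
    by (simp only: ennreal_1 mult_1)
qed

lemma Basis_matrixE: "b \<in> (Basis::(real^'m^'n) set) \<Longrightarrow> \<exists>i j. b = axis i (axis j 1)"
  by (auto simp: Basis_vec_def)

lemma prod_Basis_matrix:
  "(\<Prod>b\<in>(Basis::(real^'m^'n) set). f b) = (\<Prod>i\<in>UNIV. \<Prod>j\<in>UNIV. f (axis i (axis j 1)))"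
proof -
  have "bij_betw (\<lambda>(i, j). axis i (axis j 1)) UNIV (Basis::(real^'m^'n) set)"
    by (auto simp: bij_betw_def inj_on_def Basis_vec_def axis_eq_axis image_def axis_eq_0_iff) 
  then have "(\<Prod>b\<in>(Basis::(real^'m^'n) set). f b) = (\<Prod>(i, j)\<in>UNIV. f (axis i (axis j 1)))"
    by (simp add: prod.reindex_bij_betw[symmetric] case_prod_beta')
  then show ?thesis
    by (simp add: prod.cartesian_product)
qed

lemma det_orthogonal_abs: "orthogonal_matrix (q::real^'m^'m) \<Longrightarrow> \<bar>det q\<bar> = 1"
  using det_orthogonal_matrix by fastforce

text \<open>
  A shear is conjugate to its inverse by a reflection, so its scaling factor is \<open>1\<close>.
\<close>

lemma lborel_scaling_mult_right:
  fixes t :: "real^'m^'m"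
  assumes "det t \<noteq> 0"
  shows "lborel_scaling (\<lambda>x::real^'m^'n. x ** t) (ennreal (1 / \<bar>det t\<bar> ^ CARD('n)))"
proof -
  let ?S = "\<lambda>A. lborel_scaling (\<lambda>x::real^'m^'n. x ** A)"
  let ?P = "\<lambda>A. det A \<noteq> 0 \<longrightarrow> ?S A (ennreal (1 / \<bar>det A\<bar> ^ CARD('n)))"
  have orth: "?S q 1" if "orthogonal_matrix q" for q
    by (intro lborel_scaling_norm_preserving linear_matrix_mult_right norm_mult_orthogonal that)
  have mult: "?S (A ** B) (c * d)" if "?S A c" "?S B d" for A B c d
    using lborel_scaling_compose[OF that linear_matrix_mult_right] by (simp add: matrix_mul_assoc)
  \<comment> \<open>Nonvanishing of the determinant belongs to the predicate, because singular
    matrices occur among the elementary cases: a zero row then holds vacuously, and a product splits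
    since both its determinants are nonzero.\<close>
  have "?P t"
  proof (rule induct_matrix_elementary_alt)
    fix A B :: "real^'m^'m" assume "?P A" "?P B"
    then show "?P (A ** B)"
      using mult[of A "ennreal (1 / \<bar>det A\<bar> ^ CARD('n))" B "ennreal (1 / \<bar>det B\<bar> ^ CARD('n))"]
      by (auto simp: det_mul abs_mult power_mult_distrib ennreal_mult'[symmetric])
  next
    fix A :: "real^'m^'m" and i assume "row i A = 0"
    then show "?P A" by (simp add: det_zero_row(2))
  next
    fix A :: "real^'m^'m" assume A: "\<And>i j. i \<noteq> j \<Longrightarrow> A $ i $ j = 0"
    define c :: "real^'m^'n \<Rightarrow> real" where "c b = (\<Sum>i\<in>UNIV. \<Sum>j\<in>UNIV. A$j$j * b$i$j)" for b
    have ifs: "(\<Sum>b\<in>UNIV. if P then f b else 0) = (if P then sum f UNIV else 0)" for P and f :: "'m \<Rightarrow> real"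
      by simp
    have c: "c (axis i (axis j 1)) = A$j$j" for i j
      by (simp add: c_def axis_def if_distrib[of "\<lambda>u. u $ _"] if_distrib[of "\<lambda>u. _ * u"] ifs cong: if_cong)
    have dA: "det A = (\<Prod>j\<in>UNIV. A$j$j)" by (intro det_diagonal A)
    show "?P A"
    proof
      assume "det A \<noteq> 0"
      then have nz: "A$j$j \<noteq> 0" for j by (simp add: dA)
      have "(\<lambda>x. x ** A) = (\<lambda>x. \<Sum>b\<in>Basis. (c b * (x \<bullet> b)) *\<^sub>R b)"
      proof
        fix x :: "real^'m^'n"
        have "(x ** A)$i$j = x$i$j * A$j$j" for i j
        proof -
          have "(x ** A)$i$j = (\<Sum>k\<in>UNIV. if k = j then x$i$j * A$j$j else 0)"
            unfolding matrix_matrix_mult_def vec_lambda_beta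
            by (rule sum.cong) (auto simp: A)
          then show ?thesis by simp
        qed
        then have "(x ** A) \<bullet> axis i (axis j 1) = c (axis i (axis j 1)) * (x \<bullet> axis i (axis j 1))" for i j
          by (simp add: inner_axis c)
        note * = this
        have "(x ** A) \<bullet> b = c b * (x \<bullet> b)" if b: "b \<in> Basis" for b
        proof -
          obtain i j where "b = axis i (axis j 1)"
            using Basis_matrixE[OF b] by metis
          then show ?thesis using *[of i j] by (simp only:)
        qed
        then show "x ** A = (\<Sum>b\<in>Basis. (c b * (x \<bullet> b)) *\<^sub>R b)"
          by - (rule euclidean_eqI, simp only: inner_sum_left_Basis)
      qed
      moreover have "\<And>b. b \<in> Basis \<Longrightarrow> c b \<noteq> 0"
        using c nz by (auto simp: Basis_vec_def)
      moreover have "(\<Prod>b\<in>Basis. \<bar>c b\<bar>) = \<bar>det A\<bar> ^ CARD('n)"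
        by (simp add: prod_Basis_matrix c dA abs_prod)
      ultimately show "?S A (ennreal (1 / \<bar>det A\<bar> ^ CARD('n)))"
        using lborel_scaling_diagonal_map[of c] by simp
    qed
  next
    fix m n :: 'm assume "m \<noteq> n"
    let ?q = "(\<chi> i j. mat 1 $ i $ Transposition.transpose m n j) :: real^'m^'m"
    have q: "orthogonal_matrix ?q"
      unfolding orthogonal_matrix
      by (auto simp: vec_eq_iff matrix_matrix_mult_def transpose_def mat_def Transposition.transpose_def 
          if_distrib[of "\<lambda>u. u * _"] cong: if_cong)
    then show "?P ?q"
      using orth by (simp add: det_orthogonal_abs)
  next
    fix m n :: 'm assume mn: "m \<noteq> n"
    define E :: "real^'m^'m" where "E = (\<chi> i j. of_bool (i = m \<and> j = n \<or> i = j))"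
    define D :: "real^'m^'m" where "D = (\<chi> i j. if i = j then if i = m then - 1 else 1 else 0)"
    have D: "orthogonal_matrix D"
      unfolding orthogonal_matrix
      by (auto simp: D_def vec_eq_iff matrix_matrix_mult_def transpose_def mat_def
          if_distrib[of "\<lambda>u. u * _"] cong: if_cong)
    have "det E \<noteq> 0 \<and> ?S E 1 \<and> \<bar>det E\<bar> = 1"
    proof -
      \<comment> \<open>\<open>F = D ** E\<close> is an involution, and the norm preserving
        reflection \<open>D\<close> contributes the factor 1. Applying \<open>F\<close> twice
        therefore gives \<open>c * c = 1\<close> for the factor \<open>c\<close> of the
        shear.\<close>
      define F :: "real^'m^'m" where "F = (\<chi> i j. if i = m then (if j = m \<or> j = n then - 1 else 0) else of_bool (i = j))"
      have DE: "D ** E = F"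
        using mn by (auto simp: D_def E_def F_def vec_eq_iff matrix_matrix_mult_def if_distrib[of "\<lambda>u. u * _"] cong: if_cong)
      have "(F ** F) $ i $ j = mat 1 $ i $ j" for i j
      proof (cases "i = m")
        case True
        have "(F ** F) $ i $ j = (\<Sum>k\<in>{m, n}. F $ i $ k * F $ k $ j)"
          unfolding matrix_matrix_mult_def[of F] vec_lambda_beta
          by (rule sum.mono_neutral_right) (auto simp: True F_def)
        then show ?thesis using mn True by (auto simp: mat_def F_def)
      next
        case False
        have "(F ** F) $ i $ j = (\<Sum>k\<in>{i}. F $ i $ k * F $ k $ j)"
          unfolding matrix_matrix_mult_def[of F] vec_lambda_beta
          by (rule sum.mono_neutral_right) (auto simp: False F_def)
        then show ?thesis using False by (auto simp: mat_def F_def)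
      qed
      note FF = this
      have "F ** F = mat 1"
        by (rule vec_eq_iff[THEN iffD2], rule allI, rule vec_eq_iff[THEN iffD2], rule allI, rule FF)
      then have inv: "(D ** E) ** (D ** E) = mat 1"
        by (simp only: DE)
      have abs1: "\<bar>d\<bar> = 1" if "d * d = 1" for d :: real
        using that square_eq_1_iff[of d] by auto
      have sq: "det (D ** E) * det (D ** E) = 1"
        by (metis inv det_mul det_I)
      have aD: "\<bar>det D\<bar> = 1" using D by (rule det_orthogonal_abs)
      have "\<bar>det (D ** E)\<bar> = 1"
        by (rule abs1[OF sq])
      then have dE: "\<bar>det E\<bar> = 1" using aD by (simp add: det_mul abs_mult)
      then have nz: "det E \<noteq> 0" by auto
      have "surj (\<lambda>x::real^'m^'n. x ** E)"
      proof -
        obtain B where "B ** E = mat 1" using nz invertible_det_nz[of E] invertible_def by blast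
        then have "x = (x ** B) ** E" for x :: "real^'m^'n" by (simp add: matrix_mul_assoc[symmetric])
        then show ?thesis by (metis surjI)
      qed
      then obtain c where c: "?S E c"
        using lborel_scaling_exists[OF linear_matrix_mult_right] by blast
      have "?S (D ** E) c" using mult[OF orth[OF D] c] by simp
      from mult[OF this this] have "?S (mat 1) (c * c)" by (simp add: inv)
      then have "c * c = 1"
        using lborel_scaling_unique lborel_scaling_id by (metis (no_types, lifting) ext matrix_mul_rid)
      then have "c = 1"
      proof (cases c)
        case (real r)
        with \<open>c * c = 1\<close> have "ennreal (r * r) = ennreal 1"
          by (simp add: ennreal_mult)
        with real have "r * r = 1" by (subst (asm) ennreal_inj) auto
        with real show ?thesis
          using square_eq_1_iff[of r] by auto
      qed (simp add: ennreal_top_mult)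
      with c nz dE show ?thesis by simp
    qed
    then have "?P E" by simp
    then show "?P (\<chi> i j. of_bool (i = m \<and> j = n \<or> i = j))" by (simp only: E_def)
  qed
  with assms show ?thesis by blast
qed

text \<open>Transposition preserves the norm and turns left multiplication into right
  multiplication.\<close>

lemma lborel_scaling_mult_left:
  fixes t :: "real^'m^'m"
  assumes "det t \<noteq> 0"
  shows "lborel_scaling (\<lambda>x::real^'m^'m. t ** x) (ennreal (1 / \<bar>det t\<bar> ^ CARD('m)))"
proof -
  have T: "lborel_scaling (\<lambda>x::real^'m^'m. transpose x) 1"
    by (intro lborel_scaling_norm_preserving linear_transpose norm_transpose)
  have "lborel_scaling (\<lambda>x::real^'m^'m. transpose x ** transpose t) (1 * ennreal (1 / \<bar>det t\<bar> ^ CARD('m)))"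
    using lborel_scaling_compose[OF T lborel_scaling_mult_right[of "transpose t"] linear_matrix_mult_right] assms
    by (simp add: det_transpose)
  from lborel_scaling_compose[OF this T linear_transpose] show ?thesis by (simp add: matrix_transpose_mul transpose_transpose)
qed

subsection \<open>Standard Gaussian measure\<close>

definition gauss_density :: "'a::euclidean_space \<Rightarrow> real" where
  "gauss_density x = exp (- (norm x)\<^sup>2 / 2) / sqrt (2 * pi) ^ DIM('a)"

definition gauss :: "'a::euclidean_space measure" where
  "gauss = density lborel (\<lambda>x. ennreal (gauss_density x))"

lemma gauss_density_pos: "gauss_density x > 0"
  by (simp add: gauss_density_def)

lemma gauss_density_measurable [measurable]: "gauss_density \<in> borel_measurable borel"
  unfolding gauss_density_def by measurable

lemma sets_gauss [measurable_cong, simp]: "sets gauss = sets borel"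
  by (simp add: gauss_def)

lemma space_gauss [simp]: "space gauss = UNIV"
  by (simp add: gauss_def)

lemma gauss_density_prod: "gauss_density (x::'a::euclidean_space) = (\<Prod>b\<in>Basis. std_normal_density (x \<bullet> b))"
proof -
  have "(norm x)\<^sup>2 = (\<Sum>b\<in>Basis. (x \<bullet> b)\<^sup>2)"
    unfolding power2_norm_eq_inner by (subst euclidean_inner) (simp add: power2_eq_square)
  then have "exp (- (norm x)\<^sup>2 / 2) = (\<Prod>b\<in>Basis. exp (- (x \<bullet> b)\<^sup>2 / 2))"
    by (simp add: exp_sum[symmetric] sum_negf sum_divide_distrib)
  then show ?thesis
    by (simp add: gauss_density_def std_normal_density_def prod_dividef prod.distrib)
qed

lemma prob_space_gauss: "prob_space (gauss :: 'a::euclidean_space measure)"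
proof
  have "(\<integral>\<^sup>+x. ennreal (std_normal_density x) \<partial>lborel) = 1"
    using prob_space.emeasure_space_1[OF prob_space_normal_density[of 1 0]]
    by (simp add: emeasure_density)
  moreover have "(\<integral>\<^sup>+x. (\<Prod>b\<in>Basis. ennreal (std_normal_density (x \<bullet> b))) \<partial>(lborel::'a measure))
      = (\<Prod>b\<in>(Basis::'a set). \<integral>\<^sup>+x. ennreal (std_normal_density x) \<partial>lborel)"
    by (rule nn_integral_lborel_prod) auto
  ultimately show "emeasure (gauss::'a measure) (space gauss) = 1"
    by (simp add: gauss_def emeasure_density gauss_density_prod prod_ennreal)
qed

interpretation gauss: prob_space gauss
  by (rule prob_space_gauss)

interpretation gauss_pair: pair_prob_space gauss gauss ..

lemma nn_integral_gauss:
  fixes f :: "'a::euclidean_space \<Rightarrow> ennreal"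
  assumes [measurable]: "f \<in> borel_measurable borel"
  shows "(\<integral>\<^sup>+x. f x \<partial>gauss) = (\<integral>\<^sup>+x. ennreal (gauss_density x) * f x \<partial>lborel)"
  unfolding gauss_def by (rule nn_integral_density) measurable

lemma AE_gauss_iff: "(AE x in gauss. P x) \<longleftrightarrow> (AE x in lborel. P x)"
  unfolding gauss_def by (subst AE_density) (auto simp: gauss_density_pos)

lemma gauss_real: "(gauss :: real measure) = density lborel (\<lambda>x. ennreal (std_normal_density x))"
  unfolding gauss_def gauss_density_def std_normal_density_def by (simp add: mult.commute)

lemma distr_gauss_norm_preserving:
  fixes f :: "'a::euclidean_space \<Rightarrow> 'a"
  assumes f: "linear f" "\<And>x. norm (f x) = norm x"
  shows "distr gauss borel f = gauss"
proof (rule measure_eqI)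
  fix A assume "A \<in> sets (distr gauss borel f)"
  then have A [measurable]: "A \<in> sets borel" by simp
  have [measurable]: "f \<in> borel_measurable borel" using f by (intro borel_measurable_linear)
  have "emeasure (distr gauss borel f) A = (\<integral>\<^sup>+x. indicator A (f x) \<partial>gauss)"
    using nn_integral_distr[of f gauss borel "indicator A"] by simp
  also have "\<dots> = (\<integral>\<^sup>+x. ennreal (gauss_density (f x)) * indicator A (f x) \<partial>lborel)"
    by (subst nn_integral_gauss) (auto simp: gauss_density_def f)
  also have "\<dots> = (\<integral>\<^sup>+x. ennreal (gauss_density x) * indicator A x \<partial>lborel)"
    using lborel_scaling_norm_preserving[OF f] unfolding lborel_scaling_def
    by (drule_tac bspec[where x = "\<lambda>x. ennreal (gauss_density x) * indicator A x"]) auto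
  also have "\<dots> = emeasure gauss A"
    by (subst nn_integral_gauss[symmetric]) auto
  finally show "emeasure (distr gauss borel f) A = emeasure gauss A" .
qed simp

lemma gauss_prod:
  "(gauss :: ('a::euclidean_space \<times> 'b::euclidean_space) measure) = gauss \<Otimes>\<^sub>M gauss"
proof -
  have "gauss_density (x, y) = gauss_density x * gauss_density y" for x :: 'a and y :: 'b
    by (simp add: gauss_density_def norm_Pair power_add exp_add[symmetric] add_divide_distrib)
  then have e: "(\<lambda>z::'a \<times> 'b. ennreal (gauss_density z)) =
      (\<lambda>(x, y). ennreal (gauss_density x) * ennreal (gauss_density y))"
    by (auto simp: fun_eq_iff ennreal_mult gauss_density_pos less_imp_le)
  have "(gauss :: ('a \<times> 'b) measure) = density (lborel \<Otimes>\<^sub>M lborel)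
      (\<lambda>(x, y). ennreal (gauss_density x) * ennreal (gauss_density y))"
    unfolding gauss_def e lborel_prod ..
  also have "\<dots> = gauss \<Otimes>\<^sub>M gauss"
    unfolding gauss_def
    by (rule pair_measure_density[symmetric])
      (auto intro: sigma_finite_lborel prob_space_imp_sigma_finite prob_space_gauss[unfolded gauss_def])
  finally show ?thesis .
qed

text \<open>
  If \<open>U\<close> is a partial isometry with adjoint \<open>V\<close>, then a Gaussian vector can be resampled along
  the range of \<open>U\<close>: the map \<open>(a, y) \<mapsto> (V y + a - V (U a), U a + y - U (V y))\<close> is orthogonal.
\<close>

definition partial_isometry :: "('a::euclidean_space \<Rightarrow> 'b::euclidean_space) \<Rightarrow> ('b \<Rightarrow> 'a) \<Rightarrow> bool" where
  "partial_isometry U V \<longleftrightarrow>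
    linear U \<and> linear V \<and> (\<forall>a y. U a \<bullet> y = a \<bullet> V y) \<and> (\<forall>a. U (V (U a)) = U a)"

lemma distr_gauss_resample:
  assumes UV: "partial_isometry U V"
  shows "distr (gauss \<Otimes>\<^sub>M gauss) borel (\<lambda>(a, y). U a + (y - U (V y))) = gauss"
proof -
  have lin: "linear U" "linear V" and adj: "U a \<bullet> y = a \<bullet> V y" and inv: "U (V (U a)) = U a" for a y
    using UV by (auto simp: partial_isometry_def)
  \<comment> \<open>The relation dual to \<open>inv\<close>, obtained by passing to adjoints. With
    both, the composites of \<open>U\<close> and \<open>V\<close> are orthogonal
    projections.\<close>
  have inv': "V (U (V y)) = V y" for y
  proof -
    have "a \<bullet> V (U (V y)) = a \<bullet> V y" for a
    proof -
      have "a \<bullet> V (U (V y)) = U a \<bullet> U (V y)" by (simp only: adj)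
      also have "\<dots> = U (V y) \<bullet> U a" by (rule inner_commute)
      also have "\<dots> = V y \<bullet> V (U a)" by (simp only: adj)
      also have "\<dots> = V (U a) \<bullet> V y" by (rule inner_commute)
      also have "\<dots> = U (V (U a)) \<bullet> y" by (simp only: adj)
      also have "\<dots> = a \<bullet> V y" by (simp only: inv adj)
      finally show ?thesis .
    qed
    then show ?thesis by (metis vector_eq_ldot)
  qed
  define F where "F z = (V (snd z) + (fst z - V (U (fst z))), U (fst z) + (snd z - U (V (snd z))))" for z
  have [measurable]: "U \<in> borel_measurable borel" "V \<in> borel_measurable borel"
    using lin by (auto intro: borel_measurable_linear)
  have linF: "linear F"
    unfolding F_def
    by (rule linearI) (auto simp: linear_add[OF lin(1)] linear_add[OF lin(2)] linear_scale[OF lin(1)]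
        linear_scale[OF lin(2)] algebra_simps)
  have "norm (F z) = norm z" for z
  proof -
    obtain a y where z: "z = (a, y)" by (cases z)
    define w u where "w = y - U (V y)" and "u = a - V (U a)"
    have wu: "U a \<bullet> w = 0" "w \<bullet> U a = 0" "V y \<bullet> u = 0" "u \<bullet> V y = 0"
    proof -
      show "U a \<bullet> w = 0"
        by (simp add: adj w_def linear_diff[OF lin(2)] inv')
      then show "w \<bullet> U a = 0" by (simp add: inner_commute)
      have "u \<bullet> V y = U u \<bullet> y" by (simp only: adj)
      then show "u \<bullet> V y = 0" by (simp add: u_def linear_diff[OF lin(1)] inv)
      then show "V y \<bullet> u = 0" by (simp add: inner_commute)
    qed
    have "y \<bullet> y = (w + U (V y)) \<bullet> (w + U (V y))" by (simp add: w_def)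
    also have "\<dots> = w \<bullet> w + V y \<bullet> V y"
    proof -
      have "U (V y) \<bullet> w = V y \<bullet> V w" by (simp only: adj)
      also have "V w = 0" by (simp add: w_def linear_diff[OF lin(2)] inv')
      finally have 1: "U (V y) \<bullet> w = 0" by simp
      then have 2: "w \<bullet> U (V y) = 0" by (simp add: inner_commute)
      have "U (V y) \<bullet> U (V y) = V y \<bullet> V y" by (simp only: adj inv')
      with 1 2 show ?thesis by (simp add: inner_add_left inner_add_right)
    qed
    finally have y: "y \<bullet> y = w \<bullet> w + V y \<bullet> V y" .
    have "a \<bullet> a = (u + V (U a)) \<bullet> (u + V (U a))" by (simp add: u_def)
    also have "\<dots> = u \<bullet> u + U a \<bullet> U a"
    proof -
      have "u \<bullet> V (U a) = U u \<bullet> U a" by (simp only: adj)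
      also have "U u = 0" by (simp add: u_def linear_diff[OF lin(1)] inv)
      finally have 1: "u \<bullet> V (U a) = 0" by simp
      then have 2: "V (U a) \<bullet> u = 0" by (simp add: inner_commute)
      have "V (U a) \<bullet> V (U a) = U (V (U a)) \<bullet> U a" by (simp only: adj)
      with 1 2 show ?thesis by (simp add: inner_add_left inner_add_right inv)
    qed
    finally have a: "a \<bullet> a = u \<bullet> u + U a \<bullet> U a" .
    have "(norm (F z))\<^sup>2 = (V y + u) \<bullet> (V y + u) + (U a + w) \<bullet> (U a + w)"
      by (simp add: F_def z norm_Pair power2_norm_eq_inner w_def u_def)
    also have "\<dots> = a \<bullet> a + y \<bullet> y"
      unfolding a y using wu by (simp add: inner_add_left inner_add_right)
    also have "\<dots> = (norm z)\<^sup>2"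
      by (simp add: z norm_Pair power2_norm_eq_inner)
    finally have "(norm (F z))\<^sup>2 = (norm z)\<^sup>2" .
    then show ?thesis by simp
  qed
  then have F: "distr gauss borel F = gauss"
    by (intro distr_gauss_norm_preserving linF)
  \<comment> \<open>The resampled vector is the second component of the orthogonal image, so its law
    is a marginal of the Gaussian product.\<close>
  have "distr (gauss \<Otimes>\<^sub>M gauss) borel (\<lambda>(a, y). U a + (y - U (V y))) = distr gauss borel (\<lambda>z. snd (F z))"
    by (simp add: gauss_prod F_def case_prod_beta')
  also have "\<dots> = distr (distr gauss borel F) borel snd"
    using borel_measurable_linear[OF linF]
    by (subst distr_distr) (auto simp: comp_def intro!: borel_measurable_linear linear_snd)
  also have "\<dots> = distr ((gauss :: 'a measure) \<Otimes>\<^sub>M gauss) borel snd"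
    unfolding F by (simp add: gauss_prod)
  also have "\<dots> = gauss"
  proof (rule measure_eqI)
    fix A assume "A \<in> sets (distr ((gauss :: 'a measure) \<Otimes>\<^sub>M (gauss :: 'b measure)) borel snd)"
    then have A: "A \<in> sets borel" by simp
    have "emeasure ((gauss :: 'a measure) \<Otimes>\<^sub>M (gauss :: 'b measure)) (UNIV \<times> A) = emeasure gauss A"
      using A gauss.emeasure_space_1[where 'a = 'a]
      by (subst gauss.emeasure_pair_measure_Times) auto
    moreover have "(UNIV :: 'a set) \<times> A = snd -` A" by auto
    ultimately show "emeasure (distr ((gauss :: 'a measure) \<Otimes>\<^sub>M gauss) borel snd) A = emeasure gauss A"
      using A by (subst emeasure_distr) (auto simp: space_pair_measure)
  qed simp
  finally show ?thesis .
qed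

lemma resample_measurable [measurable (raw)]:
  assumes "partial_isometry U V"
  shows "(\<lambda>z. U (fst z) + (snd z - U (V (snd z)))) \<in> gauss \<Otimes>\<^sub>M gauss \<rightarrow>\<^sub>M borel"
proof -
  have [measurable]: "U \<in> borel_measurable borel" "V \<in> borel_measurable borel"
    using assms by (auto simp: partial_isometry_def intro: borel_measurable_linear)
  show ?thesis by measurable
qed

lemma nn_integral_gauss_resample:
  assumes UV: "partial_isometry U V" and [measurable]: "f \<in> borel_measurable borel"
  shows "(\<integral>\<^sup>+y. f y \<partial>gauss) = (\<integral>\<^sup>+a. \<integral>\<^sup>+y. f (U a + (y - U (V y))) \<partial>gauss \<partial>gauss)"
proof -
  have [measurable]: "U \<in> borel_measurable borel" "V \<in> borel_measurable borel"
    using UV by (auto simp: partial_isometry_def intro: borel_measurable_linear)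
  have "(\<integral>\<^sup>+y. f y \<partial>gauss) = (\<integral>\<^sup>+z. f (U (fst z) + (snd z - U (V (snd z)))) \<partial>(gauss \<Otimes>\<^sub>M gauss))"
    by (subst distr_gauss_resample[OF UV, symmetric])
      (subst nn_integral_distr, auto simp: case_prod_beta' intro!: resample_measurable UV)
  also have "\<dots> = (\<integral>\<^sup>+a. \<integral>\<^sup>+y. f (U (fst (a, y)) + (snd (a, y) - U (V (snd (a, y))))) \<partial>gauss \<partial>gauss)"
    by (rule gauss.nn_integral_fst[symmetric]) measurable
  finally show ?thesis by simp
qed

lemma integrable_gauss_resample:
  fixes f :: "'b::euclidean_space \<Rightarrow> 'c::{banach, second_countable_topology}"
  assumes UV: "partial_isometry U V" and f: "integrable gauss f"
  shows "integrable (gauss \<Otimes>\<^sub>M gauss) (\<lambda>(a, y). f (U a + (y - U (V y))))"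
proof -
  have "integrable (distr (gauss \<Otimes>\<^sub>M gauss) borel (\<lambda>(a, y). U a + (y - U (V y)))) f"
    using f by (simp add: distr_gauss_resample[OF UV])
  then show ?thesis
    by (subst (asm) integrable_distr_eq)
      (use UV f in \<open>auto simp: case_prod_beta' intro!: resample_measurable dest: borel_measurable_integrable\<close>)
qed

lemma integral_gauss_resample:
  fixes f :: "'b::euclidean_space \<Rightarrow> 'c::{banach, second_countable_topology}"
  assumes UV: "partial_isometry U V" and f: "integrable gauss f"
  shows "(LINT y|gauss. f y) = (LINT a|gauss. LINT y|gauss. f (U a + (y - U (V y))))"
proof -
  have m: "f \<in> borel_measurable borel"
    using borel_measurable_integrable[OF f] by simp
  have "(LINT y|gauss. f y) = (LINT z|(gauss \<Otimes>\<^sub>M gauss). f (U (fst z) + (snd z - U (V (snd z)))))"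
    by (subst distr_gauss_resample[OF UV, symmetric])
      (subst integral_distr, auto simp: case_prod_beta' m intro!: resample_measurable UV)
  then show ?thesis
    using gauss_pair.integral_fst'[OF integrable_gauss_resample[OF UV f]]
    by (simp add: case_prod_beta')
qed

lemma integral_gauss_norm_preserving:
  fixes g :: "'a::euclidean_space \<Rightarrow> 'c::{banach, second_countable_topology}" and f :: "'a \<Rightarrow> 'a"
  assumes f: "linear f" "\<And>x. norm (f x) = norm x" and g: "g \<in> borel_measurable borel"
  shows "(LINT x|gauss. g (f x)) = (LINT x|gauss. g x)"
  using integral_distr[of f gauss borel g] g borel_measurable_linear[OF f(1)]
  by (simp add: distr_gauss_norm_preserving[OF f])

lemma nn_integral_gauss_norm_preserving:
  fixes f :: "'a::euclidean_space \<Rightarrow> 'a"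
  assumes f: "linear f" "\<And>x. norm (f x) = norm x" and g: "g \<in> borel_measurable borel"
  shows "(\<integral>\<^sup>+x. g (f x) \<partial>gauss) = (\<integral>\<^sup>+x. g x \<partial>gauss)"
  using nn_integral_distr[of f gauss borel g] g borel_measurable_linear[OF f(1)]
  by (simp add: distr_gauss_norm_preserving[OF f])

text \<open>Resampling one coordinate; this reduces integration by parts to a single
  variable.\<close>

lemma partial_isometry_Basis:
  assumes "norm (b::'a::euclidean_space) = 1"
  shows "partial_isometry (\<lambda>s. s *\<^sub>R b) (\<lambda>y. y \<bullet> b)"
proof -
  have "(s *\<^sub>R b) \<bullet> y = s * (y \<bullet> b)" for s y
    by (simp add: inner_commute)
  then show ?thesis
    using assms by (auto simp: partial_isometry_def linear_iff scaleR_add_left inner_add_left norm_eq_1)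
qed

text \<open>Resampling along this isometry replaces \<open>transpose v ** x\<close> by a fresh
  square Gaussian matrix, independent of the part of \<open>x\<close> orthogonal to the columns of
  \<open>v\<close>.\<close>

lemma partial_isometry_stiefel:
  fixes v :: "real^'m^'n"
  assumes "transpose v ** v = mat 1"
  shows "partial_isometry (\<lambda>z::real^'k^'m. v ** z) (\<lambda>x. transpose v ** x)"
proof -
  have "(v ** a) \<bullet> y = a \<bullet> (transpose v ** y)" for a :: "real^'k^'m" and y
  proof -
    have "(v ** a) \<bullet> y = (\<Sum>i\<in>UNIV. \<Sum>j\<in>UNIV. \<Sum>l\<in>UNIV. v$i$l * a$l$j * y$i$j)"
      by (simp add: inner_matrix matrix_matrix_mult_def sum_distrib_right)
    also have "\<dots> = (\<Sum>l\<in>UNIV. \<Sum>j\<in>UNIV. \<Sum>i\<in>UNIV. v$i$l * a$l$j * y$i$j)"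
      by (subst sum.swap, subst (2) sum.swap, subst sum.swap) (rule refl)
    also have "\<dots> = a \<bullet> (transpose v ** y)"
      by (simp add: inner_matrix matrix_matrix_mult_def sum_distrib_left transpose_def mult_ac)
    finally show ?thesis .
  qed
  then show ?thesis
    using assms by (simp add: partial_isometry_def linear_matrix_mult_left matrix_mul_assoc)
qed

lemma partial_isometry_row:
  "partial_isometry (\<lambda>y::'a::euclidean_space. (axis a y :: 'a^'n)) (\<lambda>z. z $ a)"
  unfolding partial_isometry_def by (intro conjI allI, simp_all only: inner_axis') (auto simp: linear_iff vec_eq_iff axis_def)

subsection \<open>Polynomials and Gaussian convolution\<close>

lemma measure_gauss_UNIV [simp]: "measure gauss UNIV = 1"
  using gauss.prob_space by simp

inductive pdeg :: "nat \<Rightarrow> ('a::euclidean_space \<Rightarrow> complex) \<Rightarrow> bool" where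
  pdeg_const: "pdeg d (\<lambda>x. c)"
| pdeg_add: "pdeg d f \<Longrightarrow> pdeg d g \<Longrightarrow> pdeg d (\<lambda>x. f x + g x)"
| pdeg_lin: "pdeg d f \<Longrightarrow> linear L \<Longrightarrow> pdeg (Suc d) (\<lambda>x. complex_of_real (L x) * f x)"

definition cpoly :: "('a::euclidean_space \<Rightarrow> complex) \<Rightarrow> bool" where
  "cpoly f \<longleftrightarrow> (\<exists>d. pdeg d f)"

lemma pdeg_mono: "pdeg d f \<Longrightarrow> d \<le> e \<Longrightarrow> pdeg e f"
proof (induction arbitrary: e rule: pdeg.induct)
  case (pdeg_lin d f L)
  then obtain e' where "e = Suc e'" "d \<le> e'" by (cases e) auto
  with pdeg_lin show ?case by (auto intro: pdeg.pdeg_lin)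
qed (auto intro: pdeg.intros)

lemma pdeg_cmult: "pdeg d f \<Longrightarrow> pdeg d (\<lambda>x. c * f x)"
proof (induction rule: pdeg.induct)
  case (pdeg_lin d f L)
  then have "pdeg (Suc d) (\<lambda>x. complex_of_real (L x) * (c * f x))"
    by (intro pdeg.pdeg_lin)
  then show ?case by (simp add: mult.left_commute)
qed (auto simp: ring_distribs intro: pdeg.intros)

lemma pdeg_mult: "pdeg d f \<Longrightarrow> pdeg e g \<Longrightarrow> pdeg (d + e) (\<lambda>x. f x * g x)"
proof (induction rule: pdeg.induct)
  case (pdeg_const d c)
  then show ?case by (intro pdeg_cmult) (auto intro: pdeg_mono)
next
  case (pdeg_lin d f L)
  then have "pdeg (Suc (d + e)) (\<lambda>x. complex_of_real (L x) * (f x * g x))"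
    by (intro pdeg.pdeg_lin) auto
  then show ?case by (simp add: mult.assoc)
qed (auto simp: ring_distribs intro: pdeg.intros)

lemma cpoly_const: "cpoly (\<lambda>x. c)"
  by (auto simp: cpoly_def intro: pdeg.intros)

lemma cpoly_add: "cpoly f \<Longrightarrow> cpoly g \<Longrightarrow> cpoly (\<lambda>x. f x + g x)"
  unfolding cpoly_def by (metis pdeg_add pdeg_mono nat_le_linear)

lemma cpoly_mult: "cpoly f \<Longrightarrow> cpoly g \<Longrightarrow> cpoly (\<lambda>x. f x * g x)"
  unfolding cpoly_def by (metis pdeg_mult)

lemma cpoly_linear: "linear L \<Longrightarrow> cpoly (\<lambda>x. complex_of_real (L x))"
  using pdeg_lin[OF pdeg_const[of 0 1]] by (auto simp: cpoly_def)

lemma cpoly_diff: "cpoly f \<Longrightarrow> cpoly g \<Longrightarrow> cpoly (\<lambda>x. f x - g x)"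
  using cpoly_add[of f "\<lambda>x. -1 * g x"] cpoly_mult[OF cpoly_const, of g "-1"] by simp

lemma cpoly_sum: "(\<And>i. i \<in> I \<Longrightarrow> cpoly (f i)) \<Longrightarrow> cpoly (\<lambda>x. \<Sum>i\<in>I. f i x)"
  by (induction I rule: infinite_finite_induct) (auto intro: cpoly_const cpoly_add)

lemma cpoly_prod: "(\<And>i. i \<in> I \<Longrightarrow> cpoly (f i)) \<Longrightarrow> cpoly (\<lambda>x. \<Prod>i\<in>I. f i x)"
  by (induction I rule: infinite_finite_induct) (auto intro: cpoly_const cpoly_mult)

lemma cpoly_power: "cpoly f \<Longrightarrow> cpoly (\<lambda>x. f x ^ k)"
  by (induction k) (auto intro: cpoly_const cpoly_mult)

lemma cpoly_det: "(\<And>i j. cpoly (\<lambda>x. A x $ i $ j)) \<Longrightarrow> cpoly (\<lambda>x. det (A x))"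
  unfolding det_def by (intro cpoly_sum cpoly_mult cpoly_const cpoly_prod)

lemmas cpoly_intros = cpoly_const cpoly_add cpoly_diff cpoly_mult cpoly_sum cpoly_prod cpoly_power

lemma pdeg_linear_image: "pdeg d f \<Longrightarrow> linear U \<Longrightarrow> pdeg d (\<lambda>x. f (U x))"
proof (induction rule: pdeg.induct)
  case (pdeg_lin d f L)
  then show ?case
    using linear_compose[of U L] by (auto simp: comp_def intro!: pdeg.pdeg_lin)
qed (auto intro: pdeg.intros)

lemma pdeg_translate: "pdeg d f \<Longrightarrow> pdeg d (\<lambda>x. f (a + x))"
proof (induction rule: pdeg.induct)
  case (pdeg_lin d f L)
  have "pdeg (Suc d) (\<lambda>x. complex_of_real (L a) * f (a + x) + complex_of_real (L x) * f (a + x))"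
    using pdeg_lin by (intro pdeg_add pdeg_cmult pdeg.pdeg_lin) (auto intro: pdeg_mono)
  then show ?case using pdeg_lin by (simp add: linear_add ring_distribs)
qed (auto intro: pdeg.intros)

lemma cpoly_linear_image: "cpoly f \<Longrightarrow> linear U \<Longrightarrow> cpoly (\<lambda>x. f (U x))"
  by (auto simp: cpoly_def intro: pdeg_linear_image)

lemma cpoly_translate: "cpoly f \<Longrightarrow> cpoly (\<lambda>x. f (a + x))"
  by (auto simp: cpoly_def intro: pdeg_translate)

lemma cpoly_affine_image: "cpoly f \<Longrightarrow> linear U \<Longrightarrow> cpoly (\<lambda>x. f (a + U x))"
  using cpoly_linear_image[OF cpoly_translate] .

lemma cpoly_of_real_polynomial:
  "real_polynomial_function p \<Longrightarrow> cpoly (\<lambda>x. complex_of_real (p x))"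
proof (induction rule: real_polynomial_function.induct)
  case (linear f)
  then show ?case by (intro cpoly_linear bounded_linear.linear)
qed (auto intro: cpoly_intros)

lemma cpoly_polynomial_function:
  assumes "polynomial_function (p :: 'a::euclidean_space \<Rightarrow> complex)"
  shows "cpoly p"
proof -
  have "real_polynomial_function (Re \<circ> p)" "real_polynomial_function (Im \<circ> p)"
    using assms bounded_linear_Re bounded_linear_Im by (auto simp: polynomial_function_def)
  then have "cpoly (\<lambda>x. complex_of_real ((Re \<circ> p) x) + \<i> * complex_of_real ((Im \<circ> p) x))"
    by (intro cpoly_intros cpoly_of_real_polynomial)
  then show ?thesis by (simp add: complex_eq[symmetric])
qed

lemma continuous_cpoly:
  assumes "cpoly f"
  shows "continuous_on UNIV f"
proof -
  obtain d where "pdeg d f" using assms by (auto simp: cpoly_def)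
  then show ?thesis
  proof (induction rule: pdeg.induct)
    case (pdeg_lin d f L)
    then have "continuous_on UNIV L" using linear_continuous_on linear_conv_bounded_linear by blast
    with pdeg_lin show ?case by (auto intro!: continuous_intros)
  qed (auto intro: continuous_intros)
qed

lemma cpoly_measurable: "cpoly f \<Longrightarrow> f \<in> borel_measurable borel"
  by (intro borel_measurable_continuous_onI continuous_cpoly)

text \<open>An arbitrarily small \<open>e\<close> leaves room for a Gaussian factor. When a linear
  form is multiplied on, half of \<open>e\<close> is spent on the form and half on the remaining
  polynomial.\<close>

lemma cpoly_bound:
  assumes "cpoly f" "e > 0"
  shows "\<exists>C\<ge>0. \<forall>x. norm (f x) \<le> C * exp (e * (norm x)\<^sup>2)"
proof -
  obtain d where "pdeg d f" using assms by (auto simp: cpoly_def)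
  from this \<open>e > 0\<close> show ?thesis
  proof (induction arbitrary: e rule: pdeg.induct)
    case (pdeg_const d c)
    have "norm c \<le> norm c * exp (e * (norm x)\<^sup>2)" for x :: 'a
      using mult_left_mono[of 1 "exp (e * (norm x)\<^sup>2)" "norm c"] pdeg_const by simp
    then show ?case by (intro exI[of _ "norm c"]) auto
  next
    case (pdeg_add d f g)
    obtain C D where "C \<ge> 0" "\<And>x. norm (f x) \<le> C * exp (e * (norm x)\<^sup>2)"
      "D \<ge> 0" "\<And>x. norm (g x) \<le> D * exp (e * (norm x)\<^sup>2)"
      using pdeg_add by metis
    then have "norm (f x + g x) \<le> (C + D) * exp (e * (norm x)\<^sup>2)" for x
      by (smt (verit, best) norm_triangle_ineq distrib_right)
    with \<open>C \<ge> 0\<close> \<open>D \<ge> 0\<close> show ?case by (intro exI[of _ "C + D"]) auto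
  next
    case (pdeg_lin d f L)
    obtain C where C: "C \<ge> 0" "\<And>x. norm (f x) \<le> C * exp (e / 2 * (norm x)\<^sup>2)"
      using pdeg_lin.IH[of "e / 2"] pdeg_lin.prems by auto
    obtain B where B: "B > 0" "\<And>x. norm (L x) \<le> B * norm x"
      using linear_bounded_pos[OF pdeg_lin.hyps(2)] by auto
    have nx: "norm x \<le> exp (1 / (2 * e)) * exp (e / 2 * (norm x)\<^sup>2)" for x :: 'a
    proof -
      have "0 \<le> (e * norm x - 1)\<^sup>2" by simp
      then have "norm x * (2 * e) \<le> e\<^sup>2 * (norm x)\<^sup>2 + 1"
        by (simp add: power2_eq_square algebra_simps)
      then have "norm x \<le> 1 / (2 * e) + e / 2 * (norm x)\<^sup>2"
        using pdeg_lin.prems by (simp add: field_simps power2_eq_square)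
      also have "\<dots> \<le> exp (1 / (2 * e) + e / 2 * (norm x)\<^sup>2)"
        using exp_ge_add_one_self[of "1 / (2 * e) + e / 2 * (norm x)\<^sup>2"] by linarith
      finally show ?thesis by (simp add: exp_add)
    qed
    have "norm (complex_of_real (L x) * f x) \<le> B * exp (1 / (2 * e)) * C * exp (e * (norm x)\<^sup>2)" for x
    proof -
      have "norm (complex_of_real (L x) * f x) \<le> (B * norm x) * (C * exp (e / 2 * (norm x)\<^sup>2))"
        unfolding norm_mult using B C by (intro mult_mono) auto
      also have "\<dots> \<le> (B * (exp (1 / (2 * e)) * exp (e / 2 * (norm x)\<^sup>2))) * (C * exp (e / 2 * (norm x)\<^sup>2))"
        using B C nx by (intro mult_right_mono mult_left_mono) auto
      also have "\<dots> = B * exp (1 / (2 * e)) * C * (exp (e / 2 * (norm x)\<^sup>2) * exp (e / 2 * (norm x)\<^sup>2))"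
        by simp
      also have "exp (e / 2 * (norm x)\<^sup>2) * exp (e / 2 * (norm x)\<^sup>2) = exp (e * (norm x)\<^sup>2)"
        by (simp add: exp_add[symmetric])
      finally show ?thesis .
    qed
    then show ?case using B C by (intro exI[of _ "B * exp (1 / (2 * e)) * C"]) auto
  qed
qed

lemma lborel_scaling_scaleR:
  assumes "r > 0"
  shows "lborel_scaling (\<lambda>x::'a::euclidean_space. r *\<^sub>R x) (ennreal (1 / r ^ DIM('a)))"
proof -
  have "(\<Sum>b\<in>Basis. (r * (x \<bullet> b)) *\<^sub>R b) = r *\<^sub>R x" for x :: 'a
    by (simp add: scaleR_scaleR[symmetric] scaleR_sum_right[symmetric] euclidean_representation del: scaleR_scaleR)
  then show ?thesis
    using lborel_scaling_diagonal_map[of "\<lambda>_::'a. r"] assms by simp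
qed

lemma integrable_gauss_cpoly:
  fixes f :: "'a::euclidean_space \<Rightarrow> complex"
  assumes "cpoly f"
  shows "integrable gauss f"
proof -
  have [measurable]: "f \<in> borel_measurable borel" using assms by (rule cpoly_measurable)
  \<comment> \<open>The exponent 1/4 uses up half of the Gaussian exponent 1/2. What remains is the
    Gaussian density at \<open>x\<close> divided by \<open>sqrt 2\<close>, hence the choice of
    \<open>?r\<close>.\<close>
  obtain C where C: "C \<ge> 0" "\<And>x. norm (f x) \<le> C * exp (1/4 * (norm x)\<^sup>2)"
    using cpoly_bound[OF assms, of "1/4"] by auto
  let ?r = "1 / sqrt 2"
  have "(\<integral>\<^sup>+x. norm (f x) \<partial>gauss) \<le> (\<integral>\<^sup>+x. ennreal C * ennreal (gauss_density (?r *\<^sub>R (x::'a))) \<partial>lborel)"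
  proof (subst nn_integral_gauss, measurable, rule nn_integral_mono)
    fix x :: 'a
    have "gauss_density x * norm (f x) \<le> gauss_density x * (C * exp (1/4 * (norm x)\<^sup>2))"
      using C gauss_density_pos[of x] by (intro mult_left_mono) auto
    also have "\<dots> = C * gauss_density (?r *\<^sub>R x)"
      by (simp add: gauss_density_def power_divide exp_add[symmetric] power_mult_distrib)
    finally show "ennreal (gauss_density x) * ennreal (norm (f x)) \<le> ennreal C * ennreal (gauss_density (?r *\<^sub>R x))"
      using C gauss_density_pos[of x] by (simp add: ennreal_mult'[symmetric] ennreal_leI less_imp_le)
  qed
  also have "\<dots> = ennreal C * (\<integral>\<^sup>+x. ennreal (gauss_density (?r *\<^sub>R (x::'a))) \<partial>lborel)"
    by (rule nn_integral_cmult) measurable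
  also have "(\<integral>\<^sup>+x. ennreal (gauss_density (?r *\<^sub>R (x::'a))) \<partial>lborel)
      = ennreal (1 / ?r ^ DIM('a)) * (\<integral>\<^sup>+x. ennreal (gauss_density (x::'a)) \<partial>lborel)"
    using lborel_scaling_scaleR[of ?r, where 'a = 'a] unfolding lborel_scaling_def
    by (auto dest!: bspec[where x = "\<lambda>x. ennreal (gauss_density x)"])
  also have "(\<integral>\<^sup>+x. ennreal (gauss_density (x::'a)) \<partial>lborel) = 1"
    using gauss.emeasure_space_1[where 'a = 'a] by (simp add: gauss_def emeasure_density)
  finally have "(\<integral>\<^sup>+x. norm (f x) \<partial>gauss) < \<infinity>"
    by (rule le_less_trans) (simp add: ennreal_mult_less_top)
  then show ?thesis by (intro integrableI_bounded) auto
qed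

section \<open>Gaussian convolution of polynomials\<close>

text \<open>A linear factor splits as \<open>L (U y) + L (W x)\<close>. The first term leaves the
  integral, the second joins the weight, so the induction has to run over all polynomial weights
  \<open>w\<close>.\<close>

lemma pdeg_gauss_convolution:
  fixes U :: "'a::euclidean_space \<Rightarrow> 'b::euclidean_space" and W :: "'c::euclidean_space \<Rightarrow> 'b"
  assumes "pdeg d f" "linear U" "linear W" "cpoly w"
  shows "pdeg d (\<lambda>y. LINT x|gauss. w x * f (U y + W x))"
  using assms
proof (induction arbitrary: w rule: pdeg.induct)
  case (pdeg_const d c)
  show ?case by (rule pdeg.pdeg_const)
next
  case (pdeg_add d f g)
  have "integrable gauss (\<lambda>x. w x * f (U y + W x))" "integrable gauss (\<lambda>x. w x * g (U y + W x))" for y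
    using pdeg_add by (auto intro!: integrable_gauss_cpoly cpoly_mult cpoly_affine_image simp: cpoly_def)
  then have "(LINT x|gauss. w x * (f (U y + W x) + g (U y + W x)))
      = (LINT x|gauss. w x * f (U y + W x)) + (LINT x|gauss. w x * g (U y + W x))" for y
    by (simp add: ring_distribs)
  with pdeg_add show ?case by (auto intro: pdeg.pdeg_add)
next
  case (pdeg_lin d f L)
  have LU: "linear (\<lambda>y. L (U y))" and LW: "linear (\<lambda>x. L (W x))"
    using pdeg_lin linear_compose[of _ L] by (auto simp: comp_def)
  have wL: "cpoly (\<lambda>x. complex_of_real (L (W x)) * w x)"
    by (intro cpoly_mult cpoly_linear LW pdeg_lin)
  have int: "integrable gauss (\<lambda>x. w x * f (U y + W x))" "integrable gauss (\<lambda>x. (complex_of_real (L (W x)) * w x) * f (U y + W x))" for y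
    using pdeg_lin wL by (auto intro!: integrable_gauss_cpoly cpoly_mult[of w] cpoly_mult[of "\<lambda>x. complex_of_real (L (W x)) * w x"] cpoly_affine_image simp: cpoly_def[of f])
  have "(LINT x|gauss. w x * (complex_of_real (L (U y + W x)) * f (U y + W x)))
      = (LINT x|gauss. complex_of_real (L (U y)) * (w x * f (U y + W x)) + (complex_of_real (L (W x)) * w x) * f (U y + W x))" for y
    using pdeg_lin by (simp add: linear_add algebra_simps)
  also have "\<dots> y = complex_of_real (L (U y)) * (LINT x|gauss. w x * f (U y + W x))
      + (LINT x|gauss. (complex_of_real (L (W x)) * w x) * f (U y + W x))" for y
    using int by simp
  finally have eq: "(LINT x|gauss. w x * (complex_of_real (L (U y + W x)) * f (U y + W x)))
    = complex_of_real (L (U y)) * (LINT x|gauss. w x * f (U y + W x))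
      + (LINT x|gauss. (complex_of_real (L (W x)) * w x) * f (U y + W x))" for y .
  show ?case
    unfolding eq
    by (intro pdeg_add pdeg.pdeg_lin LU pdeg_lin.IH pdeg_lin.prems wL pdeg_mono[OF pdeg_lin.IH[OF pdeg_lin.prems(1,2) wL]]) auto
qed

lemma cpoly_gauss_convolution:
  assumes "cpoly f" "linear U" "linear W"
  shows "cpoly (\<lambda>y. LINT x|gauss. f (U y + W x))"
  using assms pdeg_gauss_convolution[of _ f U W "\<lambda>_. 1"] by (auto simp: cpoly_def intro: pdeg_const)

text \<open>Convolution with a probability measure leaves the leading part of a polynomial
  unchanged, so subtracting the identity lowers the degree. In degree 0 the truncated
  \<open>d - 1\<close> records no gain, hence the second conjunct.\<close>

lemma pdeg_gauss_convolution_diff: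
  assumes "pdeg d f"
  shows "pdeg (d - 1) (\<lambda>y. (LINT z|gauss. f (y + z)) - f y) \<and> (d = 0 \<longrightarrow> (\<forall>y. (LINT z|gauss. f (y + z)) = f y))"
  using assms
proof (induction rule: pdeg.induct)
  case (pdeg_const d c)
  show ?case by (auto intro: pdeg.pdeg_const)
next
  case (pdeg_add d f g)
  have "integrable gauss (\<lambda>x. f (y + x))" "integrable gauss (\<lambda>x. g (y + x))" for y
    using pdeg_add by (auto intro!: integrable_gauss_cpoly cpoly_translate simp: cpoly_def)
  then have "(LINT x|gauss. f (y + x) + g (y + x)) - (f y + g y)
      = ((LINT x|gauss. f (y + x)) - f y) + ((LINT x|gauss. g (y + x)) - g y)" 
      "(LINT x|gauss. f (y + x) + g (y + x)) = (LINT x|gauss. f (y + x)) + (LINT x|gauss. g (y + x))" for y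
    by simp_all
  note eq = this
  have "pdeg (d - 1) (\<lambda>y. ((LINT x|gauss. f (y + x)) - f y) + ((LINT x|gauss. g (y + x)) - g y))"
    using pdeg_add.IH by (intro pdeg.pdeg_add) auto
  then show ?case unfolding eq(1) using eq(2) pdeg_add.IH by simp
next
  case (pdeg_lin d f L)
  have cf: "cpoly f" using pdeg_lin by (auto simp: cpoly_def)
  have int: "integrable gauss (\<lambda>x. f (y + x))" "integrable gauss (\<lambda>x. complex_of_real (L x) * f (y + x))" for y
    using pdeg_lin by (auto intro!: integrable_gauss_cpoly cpoly_translate cpoly_mult cpoly_linear cf)
  have "(LINT x|gauss. complex_of_real (L (y + x)) * f (y + x))
      = (LINT x|gauss. complex_of_real (L y) * f (y + x) + complex_of_real (L x) * f (y + x))" for y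
    using pdeg_lin by (simp add: linear_add algebra_simps)
  also have "\<dots> y = complex_of_real (L y) * (LINT x|gauss. f (y + x)) + (LINT x|gauss. complex_of_real (L x) * f (y + x))" for y
    using int by simp
  finally have eq: "(LINT x|gauss. complex_of_real (L (y + x)) * f (y + x)) - complex_of_real (L y) * f y
    = complex_of_real (L y) * ((LINT x|gauss. f (y + x)) - f y) + (LINT x|gauss. complex_of_real (L x) * f (y + x))" for y
    by (simp add: right_diff_distrib)
  have 2: "pdeg d (\<lambda>y. LINT x|gauss. complex_of_real (L x) * f (y + x))"
    using pdeg_gauss_convolution[OF pdeg_lin.hyps(1), of "\<lambda>x. x" "\<lambda>x. x" "\<lambda>x. complex_of_real (L x)"]
      cpoly_linear[OF pdeg_lin.hyps(2)] linear_id[unfolded id_def] by auto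
  have 1: "pdeg d (\<lambda>y. complex_of_real (L y) * ((LINT x|gauss. f (y + x)) - f y))"
  proof (cases d)
    case 0
    then show ?thesis using pdeg_lin.IH by (simp add: pdeg_const)
  next
    case (Suc e)
    then show ?thesis using pdeg_lin.IH pdeg_lin.hyps(2) by (auto intro: pdeg.pdeg_lin)
  qed
  show ?case unfolding eq using 1 2 by (auto intro: pdeg.pdeg_add)
qed

text \<open>If the convolution vanishes, \<open>r\<close> is minus the difference between its
  convolution and itself, so its degree bound drops by one. Repeating this reaches degree 0.\<close>

lemma gauss_convolution_injective:
  assumes "cpoly r" and 0: "\<And>y. (LINT z|gauss. r (y + z)) = 0"
  shows "r y = 0"
proof -
  obtain d where "pdeg d r" using assms by (auto simp: cpoly_def)
  then show ?thesis
  proof (induction d)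
    case 0
    then show ?case using pdeg_gauss_convolution_diff[of 0 r] assms(2) by simp
  next
    case (Suc d)
    have "pdeg d (\<lambda>y. - 1 * (0 - r y))"
      using pdeg_gauss_convolution_diff[OF Suc.prems] assms(2) by (intro pdeg_cmult) simp
    then show ?case by (intro Suc.IH) simp
  qed
qed

section \<open>Gaussian integration by parts and harmonic polynomials\<close>

text \<open>The product rule builds the partial derivatives together with the fact that they are
  polynomials again, so they can be differentiated once more and integrated.\<close>

lemma cpoly_derivative:
  fixes f :: "'a::euclidean_space \<Rightarrow> complex"
  assumes "cpoly f"
  shows "\<exists>G. (\<forall>b. cpoly (G b)) \<and>
    (\<forall>x z. ((\<lambda>t. f (x + t *\<^sub>R z)) has_vector_derivative (\<Sum>b\<in>Basis. (z \<bullet> b) *\<^sub>R G b x)) (at 0))"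
proof -
  obtain d where "pdeg d f" using assms by (auto simp: cpoly_def)
  then show ?thesis
  proof (induction rule: pdeg.induct)
    case (pdeg_const d c)
    show ?case by (intro exI[of _ "\<lambda>b x. 0"]) (auto intro: cpoly_const)
  next
    case (pdeg_add d f g)
    obtain F where F: "\<And>b. cpoly (F b)"
      "\<And>x z. ((\<lambda>t. f (x + t *\<^sub>R z)) has_vector_derivative (\<Sum>b\<in>Basis. (z \<bullet> b) *\<^sub>R F b x)) (at 0)"
      using pdeg_add.IH(1) by blast
    obtain G where G: "\<And>b. cpoly (G b)"
      "\<And>x z. ((\<lambda>t. g (x + t *\<^sub>R z)) has_vector_derivative (\<Sum>b\<in>Basis. (z \<bullet> b) *\<^sub>R G b x)) (at 0)"
      using pdeg_add.IH(2) by blast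
    show ?case
      using has_vector_derivative_add[OF F(2) G(2)]
      by (intro exI[of _ "\<lambda>b x. F b x + G b x"]) (auto intro: cpoly_add F G simp: scaleR_add_right sum.distrib)
  next
    case (pdeg_lin d f L)
    obtain F where F: "\<And>b. cpoly (F b)"
      "\<And>x z. ((\<lambda>t. f (x + t *\<^sub>R z)) has_vector_derivative (\<Sum>b\<in>Basis. (z \<bullet> b) *\<^sub>R F b x)) (at 0)"
      using pdeg_lin.IH by blast
    have cf: "cpoly f" using pdeg_lin by (auto simp: cpoly_def)
    define G where "G b x = complex_of_real (L b) * f x + complex_of_real (L x) * F b x" for b x
    have L: "L (x + t *\<^sub>R z) = L x + t * L z" for x z t
      using pdeg_lin by (simp add: linear_add linear_scale)
    have Lz: "L z = (\<Sum>b\<in>Basis. (z \<bullet> b) * L b)" for z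
    proof -
      have "L (\<Sum>b\<in>Basis. (z \<bullet> b) *\<^sub>R b) = (\<Sum>b\<in>Basis. (z \<bullet> b) * L b)"
        using pdeg_lin by (simp add: linear_sum linear_scale)
      then show ?thesis by (simp add: euclidean_representation)
    qed
    have "((\<lambda>t. complex_of_real (L (x + t *\<^sub>R z)) * f (x + t *\<^sub>R z)) has_vector_derivative (\<Sum>b\<in>Basis. (z \<bullet> b) *\<^sub>R G b x)) (at 0)" for x z
    proof -
      have "((\<lambda>t. complex_of_real (L x + t * L z)) has_vector_derivative complex_of_real (L z)) (at 0)"
        by (rule has_vector_derivative_of_real) (auto intro!: derivative_eq_intros)
      from has_vector_derivative_mult[OF this F(2)[of x z]] 
      have "((\<lambda>t. complex_of_real (L (x + t *\<^sub>R z)) * f (x + t *\<^sub>R z)) has_vector_derivative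
        complex_of_real (L x) * (\<Sum>b\<in>Basis. (z \<bullet> b) *\<^sub>R F b x) + complex_of_real (L z) * f x) (at 0)"
        by (simp add: L)
      moreover have "complex_of_real (L x) * (\<Sum>b\<in>Basis. (z \<bullet> b) *\<^sub>R F b x) + complex_of_real (L z) * f x
          = (\<Sum>b\<in>Basis. (z \<bullet> b) *\<^sub>R G b x)"
        by (subst Lz) (simp add: G_def sum_distrib_left sum_distrib_right scaleR_conv_of_real algebra_simps sum.distrib)
      ultimately show ?thesis by simp
    qed
    moreover have "cpoly (G b)" for b
      unfolding G_def by (intro cpoly_intros cpoly_linear pdeg_lin cf F)
    ultimately show ?case by (intro exI[of _ G]) auto
  qed
qed

lemma has_vector_derivative_line_shift:
  fixes f :: "'a::real_vector \<Rightarrow> 'b::real_normed_vector"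
  assumes "\<And>x. ((\<lambda>t. f (x + t *\<^sub>R z)) has_vector_derivative D x) (at 0)"
  shows "((\<lambda>t. f (x + t *\<^sub>R z)) has_vector_derivative D (x + t *\<^sub>R z)) (at t)"
proof -
  have 1: "((\<lambda>s. s - t) has_vector_derivative 1) (at t)"
    by (auto intro!: derivative_eq_intros)
  have 2: "((\<lambda>s. f ((x + t *\<^sub>R z) + s *\<^sub>R z)) has_vector_derivative D (x + t *\<^sub>R z)) (at (t - t))"
    using assms by simp
  have "(x + t *\<^sub>R z) + (s - t) *\<^sub>R z = x + s *\<^sub>R z" for s
    by (simp add: algebra_simps)
  with vector_diff_chain_at[OF 1 2] show ?thesis
    by (simp add: comp_def)
qed

text \<open>Differentiation under the integral sign, by induction on the polynomial instead of
  domination. A linear factor becomes \<open>L x + t * L z\<close>, whose second term joins the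
  weight \<open>w\<close>; this is why all polynomial weights are carried along.\<close>

lemma cpoly_line_integral_derivative:
  fixes f :: "'a::euclidean_space \<Rightarrow> complex"
  assumes "cpoly f"
  shows "\<exists>F. (\<forall>t. cpoly (F t)) \<and>
    (\<forall>t z. ((\<lambda>t. f (x + t *\<^sub>R z)) has_vector_derivative F t z) (at t)) \<and>
    (\<forall>w t. cpoly w \<longrightarrow> ((\<lambda>t. LINT z|gauss. w z * f (x + t *\<^sub>R z)) has_vector_derivative
      (LINT z|gauss. w z * F t z)) (at t))"
proof -
  have tr: "linear (\<lambda>z::'a. t *\<^sub>R z)" for t by (simp add: linear_iff scaleR_add_right)
  obtain d where "pdeg d f" using assms by (auto simp: cpoly_def)
  then show ?thesis
  proof (induction rule: pdeg.induct)
    case (pdeg_const d c)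
    show ?case by (intro exI[of _ "\<lambda>t z. 0"]) (auto intro: cpoly_const)
  next
    case (pdeg_add d f g)
    obtain F where F: "\<And>t. cpoly (F t)"
      "\<And>t z. ((\<lambda>t. f (x + t *\<^sub>R z)) has_vector_derivative F t z) (at t)"
      "\<And>w t. cpoly w \<Longrightarrow> ((\<lambda>t. LINT z|gauss. w z * f (x + t *\<^sub>R z)) has_vector_derivative
        (LINT z|gauss. w z * F t z)) (at t)"
      using pdeg_add.IH(1) by blast
    obtain G where G: "\<And>t. cpoly (G t)"
      "\<And>t z. ((\<lambda>t. g (x + t *\<^sub>R z)) has_vector_derivative G t z) (at t)"
      "\<And>w t. cpoly w \<Longrightarrow> ((\<lambda>t. LINT z|gauss. w z * g (x + t *\<^sub>R z)) has_vector_derivative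
        (LINT z|gauss. w z * G t z)) (at t)"
      using pdeg_add.IH(2) by blast
    have c: "cpoly f" "cpoly g" using pdeg_add by (auto simp: cpoly_def)
    have "((\<lambda>t. LINT z|gauss. w z * (f (x + t *\<^sub>R z) + g (x + t *\<^sub>R z))) has_vector_derivative
        (LINT z|gauss. w z * (F t z + G t z))) (at t)" if w: "cpoly w" for w t
    proof -
      have "integrable gauss (\<lambda>z. w z * f (x + t *\<^sub>R z))" "integrable gauss (\<lambda>z. w z * g (x + t *\<^sub>R z))"
        "integrable gauss (\<lambda>z. w z * F t z)" "integrable gauss (\<lambda>z. w z * G t z)" for t
        by (auto intro!: integrable_gauss_cpoly cpoly_mult w F G cpoly_affine_image[OF _ tr] c)
      then show ?thesis
        using has_vector_derivative_add[OF F(3)[OF w] G(3)[OF w]] by (simp add: ring_distribs)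
    qed
    then show ?case
      using has_vector_derivative_add[OF F(2) G(2)]
      by (intro exI[of _ "\<lambda>t z. F t z + G t z"]) (auto intro: cpoly_add F G)
  next
    case (pdeg_lin d f L)
    obtain F where F: "\<And>t. cpoly (F t)"
      "\<And>t z. ((\<lambda>t. f (x + t *\<^sub>R z)) has_vector_derivative F t z) (at t)"
      "\<And>w t. cpoly w \<Longrightarrow> ((\<lambda>t. LINT z|gauss. w z * f (x + t *\<^sub>R z)) has_vector_derivative
        (LINT z|gauss. w z * F t z)) (at t)"
      using pdeg_lin.IH by blast
    have cf: "cpoly f" using pdeg_lin by (auto simp: cpoly_def)
    have cL: "cpoly (\<lambda>z. complex_of_real (L z))" by (intro cpoly_linear pdeg_lin)
    define G where "G t z = complex_of_real (L z) * f (x + t *\<^sub>R z) + complex_of_real (L x + t * L z) * F t z" for t z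
    have L: "L (x + t *\<^sub>R z) = L x + t * L z" for z t
      using pdeg_lin by (simp add: linear_add linear_scale)
    have dL: "((\<lambda>t. complex_of_real (a + t * b)) has_vector_derivative complex_of_real b) (at t)" for a b t
      by (rule has_vector_derivative_of_real) (auto intro!: derivative_eq_intros)
    have "cpoly (G t)" for t
      unfolding G_def of_real_add of_real_mult
      by (intro cpoly_intros cL F cpoly_affine_image[OF cf tr])
    moreover have "((\<lambda>t. complex_of_real (L (x + t *\<^sub>R z)) * f (x + t *\<^sub>R z)) has_vector_derivative G t z) (at t)" for t z
      using has_vector_derivative_mult[OF dL[of "L x" "L z" t] F(2)[of z t]] 
      by (simp add: L G_def add.commute)
    moreover have "((\<lambda>t. LINT z|gauss. w z * (complex_of_real (L (x + t *\<^sub>R z)) * f (x + t *\<^sub>R z))) has_vector_derivative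
        (LINT z|gauss. w z * G t z)) (at t)" if w: "cpoly w" for w t
    proof -
      define wL where "wL = (\<lambda>z. w z * complex_of_real (L z))"
      have wL: "cpoly wL" unfolding wL_def by (intro cpoly_mult w cL)
      have int: "integrable gauss (\<lambda>z. w z * f (x + t *\<^sub>R z))" "integrable gauss (\<lambda>z. wL z * f (x + t *\<^sub>R z))"
        "integrable gauss (\<lambda>z. w z * F t z)" "integrable gauss (\<lambda>z. wL z * F t z)" for t
        by (auto intro!: integrable_gauss_cpoly cpoly_mult w wL F cpoly_affine_image[OF cf tr])
      have 1: "(LINT z|gauss. w z * (complex_of_real (L (x + t *\<^sub>R z)) * f (x + t *\<^sub>R z)))
        = complex_of_real (L x) * (LINT z|gauss. w z * f (x + t *\<^sub>R z)) +
          complex_of_real (0 + t * 1) * (LINT z|gauss. wL z * f (x + t *\<^sub>R z))" for t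
      proof -
        have "(LINT z|gauss. w z * (complex_of_real (L (x + t *\<^sub>R z)) * f (x + t *\<^sub>R z))) =
          (LINT z|gauss. complex_of_real (L x) * (w z * f (x + t *\<^sub>R z)) + complex_of_real t * (wL z * f (x + t *\<^sub>R z)))"
          by (simp add: L wL_def algebra_simps)
        then show ?thesis using int by simp
      qed
      have 2: "(LINT z|gauss. w z * G t z) = complex_of_real (L x) * (LINT z|gauss. w z * F t z) +
          (complex_of_real (0 + t * 1) * (LINT z|gauss. wL z * F t z) + complex_of_real 1 * (LINT z|gauss. wL z * f (x + t *\<^sub>R z)))"
      proof -
        have "(LINT z|gauss. w z * G t z) =
          (LINT z|gauss. complex_of_real (L x) * (w z * F t z) + (complex_of_real t * (wL z * F t z) + wL z * f (x + t *\<^sub>R z)))"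
          by (simp add: G_def wL_def algebra_simps)
        then show ?thesis using int by simp
      qed
      show ?thesis
        unfolding 1 2
        by (intro has_vector_derivative_add has_vector_derivative_mult[OF dL F(3)[OF wL]] has_vector_derivative_mult_right F w)
    qed
    ultimately show ?case by (intro exI[of _ G]) auto
  qed
qed

text \<open>Integration by parts for monomials, read off from the known even and odd moments. For
  \<open>j = 0\<close> the right side is 0 despite the truncated exponent \<open>j - 1\<close>: the
  mean vanishes.\<close>

lemma std_normal_moment_rec:
  "(LINT s|gauss. complex_of_real s ^ Suc j) = of_nat j * (LINT s|gauss. complex_of_real s ^ (j - 1))"
proof -
  have m: "(LINT s|gauss. complex_of_real s ^ i) = complex_of_real (LINT s|lborel. std_normal_density s * s ^ i)" for i
    unfolding gauss_real by (subst integral_density) (auto simp: integral_complex_of_real[symmetric] scaleR_conv_of_real)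
  show ?thesis
  proof (cases "even j")
    case True
    then obtain k where j: "j = 2 * k" by auto
    show ?thesis
    proof (cases k)
      case 0
      then show ?thesis using integral_std_normal_moment_odd[of 0] j unfolding m by simp
    next
      case (Suc i)
      then have "j - 1 = 2 * i + 1" "Suc j = 2 * k + 1" using j by auto
      then show ?thesis
        using integral_std_normal_moment_odd[of k] integral_std_normal_moment_odd[of i]
        unfolding m by simp
    qed
  next
    case False
    then obtain k where j: "j = 2 * k + 1" by (elim oddE)
    have "fact (2 * Suc k) / (2 ^ Suc k * fact (Suc k)) = (real j * (fact (2 * k) / (2 ^ k * fact k)) :: real)"
    proof -
      have "fact (2 * Suc k) = (real (2 * k + 2) * (real (2 * k + 1) * fact (2 * k)) :: real)"
        by (simp add: algebra_simps)
      moreover have "2 ^ Suc k * fact (Suc k) = (real (2 * k + 2) * (2 ^ k * fact k) :: real)"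
        by (simp add: algebra_simps)
      ultimately show ?thesis by (simp add: j del: fact_Suc power_Suc)
    qed
    moreover have "Suc j = 2 * Suc k" "j - 1 = 2 * k" by (auto simp: j)
    ultimately show ?thesis
      using integral_std_normal_moment_even[of k] integral_std_normal_moment_even[of "Suc k"]
      unfolding m by (simp del: fact_Suc power_Suc)
  qed
qed

text \<open>Multiplying by a linear form raises the power of \<open>s\<close>, so the induction
  allows an arbitrary \<open>j\<close>. For constants the claim is the moment recursion; the case
  \<open>j = 0\<close> is integration by parts for \<open>q\<close>.\<close>

lemma gauss_integration_by_parts_real:
  fixes q :: "real \<Rightarrow> complex"
  assumes "cpoly q"
  shows "\<exists>q'. cpoly q' \<and> (\<forall>s. (q has_vector_derivative q' s) (at s)) \<and>
    (\<forall>j. (LINT s|gauss. complex_of_real s ^ Suc j * q s)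
      = (LINT s|gauss. of_nat j * complex_of_real s ^ (j - 1) * q s + complex_of_real s ^ j * q' s))"
proof -
  have cs: "cpoly (\<lambda>s. complex_of_real s)" by (rule cpoly_linear) (simp add: linear_iff)
  obtain d where "pdeg d q" using assms by (auto simp: cpoly_def)
  then show ?thesis
  proof (induction rule: pdeg.induct)
    case (pdeg_const d c)
    have "integrable gauss (\<lambda>s::real. complex_of_real s ^ j)" for j
      by (intro integrable_gauss_cpoly cpoly_power cs)
    then show ?case
      using std_normal_moment_rec by (intro exI[of _ "\<lambda>s. 0"]) (auto simp del: power_Suc intro: cpoly_const)
  next
    case (pdeg_add d f g)
    obtain F where F: "cpoly F" "\<And>s. (f has_vector_derivative F s) (at s)"
      "\<And>j. (LINT s|gauss. complex_of_real s ^ Suc j * f s)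
      = (LINT s|gauss. of_nat j * complex_of_real s ^ (j - 1) * f s + complex_of_real s ^ j * F s)"
      using pdeg_add.IH(1) by blast
    obtain G where G: "cpoly G" "\<And>s. (g has_vector_derivative G s) (at s)"
      "\<And>j. (LINT s|gauss. complex_of_real s ^ Suc j * g s)
      = (LINT s|gauss. of_nat j * complex_of_real s ^ (j - 1) * g s + complex_of_real s ^ j * G s)"
      using pdeg_add.IH(2) by blast
    have c: "cpoly f" "cpoly g" using pdeg_add by (auto simp: cpoly_def)
    have "(LINT s|gauss. complex_of_real s ^ Suc j * (f s + g s)) =
      (LINT s|gauss. of_nat j * complex_of_real s ^ (j - 1) * (f s + g s) + complex_of_real s ^ j * (F s + G s))" for j
    proof -
      have int: "integrable gauss (\<lambda>s. complex_of_real s ^ Suc j * f s)" "integrable gauss (\<lambda>s. complex_of_real s ^ Suc j * g s)"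
        "integrable gauss (\<lambda>s. of_nat j * complex_of_real s ^ (j - 1) * f s + complex_of_real s ^ j * F s)"
        "integrable gauss (\<lambda>s. of_nat j * complex_of_real s ^ (j - 1) * g s + complex_of_real s ^ j * G s)"
        by (intro integrable_gauss_cpoly cpoly_intros cs F G c)+
      have "(LINT s|gauss. complex_of_real s ^ Suc j * (f s + g s))
        = (LINT s|gauss. complex_of_real s ^ Suc j * f s + complex_of_real s ^ Suc j * g s)"
        by (simp only: ring_distribs)
      also have "\<dots> = (LINT s|gauss. of_nat j * complex_of_real s ^ (j - 1) * f s + complex_of_real s ^ j * F s)
        + (LINT s|gauss. of_nat j * complex_of_real s ^ (j - 1) * g s + complex_of_real s ^ j * G s)"
        unfolding Bochner_Integration.integral_add[OF int(1,2)] F G ..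
      also have "\<dots> = (LINT s|gauss. (of_nat j * complex_of_real s ^ (j - 1) * f s + complex_of_real s ^ j * F s)
        + (of_nat j * complex_of_real s ^ (j - 1) * g s + complex_of_real s ^ j * G s))"
        by (rule Bochner_Integration.integral_add[OF int(3,4), symmetric])
      finally show ?thesis by (simp add: algebra_simps)
    qed
    then show ?case
      by (intro exI[of _ "\<lambda>s. F s + G s"]) (auto intro!: cpoly_add has_vector_derivative_add F G)
  next
    case (pdeg_lin d f L)
    obtain F where F: "cpoly F" "\<And>s. (f has_vector_derivative F s) (at s)"
      "\<And>j. (LINT s|gauss. complex_of_real s ^ Suc j * f s)
      = (LINT s|gauss. of_nat j * complex_of_real s ^ (j - 1) * f s + complex_of_real s ^ j * F s)"
      using pdeg_lin.IH by blast
    define c where "c = L 1"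
    have L: "L s = c * s" for s
      using linear_scale[OF pdeg_lin.hyps(2), of s 1] by (simp add: c_def)
    have "(LINT s|gauss. complex_of_real s ^ Suc j * (complex_of_real (L s) * f s)) =
      (LINT s|gauss. of_nat j * complex_of_real s ^ (j - 1) * (complex_of_real (L s) * f s)
         + complex_of_real s ^ j * (complex_of_real c * f s + complex_of_real (L s) * F s))" for j
    proof -
      have "(LINT s|gauss. complex_of_real s ^ Suc j * (complex_of_real (L s) * f s))
        = complex_of_real c * (LINT s|gauss. complex_of_real s ^ Suc (Suc j) * f s)"
        by (subst integral_mult_right_zero[symmetric]) (simp add: L mult_ac)
      also have "\<dots> = (LINT s|gauss. complex_of_real c * (of_nat (Suc j) * complex_of_real s ^ (Suc j - 1) * f s + complex_of_real s ^ Suc j * F s))"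
        unfolding F(3)[of "Suc j"] by (rule integral_mult_right_zero[symmetric])
      also have "\<dots> = (LINT s|gauss. of_nat j * complex_of_real s ^ (j - 1) * (complex_of_real (L s) * f s)
         + complex_of_real s ^ j * (complex_of_real c * f s + complex_of_real (L s) * F s))"
        by (intro Bochner_Integration.integral_cong refl, cases j) (simp_all add: L algebra_simps)
      finally show ?thesis .
    qed
    moreover have "cpoly (\<lambda>s. complex_of_real c * f s + complex_of_real (L s) * F s)"
      using pdeg_lin F by (intro cpoly_intros cpoly_linear) (auto simp: cpoly_def)
    moreover have "((\<lambda>s. complex_of_real (L s) * f s) has_vector_derivative (complex_of_real c * f s + complex_of_real (L s) * F s)) (at s)" for s
    proof -
      have "((\<lambda>s. complex_of_real (L s)) has_vector_derivative complex_of_real c) (at s)"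
        unfolding L by (rule has_vector_derivative_of_real) (auto intro!: derivative_eq_intros)
      from has_vector_derivative_mult[OF this F(2)] show ?thesis by (simp add: add.commute)
    qed
    ultimately show ?case by (intro exI[of _ "\<lambda>s. complex_of_real c * f s + complex_of_real (L s) * F s"]) auto
  qed
qed

text \<open>The coordinate along \<open>b\<close> is standard normal and independent of the rest, so
  the one-dimensional formula applies with the rest held fixed.\<close>

lemma gauss_integration_by_parts:
  fixes g :: "'a::euclidean_space \<Rightarrow> complex"
  assumes g: "cpoly g" and D: "cpoly D" and b: "norm b = 1"
    and deriv: "\<And>x. ((\<lambda>t. g (x + t *\<^sub>R b)) has_vector_derivative D x) (at 0)"
  shows "(LINT z|gauss. complex_of_real (z \<bullet> b) * g z) = (LINT z|gauss. D z)"
proof -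
  note iso = partial_isometry_Basis[OF b]
  have ib: "cpoly (\<lambda>z. complex_of_real (z \<bullet> b))"
    by (rule cpoly_linear) (simp add: linear_iff inner_add_left)
  have bb: "b \<bullet> b = 1" using b by (simp add: norm_eq_1)
  define R where "R a y = a *\<^sub>R b + (y - (y \<bullet> b) *\<^sub>R b)" for a y
  have Rb: "R a y \<bullet> b = a" for a y by (simp add: R_def inner_add_left inner_diff_left bb)
  have int: "integrable gauss (\<lambda>z. complex_of_real (z \<bullet> b) * g z)" "integrable gauss D"
    by (intro integrable_gauss_cpoly cpoly_mult ib g D)+
  have "(LINT z|gauss. complex_of_real (z \<bullet> b) * g z) = (LINT a|gauss. LINT y|gauss. complex_of_real a * g (R a y))"
    using integral_gauss_resample[OF iso int(1)] by (simp add: R_def[symmetric] Rb)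
  also have "\<dots> = (LINT y|gauss. LINT a|gauss. complex_of_real a * g (R a y))"
    using gauss_pair.Fubini_integral[OF integrable_gauss_resample[OF iso int(1)]]
    by (simp add: R_def[symmetric] Rb)
  also have "\<dots> = (LINT y|gauss. LINT a|gauss. D (R a y))"
  proof (rule Bochner_Integration.integral_cong[OF refl])
    fix y
    have "linear (\<lambda>a::real. a *\<^sub>R b)" by (simp add: linear_iff scaleR_add_left)
    then have "cpoly (\<lambda>a. g ((y - (y \<bullet> b) *\<^sub>R b) + a *\<^sub>R b))"
      by (rule cpoly_affine_image[OF g])
    then have "cpoly (\<lambda>a. g (R a y))" by (simp add: R_def add.commute)
    from gauss_integration_by_parts_real[OF this] obtain q' where q': "cpoly q'"
      "\<And>s. ((\<lambda>a. g (R a y)) has_vector_derivative q' s) (at s)"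
      "\<And>j. (LINT s|gauss. complex_of_real s ^ Suc j * g (R s y))
      = (LINT s|gauss. of_nat j * complex_of_real s ^ (j - 1) * g (R s y) + complex_of_real s ^ j * q' s)"
      by blast
    have "((\<lambda>a. g (R a y)) has_vector_derivative D (R s y)) (at s)" for s
      using has_vector_derivative_line_shift[of g b D "y - (y \<bullet> b) *\<^sub>R b" s, OF deriv]
      by (simp add: R_def add.commute)
    then have "q' s = D (R s y)" for s
      using q'(2) vector_derivative_unique_at by blast
    then show "(LINT a|gauss. complex_of_real a * g (R a y)) = (LINT a|gauss. D (R a y))"
      using q'(3)[of 0] by simp
  qed
  also have "\<dots> = (LINT a|gauss. LINT y|gauss. D (R a y))"
    using gauss_pair.Fubini_integral[OF integrable_gauss_resample[OF iso int(2)]]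
    by (simp add: R_def[symmetric])
  also have "\<dots> = (LINT z|gauss. D z)"
    using integral_gauss_resample[OF iso int(2)] by (simp add: R_def[symmetric])
  finally show ?thesis .
qed

text \<open>
  With \<open>u t\<close> the Gaussian average of \<open>f (x + t z)\<close>, integration by parts gives
  \<open>u' t = t\<close> times the average of the Laplacian of \<open>f\<close>.
\<close>

lemma harmonic_gauss_mean_value:
  fixes f :: "'a::euclidean_space \<Rightarrow> complex"
  assumes f: "cpoly f" and harm: "\<And>x. laplacian f x = 0"
  shows "(LINT z|gauss. f (x + z)) = f x"
proof -
  obtain G where G: "\<And>b. cpoly (G b)"
    "\<And>x z. ((\<lambda>t. f (x + t *\<^sub>R z)) has_vector_derivative (\<Sum>b\<in>Basis. (z \<bullet> b) *\<^sub>R G b x)) (at 0)"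
    using cpoly_derivative[OF f] by metis
  have "\<exists>H. (\<forall>c. cpoly (H c)) \<and> (\<forall>x z. ((\<lambda>t. G b (x + t *\<^sub>R z)) has_vector_derivative (\<Sum>c\<in>Basis. (z \<bullet> c) *\<^sub>R H c x)) (at 0))" for b
    by (rule cpoly_derivative[OF G(1)])
  then obtain H where H: "\<And>b c. cpoly (H b c)"
    "\<And>b x z. ((\<lambda>t. G b (x + t *\<^sub>R z)) has_vector_derivative (\<Sum>c\<in>Basis. (z \<bullet> c) *\<^sub>R H b c x)) (at 0)"
    by metis
  have B: "(\<Sum>c\<in>Basis. (b \<bullet> c) *\<^sub>R K c) = K b" if "b \<in> Basis" for b and K :: "'a \<Rightarrow> complex"
  proof -
    have "(\<Sum>c\<in>Basis. (b \<bullet> c) *\<^sub>R K c) = (\<Sum>c\<in>Basis. if c = b then K b else 0)"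
      using that by (intro sum.cong) (auto simp: inner_Basis)
    then show ?thesis using that by simp
  qed
  have dG: "((\<lambda>t. f (y + t *\<^sub>R b)) has_vector_derivative G b (y + t *\<^sub>R b)) (at t)" if "b \<in> Basis" for y b t
    by (rule has_vector_derivative_line_shift[of f b "G b"]) (use G(2)[of _ b] B[OF that] in simp)
  have dH: "((\<lambda>t. G b (y + t *\<^sub>R b)) has_vector_derivative H b b (y + t *\<^sub>R b)) (at t)" if "b \<in> Basis" for y b t
    by (rule has_vector_derivative_line_shift[of "G b" b "H b b"]) (use H(2)[of b _ b] B[OF that] in simp)
  have "laplacian f y = (\<Sum>b\<in>Basis. H b b y)" for y
    unfolding laplacian_def
  proof (rule sum.cong[OF refl])
    fix b :: 'a assume b: "b \<in> Basis"
    have "(\<lambda>t. vector_derivative (\<lambda>s. f (y + s *\<^sub>R b)) (at t)) = (\<lambda>t. G b (y + t *\<^sub>R b))"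
      using vector_derivative_at[OF dG[OF b]] by auto
    then show "vector_derivative (\<lambda>t. vector_derivative (\<lambda>s. f (y + s *\<^sub>R b)) (at t)) (at 0) = H b b y"
      using vector_derivative_at[OF dH[OF b, of y 0]] by simp
  qed
  then have harm: "(\<Sum>b\<in>Basis. H b b y) = 0" for y using harm by simp
  obtain F where F: "\<And>t. cpoly (F t)" "\<And>t z. ((\<lambda>t. f (x + t *\<^sub>R z)) has_vector_derivative F t z) (at t)"
    "\<And>w t. cpoly w \<Longrightarrow> ((\<lambda>t. LINT z|gauss. w z * f (x + t *\<^sub>R z)) has_vector_derivative
      (LINT z|gauss. w z * F t z)) (at t)"
    using cpoly_line_integral_derivative[OF f, of x] by blast
  have Feq: "F t z = (\<Sum>b\<in>Basis. (z \<bullet> b) *\<^sub>R G b (x + t *\<^sub>R z))" for t z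
    using has_vector_derivative_line_shift[of f z "\<lambda>y. \<Sum>b\<in>Basis. (z \<bullet> b) *\<^sub>R G b y", OF G(2)] F(2)
      vector_derivative_unique_at by blast
  have tr: "linear (\<lambda>z::'a. t *\<^sub>R z)" for t by (simp add: linear_iff scaleR_add_right)
  have cH: "cpoly (\<lambda>z. complex_of_real t * H b b (x + t *\<^sub>R z))" for b t
    by (intro cpoly_mult cpoly_const cpoly_affine_image[OF _ tr] H)
  have "(LINT z|gauss. F t z) = 0" for t
  proof -
    have cG: "cpoly (\<lambda>z. G b (x + t *\<^sub>R z))" for b
      by (intro cpoly_affine_image[OF _ tr] G)
    have "(LINT z|gauss. F t z) = (LINT z|gauss. (\<Sum>b\<in>Basis. complex_of_real (z \<bullet> b) * G b (x + t *\<^sub>R z)))"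
      by (simp add: Feq scaleR_conv_of_real)
    also have "\<dots> = (\<Sum>b\<in>Basis. LINT z|gauss. complex_of_real (z \<bullet> b) * G b (x + t *\<^sub>R z))"
      by (intro Bochner_Integration.integral_sum integrable_gauss_cpoly cpoly_mult cG cpoly_linear)
        (simp add: linear_iff inner_add_left)
    \<comment> \<open>Differentiating \<open>G b (x + t *\<^sub>R z)\<close> in \<open>z\<close>
      along \<open>b\<close> brings out a factor \<open>t\<close> and a pure second derivative of
      \<open>f\<close>.\<close>
    also have "\<dots> = (\<Sum>b\<in>Basis. LINT z|gauss. complex_of_real t * H b b (x + t *\<^sub>R z))"
    proof (intro sum.cong refl gauss_integration_by_parts[OF cG cH])
      fix b :: 'a assume b: "b \<in> Basis"
      show "norm b = 1" using b by simp
      fix z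
      have 1: "((\<lambda>s. t * s) has_vector_derivative t) (at 0)"
        unfolding has_real_derivative_iff_has_vector_derivative[symmetric] by (auto intro!: derivative_eq_intros)
      have 2: "((\<lambda>s. G b ((x + t *\<^sub>R z) + s *\<^sub>R b)) has_vector_derivative H b b (x + t *\<^sub>R z)) (at (t * 0))"
        using dH[OF b, of "x + t *\<^sub>R z" 0] by simp
      from vector_diff_chain_at[OF 1 2]
      show "((\<lambda>s. G b (x + t *\<^sub>R (z + s *\<^sub>R b))) has_vector_derivative complex_of_real t * H b b (x + t *\<^sub>R z)) (at 0)"
        by (simp add: comp_def scaleR_add_right add.assoc scaleR_conv_of_real)
    qed
    also have "\<dots> = (LINT z|gauss. (\<Sum>b\<in>Basis. complex_of_real t * H b b (x + t *\<^sub>R z)))"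
      by (intro Bochner_Integration.integral_sum[symmetric] integrable_gauss_cpoly cH)
    also have "\<dots> = 0"
      by (simp add: sum_distrib_left[symmetric] harm)
    finally show ?thesis .
  qed
  then have "((\<lambda>t. LINT z|gauss. f (x + t *\<^sub>R z)) has_vector_derivative 0) (at t)" for t
    using F(3)[OF cpoly_const[of 1], of t] by simp
  then have "(LINT z|gauss. f (x + 1 *\<^sub>R z)) = (LINT z|gauss. f (x + 0 *\<^sub>R z))"
    by (intro has_derivative_zero_unique[of UNIV "\<lambda>t. LINT z|gauss. f (x + t *\<^sub>R z)"])
      (auto simp: has_vector_derivative_def)
  then show ?thesis by simp
qed

subsection \<open>Averaging holomorphic functions of complex Gaussian matrices\<close>

lemma sum_root_unity_power:
  assumes "0 < l" "l < n"
  shows "(\<Sum>r<n. (cis (2 * pi / n) ^ r) ^ l) = 0"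
proof -
  define x where "x = cis (2 * pi / n) ^ l"
  have x: "(cis (2 * pi / n) ^ r) ^ l = x ^ r" for r
    by (simp add: x_def power_mult[symmetric] mult.commute)
  have "x \<noteq> 1"
  proof
    assume "x = 1"
    then have "cis (real l * (2 * pi / n)) = 1" using Complex.DeMoivre[of "2 * pi / n" l] by (simp only: x_def)
    then have "cos (real l * (2 * pi / n)) = 1" by (metis cis.simps(1) one_complex.simps(1))
    then obtain j :: int where j: "real l * (2 * pi / n) = of_int j * 2 * pi"
      using cos_one_2pi_int by auto
    then have "real l = of_int j * real n" using assms by (simp add: field_simps)
    then have "real_of_int (int l) = real_of_int (j * int n)" by simp
    then have "int l = j * int n" by (simp only: of_int_eq_iff)
    then have "int n dvd int l" by simp
    then show False using assms by (metis int_dvd_int_iff nat_dvd_not_less)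
  qed
  moreover have "x ^ n = 1"
  proof -
    have "x ^ n = (cis (2 * pi / n) ^ n) ^ l"
      by (simp add: x_def power_mult[symmetric] mult.commute)
    also have "cis (2 * pi / n) ^ n = 1" using assms by (simp add: Complex.DeMoivre)
    finally show ?thesis by simp
  qed
  ultimately show ?thesis by (simp add: x geometric_sum)
qed

lemma poly_root_unity_average:
  assumes "degree p < n"
  shows "(\<Sum>r<n. poly p (cis (2 * pi / n) ^ r)) = of_nat n * poly p 0"
proof -
  have "(\<Sum>r<n. poly p (cis (2 * pi / n) ^ r))
      = (\<Sum>r<n. \<Sum>l\<le>degree p. coeff p l * (cis (2 * pi / n) ^ r) ^ l)"
    by (simp add: poly_altdef)
  also have "\<dots> = (\<Sum>l\<le>degree p. coeff p l * (\<Sum>r<n. (cis (2 * pi / n) ^ r) ^ l))"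
    by (subst sum.swap) (simp add: sum_distrib_left)
  also have "\<dots> = (\<Sum>l\<le>degree p. if l = 0 then of_nat n * coeff p 0 else 0)"
    by (intro sum.cong refl) (use assms sum_root_unity_power in auto)
  also have "\<dots> = of_nat n * poly p 0"
    by (simp add: poly_0_coeff_0)
  finally show ?thesis .
qed

text \<open>The degree bound tells how many roots of unity suffice for averaging. Polynomiality
  makes the singular shifts of a matrix finite in number once one shift is invertible.\<close>

lemma det_affine_poly:
  fixes A C :: "'a::field^'m^'m"
  shows "\<exists>p. degree p \<le> CARD('m) \<and> (\<forall>s. poly p s = det (\<chi> i j. A$i$j + s * C$i$j))"
proof (intro exI conjI allI)
  define p where "p = (\<Sum>q | q permutes (UNIV::'m set). of_int (sign q) * (\<Prod>i\<in>UNIV. [:A$i$q i, C$i$q i:]))"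
  have "degree (of_int (sign q) * (\<Prod>i\<in>UNIV. [:A$i$q i, C$i$q i:])) \<le> CARD('m)" for q
  proof -
    have "degree (\<Prod>i\<in>UNIV. [:A$i$q i, C$i$q i:]) \<le> (\<Sum>i\<in>(UNIV::'m set). degree [:A$i$q i, C$i$q i:])"
      using degree_prod_sum_le[of "UNIV::'m set" "\<lambda>i. [:A$i$q i, C$i$q i:]"] by (simp add: comp_def)
    also have "\<dots> \<le> (\<Sum>i\<in>(UNIV::'m set). 1)" by (intro sum_mono) simp
    finally have "degree (\<Prod>i\<in>UNIV. [:A$i$q i, C$i$q i:]) \<le> CARD('m)" by simp
    then show ?thesis
      using degree_mult_le[of "of_int (sign q) :: 'a poly" "\<Prod>i\<in>UNIV. [:A$i$q i, C$i$q i:]"] by simp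
  qed
  then show "degree p \<le> CARD('m)"
    unfolding p_def by (intro degree_sum_le) (auto simp: finite_permutations)
  show "poly p s = det (\<chi> i j. A$i$j + s * C$i$j)" for s
    unfolding p_def det_def by (simp add: poly_sum poly_prod)
qed

text \<open>On top of the deterministic \<open>D\<close>, entries in \<open>S\<close> carry a full
  complex Gaussian scaled by \<open>s\<close>, the others only its imaginary part. It is used with
  \<open>S\<close> containing every entry, to invert Gaussian convolution, and with \<open>S\<close>
  the strict lower triangle, where \<open>s = 0\<close> leaves an upper triangular matrix.\<close>

definition masked :: "('m \<Rightarrow> 'm \<Rightarrow> bool) \<Rightarrow> complex^'m^'m \<Rightarrow> complex \<Rightarrow> real^'m^'m \<Rightarrow> real^'m^'m \<Rightarrow> complex^'m^'m" where
  "masked S D s z b = (\<chi> i j. D$i$j +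
     (if S i j then s * (complex_of_real (z$i$j) + \<i> * complex_of_real (b$i$j))
      else \<i> * complex_of_real (b$i$j)))"

lemma linear_entry_fst: "linear (\<lambda>p::(real^'m^'n) \<times> 'b::real_vector. fst p $ i $ j)"
  by (simp add: linear_iff)

lemma linear_entry_snd: "linear (\<lambda>p::'b::real_vector \<times> (real^'m^'n). snd p $ i $ j)"
  by (simp add: linear_iff)

lemma cpoly_masked: "cpoly (\<lambda>p. det (masked S D s (fst p) (snd p)) ^ k)"
proof (intro cpoly_power cpoly_det)
  fix i j
  show "cpoly (\<lambda>p. masked S D s (fst p) (snd p) $ i $ j)"
    by (cases "S i j") (auto simp: masked_def intro!: cpoly_intros cpoly_linear linear_entry_fst linear_entry_snd)
qed

text \<open>
  The entries selected by \<open>S\<close> form a rotation invariant family of complex Gaussians. The average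
  over \<open>s\<close> in a group of roots of unity of high order picks the constant term in \<open>s\<close>.
\<close>

lemma gauss_masked_mean_pair:
  "(LINT p|gauss. det (masked S D 1 (fst p) (snd p)) ^ k) = (LINT p|gauss. det (masked S D 0 (fst p) (snd p)) ^ k)"
proof -
  define \<phi> where "\<phi> s = (LINT p|gauss. det (masked S D s (fst p) (snd p)) ^ k)" for s
  define n where "n = Suc (k * CARD('a))"
  have rot: "\<phi> (cis \<theta>) = \<phi> 1" for \<theta>
  proof -
    \<comment> \<open>Rotation by \<theta> in each selected pair of real and imaginary parts
      multiplies that complex entry by \<open>cis \<theta>\<close> and preserves the joint Gaussian
      law.\<close>
    define f where "f p = ((\<chi> i j. if S i j then cos \<theta> * fst p $ i $ j - sin \<theta> * snd p $ i $ j else fst p $ i $ j) :: real^'a^'a,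
      (\<chi> i j. if S i j then sin \<theta> * fst p $ i $ j + cos \<theta> * snd p $ i $ j else snd p $ i $ j) :: real^'a^'a)" for p
    have lin: "linear f"
      by (rule linearI) (auto simp: f_def vec_eq_iff algebra_simps)
    have rs: "(cos \<theta> * x - sin \<theta> * y)\<^sup>2 + (sin \<theta> * x + cos \<theta> * y)\<^sup>2 = x\<^sup>2 + y\<^sup>2" for x y
    proof -
      have "(cos \<theta> * x - sin \<theta> * y)\<^sup>2 + (sin \<theta> * x + cos \<theta> * y)\<^sup>2 = ((sin \<theta>)\<^sup>2 + (cos \<theta>)\<^sup>2) * (x\<^sup>2 + y\<^sup>2)"
        by algebra
      then show ?thesis by simp
    qed
    have "norm (f p) = norm p" for p
    proof -
      have "(norm (f p))\<^sup>2 = (\<Sum>i\<in>UNIV. \<Sum>j\<in>UNIV. (fst (f p) $ i $ j)\<^sup>2 + (snd (f p) $ i $ j)\<^sup>2)"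
        by (simp add: norm_prod_def norm_matrix_sq sum.distrib sum_nonneg)
      also have "\<dots> = (\<Sum>i\<in>UNIV. \<Sum>j\<in>UNIV. (fst p $ i $ j)\<^sup>2 + (snd p $ i $ j)\<^sup>2)"
        by (intro sum.cong refl) (simp add: f_def rs)
      also have "\<dots> = (norm p)\<^sup>2"
        by (simp add: norm_prod_def norm_matrix_sq sum.distrib sum_nonneg)
      finally show ?thesis by simp
    qed
    then have "(LINT p|gauss. det (masked S D 1 (fst (f p)) (snd (f p))) ^ k) = \<phi> 1"
      unfolding \<phi>_def
      using integral_gauss_norm_preserving[OF lin _ cpoly_measurable[OF cpoly_masked]] by blast
    moreover have "masked S D 1 (fst (f p)) (snd (f p)) = masked S D (cis \<theta>) (fst p) (snd p)" for p
      by (simp add: masked_def f_def vec_eq_iff complex_eq_iff algebra_simps)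
    ultimately show ?thesis by (simp add: \<phi>_def)
  qed
  have int: "integrable gauss (\<lambda>p. det (masked S D s (fst p) (snd p)) ^ k)" for s
    by (intro integrable_gauss_cpoly cpoly_masked)
  have avg: "(\<Sum>r<n. det (masked S D (cis (2 * pi / n) ^ r) z b) ^ k) = of_nat n * det (masked S D 0 z b) ^ k" for z b
  proof -
    define A where "A = (\<chi> i j. D$i$j + (if S i j then 0 else \<i> * complex_of_real (b$i$j)))"
    define C where "C = (\<chi> i j. if S i j then complex_of_real (z$i$j) + \<i> * complex_of_real (b$i$j) else 0)"
    have m: "masked S D s z b = (\<chi> i j. A$i$j + s * C$i$j)" for s
      by (auto simp: masked_def A_def C_def vec_eq_iff)
    obtain p where p: "degree p \<le> CARD('a)" "\<And>s. poly p s = det (masked S D s z b)"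
      unfolding m using det_affine_poly[of A C] by blast
    have "degree (p ^ k) \<le> degree p * k" by (rule degree_power_le)
    also have "\<dots> < n" using p(1) by (simp add: n_def less_Suc_eq_le mult.commute)
    finally show ?thesis
      using poly_root_unity_average[of "p ^ k" n] p(2) by (simp add: poly_power)
  qed
  \<comment> \<open>All \<open>n\<close> rotated integrals equal \<open>\<phi> 1\<close>, while
    under the integral sign their sum is \<open>n\<close> times the constant term in
    \<open>s\<close>.\<close>
  have "of_nat n * \<phi> 1 = (\<Sum>r<n. \<phi> (cis (2 * pi / n) ^ r))"
    by (simp add: Complex.DeMoivre rot)
  also have "\<dots> = (LINT p|gauss. (\<Sum>r<n. det (masked S D (cis (2 * pi / n) ^ r) (fst p) (snd p)) ^ k))"
    unfolding \<phi>_def by (intro Bochner_Integration.integral_sum[symmetric] int)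
  also have "\<dots> = of_nat n * \<phi> 0"
    unfolding avg \<phi>_def by simp
  finally have "of_nat n * \<phi> 1 = of_nat n * \<phi> 0" .
  moreover have "(of_nat n :: complex) \<noteq> 0" by (simp only: n_def of_nat_eq_0_iff)
  ultimately have "\<phi> 1 = \<phi> 0" by simp
  then show ?thesis by (simp add: \<phi>_def)
qed

lemma integral_gauss_pair:
  fixes f :: "'a::euclidean_space \<Rightarrow> 'b::euclidean_space \<Rightarrow> complex"
  assumes "integrable gauss (\<lambda>p. f (fst p) (snd p))"
  shows "(LINT p|gauss. f (fst p) (snd p)) = (LINT x|gauss. LINT y|gauss. f x y)"
proof -
  have "integrable (gauss \<Otimes>\<^sub>M gauss) (\<lambda>p. f (fst p) (snd p))"
    using assms by (simp add: gauss_prod)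
  from gauss_pair.integral_fst'[OF this] show ?thesis by (simp add: gauss_prod)
qed

lemma gauss_masked_mean:
  "(LINT z|gauss. LINT b|gauss. det (masked S D 1 z b) ^ k) = (LINT b|gauss. det (masked S D 0 0 b) ^ k)"
proof -
  have "masked S D 0 z b = masked S D 0 0 b" for z b by (simp add: masked_def vec_eq_iff)
  then have 0: "det (masked S D 0 (fst p) (snd p)) = det (masked S D 0 0 (snd p))" for p by metis
  have int: "integrable gauss (\<lambda>p. det (masked S D s (fst p) (snd p)) ^ k)" for s
    by (intro integrable_gauss_cpoly cpoly_masked)
  have "(LINT z|gauss. LINT b|gauss. det (masked S D 1 z b) ^ k) = (LINT p|gauss. det (masked S D 1 (fst p) (snd p)) ^ k)"
    by (rule integral_gauss_pair[OF int, symmetric])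
  also have "\<dots> = (LINT p|gauss. det (masked S D 0 (fst p) (snd p)) ^ k)"
    by (rule gauss_masked_mean_pair)
  also have "\<dots> = (LINT z|gauss. LINT b|gauss. det (masked S D 0 z b) ^ k)"
    by (rule integral_gauss_pair[OF int])
  also have "\<dots> = (LINT b|gauss. det (masked S D 0 0 b) ^ k)"
  proof -
    have "det (masked S D 0 z b) ^ k = det (masked S D 0 0 b) ^ k" for z b
      using 0[of "(z, b)"] by (simp only: fst_conv snd_conv)
    then have "(\<lambda>z b. det (masked S D 0 z b) ^ k) = (\<lambda>z b. det (masked S D 0 0 b) ^ k)"
      by (intro ext)
    then have "(LINT z|gauss. LINT b|gauss. det (masked S D 0 z b) ^ k)
        = (LINT z|(gauss :: (real^'a^'a) measure). LINT b|gauss. det (masked S D 0 0 b) ^ k)"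
      by (rule arg_cong)
    then show ?thesis by simp
  qed
  finally show ?thesis .
qed

subsection \<open>Independent rows\<close>

lemma borel_measurable_matrixI:
  fixes f :: "'a \<Rightarrow> real^'m^'n"
  assumes "\<And>i j. (\<lambda>x. f x $ i $ j) \<in> borel_measurable M"
  shows "f \<in> borel_measurable M"
proof (subst borel_measurable_euclidean_space, rule ballI)
  fix b :: "real^'m^'n" assume "b \<in> Basis"
  then obtain i j where b: "b = axis i (axis j 1)" using Basis_matrixE by blast
  show "(\<lambda>x. f x \<bullet> b) \<in> borel_measurable M"
    using assms[of i j] by (simp add: b inner_axis)
qed

lemma borel_measurable_entry [measurable]: "(\<lambda>x::real^'m^'n. x $ i $ j) \<in> borel_measurable borel"
  by (rule borel_measurable_linear) (simp add: linear_iff)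

lemma borel_measurable_row [measurable]: "(\<lambda>x::'a::euclidean_space^'n. x $ i) \<in> borel_measurable borel"
  by (rule borel_measurable_linear) (simp add: linear_iff)

definition set_row :: "'n \<Rightarrow> 'a::euclidean_space \<Rightarrow> 'a^'n \<Rightarrow> 'a^'n" where
  "set_row a y z = axis a y + (z - axis a (z $ a))"

lemma set_row_nth: "set_row a y z $ i = (if i = a then y else z $ i)"
  by (auto simp: set_row_def axis_def)

lemma set_row_measurable [measurable]:
  fixes y :: "'a::euclidean_space" and a :: "'n::finite"
  shows "set_row a y \<in> borel_measurable borel"
proof -
  have "linear (\<lambda>z::'a^'n. z - axis a (z $ a))"
    by (auto simp: linear_iff vec_eq_iff axis_def algebra_simps)
  from borel_measurable_linear[OF this] show ?thesis unfolding set_row_def[abs_def] by measurable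
qed

lemma nn_integral_gauss_set_row:
  assumes "f \<in> borel_measurable borel"
  shows "(\<integral>\<^sup>+z. f z \<partial>gauss) = (\<integral>\<^sup>+y. \<integral>\<^sup>+z. f (set_row a y z) \<partial>gauss \<partial>gauss)"
  using nn_integral_gauss_resample[OF partial_isometry_row assms] by (simp add: set_row_def)

text \<open>Independence of the rows, obtained by resampling one row at a time.\<close>

lemma nn_integral_gauss_prod_rows:
  fixes f :: "'n::finite \<Rightarrow> 'a::euclidean_space \<Rightarrow> ennreal"
  assumes [measurable]: "\<And>i. f i \<in> borel_measurable borel"
  shows "(\<integral>\<^sup>+z. (\<Prod>i\<in>S. f i ((z::'a^'n) $ i)) \<partial>gauss) = (\<Prod>i\<in>S. \<integral>\<^sup>+y. f i y \<partial>gauss)"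
  using finite[of S]
proof (induction S rule: finite_induct)
  case empty
  then show ?case using gauss.emeasure_space_1 by simp
next
  case (insert a S)
  have "(\<integral>\<^sup>+z. (\<Prod>i\<in>insert a S. f i ((z::'a^'n) $ i)) \<partial>gauss)
      = (\<integral>\<^sup>+y. \<integral>\<^sup>+z. (\<Prod>i\<in>insert a S. f i (set_row a y z $ i)) \<partial>gauss \<partial>gauss)"
    by (rule nn_integral_gauss_set_row) measurable
  also have "\<dots> = (\<integral>\<^sup>+y. \<integral>\<^sup>+z. f a y * (\<Prod>i\<in>S. f i ((z::'a^'n) $ i)) \<partial>gauss \<partial>gauss)"
  proof (intro nn_integral_cong)
    fix y and z :: "'a^'n"
    have "(\<Prod>i\<in>S. f i (set_row a y z $ i)) = (\<Prod>i\<in>S. f i (z $ i))"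
      by (intro prod.cong refl) (use insert in \<open>auto simp: set_row_nth\<close>)
    then show "(\<Prod>i\<in>insert a S. f i (set_row a y z $ i)) = f a y * (\<Prod>i\<in>S. f i (z $ i))"
      using insert by (simp add: set_row_nth)
  qed
  also have "\<dots> = (\<integral>\<^sup>+y. f a y \<partial>gauss) * (\<Prod>i\<in>S. \<integral>\<^sup>+y. f i y \<partial>gauss)"
    by (simp add: nn_integral_cmult nn_integral_multc insert.IH)
  finally show ?case using insert by simp
qed

lemma prod_less_infinity_ennreal: "(\<And>i. i \<in> S \<Longrightarrow> f i < (\<infinity>::ennreal)) \<Longrightarrow> (\<Prod>i\<in>S. f i) < \<infinity>"
  by (induction S rule: infinite_finite_induct) (auto simp: ennreal_mult_less_top)

lemma integrable_gauss_prod_rows: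
  fixes f :: "'n::finite \<Rightarrow> 'a::euclidean_space \<Rightarrow> complex"
  assumes f: "\<And>i. integrable gauss (f i)"
  shows "integrable gauss (\<lambda>z::'a^'n. \<Prod>i\<in>S. f i (z $ i))"
proof (rule integrableI_bounded)
  have [measurable]: "f i \<in> borel_measurable borel" for i
    using borel_measurable_integrable[OF f[of i]] by simp
  show "(\<lambda>z::'a^'n. \<Prod>i\<in>S. f i (z $ i)) \<in> borel_measurable gauss" by measurable
  have "(\<integral>\<^sup>+z. ennreal (norm (\<Prod>i\<in>S. f i ((z::'a^'n) $ i))) \<partial>gauss) = (\<Prod>i\<in>S. \<integral>\<^sup>+y. ennreal (norm (f i y)) \<partial>gauss)"
    by (subst nn_integral_gauss_prod_rows[symmetric]) (auto simp: prod_norm[symmetric] prod_ennreal)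
  also have "\<dots> < \<infinity>"
    by (rule prod_less_infinity_ennreal) (use f in \<open>simp add: integrable_iff_bounded\<close>)
  finally show "(\<integral>\<^sup>+z. ennreal (norm (\<Prod>i\<in>S. f i ((z::'a^'n) $ i))) \<partial>gauss) < \<infinity>" .
qed

lemma integral_gauss_prod_rows:
  fixes f :: "'n::finite \<Rightarrow> 'a::euclidean_space \<Rightarrow> complex"
  assumes f: "\<And>i. integrable gauss (f i)"
  shows "(LINT z|gauss. (\<Prod>i\<in>S. f i ((z::'a^'n) $ i))) = (\<Prod>i\<in>S. LINT y|gauss. f i y)"
  using finite[of S]
proof (induction S rule: finite_induct)
  case (insert a S)
  have "(LINT z|gauss. (\<Prod>i\<in>insert a S. f i ((z::'a^'n) $ i)))
      = (LINT y|gauss. LINT z|gauss. (\<Prod>i\<in>insert a S. f i (set_row a y (z::'a^'n) $ i)))"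
    unfolding set_row_def
    by (rule integral_gauss_resample[OF partial_isometry_row integrable_gauss_prod_rows[OF f]])
  also have "\<dots> = (LINT y|gauss. LINT z|gauss. f a y * (\<Prod>i\<in>S. f i ((z::'a^'n) $ i)))"
  proof (intro Bochner_Integration.integral_cong refl)
    fix y and z :: "'a^'n"
    have "(\<Prod>i\<in>S. f i (set_row a y z $ i)) = (\<Prod>i\<in>S. f i (z $ i))"
      by (intro prod.cong refl) (use insert in \<open>auto simp: set_row_nth\<close>)
    then show "(\<Prod>i\<in>insert a S. f i (set_row a y z $ i)) = f a y * (\<Prod>i\<in>S. f i (z $ i))"
      using insert by (simp add: set_row_nth)
  qed
  also have "\<dots> = (LINT y|gauss. f a y) * (\<Prod>i\<in>S. LINT y|gauss. f i y)"
    by (simp add: insert.IH)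
  finally show ?case using insert by simp
qed simp

subsection \<open>Triangularisation of a Gaussian matrix\<close>

definition tail_norm :: "'m::{finite,linorder} \<Rightarrow> real^('m::{finite,linorder}) \<Rightarrow> real" where
  "tail_norm a y = sqrt (\<Sum>l\<in>{a..}. (y $ l)\<^sup>2)"

text \<open>This is not the triangular factor of \<open>z\<close>: below the diagonal it keeps the
  entries of \<open>z\<close> itself, and on the diagonal it has the norms of the row tails. Only
  the laws of right orthogonally invariant functions of \<open>z\<close> and of \<open>tri z\<close>
  agree. The gain is that distinct rows of \<open>tri z\<close> depend on distinct rows of
  \<open>z\<close>.\<close>

definition tri :: "real^('m::{finite,linorder})^('m::{finite,linorder}) \<Rightarrow> real^('m::{finite,linorder})^('m::{finite,linorder})" where
  "tri z = (\<chi> i j. if j < i then z $ i $ j else if j = i then tail_norm i (z $ i) else 0)"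

definition tri_on where
  "tri_on A z = (\<chi> i. if i \<in> A then tri z $ i else z $ i)"

lemma tail_norm_nonneg [simp]: "tail_norm a y \<ge> 0"
  by (simp add: tail_norm_def sum_nonneg)

lemma tail_norm_measurable [measurable]: "tail_norm a \<in> borel_measurable borel"
  unfolding tail_norm_def[abs_def] by measurable

lemma tri_measurable [measurable]: "tri \<in> borel_measurable borel"
  by (rule borel_measurable_matrixI) (simp add: tri_def)

lemma tri_on_measurable [measurable]: "tri_on A \<in> borel_measurable borel"
proof (rule borel_measurable_matrixI)
  fix i j
  show "(\<lambda>x. tri_on A x $ i $ j) \<in> borel_measurable borel"
    by (cases "i \<in> A") (simp_all add: tri_on_def)
qed

text \<open>For \<open>n = 0\<close> the quotient by \<open>n \<bullet> n\<close> is 0 and the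
  matrix is the identity, which covers vectors that are already in place.\<close>

definition householder :: "real^'m \<Rightarrow> real^'m^'m" where
  "householder n = (\<chi> i j. (if i = j then 1 else 0) - 2 / (n \<bullet> n) * (n $ i * n $ j))"

lemma mult_householder: "(z ** householder n) $ i $ j = z $ i $ j - 2 / (n \<bullet> n) * (z $ i \<bullet> n) * n $ j"
proof -
  let ?c = "2 / (n \<bullet> n)"
  have "(z ** householder n) $ i $ j = (\<Sum>k\<in>UNIV. z $ i $ k * ((if k = j then 1 else 0) - ?c * (n $ k * n $ j)))"
    by (simp add: matrix_matrix_mult_def householder_def)
  also have "\<dots> = (\<Sum>k\<in>UNIV. (if k = j then z $ i $ k else 0) - ?c * n $ j * (z $ i $ k * n $ k))"
    by (intro sum.cong refl) (simp add: right_diff_distrib)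
  also have "\<dots> = z $ i $ j - ?c * n $ j * (z $ i \<bullet> n)"
    unfolding sum_subtractf sum_distrib_left[symmetric] by (simp add: inner_vec_def)
  finally show ?thesis by simp
qed

lemma orthogonal_householder: "orthogonal_matrix (householder n)"
proof -
  have t: "transpose (householder n) = householder n"
    by (simp add: transpose_def householder_def vec_eq_iff mult.commute)
  have "(householder n $ i \<bullet> n) = n $ i - 2 / (n \<bullet> n) * n $ i * (n \<bullet> n)" for i
  proof -
    let ?c = "2 / (n \<bullet> n)"
    have "householder n $ i \<bullet> n = (\<Sum>k\<in>UNIV. ((if i = k then 1 else 0) - ?c * (n $ i * n $ k)) * n $ k)"
      by (simp add: inner_vec_def[of _ n] householder_def)
    also have "\<dots> = (\<Sum>k\<in>UNIV. (if i = k then n $ k else 0) - ?c * n $ i * (n $ k * n $ k))"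
      by (intro sum.cong refl) (simp add: left_diff_distrib)
    also have "\<dots> = n $ i - ?c * n $ i * (n \<bullet> n)"
      unfolding sum_subtractf sum_distrib_left[symmetric] by (simp add: inner_vec_def)
    finally show ?thesis .
  qed
  then have "(householder n ** householder n) $ i $ j = mat 1 $ i $ j" for i j
    by (subst mult_householder) (cases "n = 0"; simp add: householder_def mat_def)
  then have "householder n ** householder n = mat 1" by (simp add: vec_eq_iff)
  then show ?thesis by (simp add: orthogonal_matrix t)
qed

text \<open>The mirror vector is the tail of \<open>y\<close> minus the tail norm in direction
  \<open>a\<close>, so it is supported on the coordinates from \<open>a\<close> on. Hence lower
  coordinates are fixed, as are rows vanishing from \<open>a\<close> on. Preservation of the full
  norm then gives that of every tail starting at or before \<open>a\<close>.\<close>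

lemma householder_tail:
  fixes y :: "(real, 'm::{finite,linorder}) vec"
  obtains q :: "((real, 'm) vec, 'm) vec" where "orthogonal_matrix q"
    "\<And>z i j. j < a \<Longrightarrow> (z ** q) $ i $ j = (z::((real, 'm) vec, 'k::finite) vec) $ i $ j"
    "\<And>z i j. (\<And>l. a \<le> l \<Longrightarrow> z $ i $ l = 0) \<Longrightarrow> ((z::((real, 'm) vec, 'k::finite) vec) ** q) $ i $ j = z $ i $ j"
    "\<And>z i c. c \<le> a \<Longrightarrow> tail_norm c (((z::((real, 'm) vec, 'k::finite) vec) ** q) $ i) = tail_norm c (z $ i)"
    "\<And>z i j. z $ i = y \<Longrightarrow> ((z::((real, 'm) vec, 'k::finite) vec) ** q) $ i $ j = (if j < a then y $ j else if j = a then tail_norm a y else 0)"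
proof -
  define t where "t = tail_norm a y"
  define n where "n = (\<chi> l. if a \<le> l then y $ l - (if l = a then t else 0) else 0)"
  define q where "q = householder n"
  have q: "orthogonal_matrix q" by (simp add: q_def orthogonal_householder)
  have low: "n $ l = 0" if "l < a" for l using that by (auto simp: n_def)
  have 1: "(z ** q) $ i $ j = z $ i $ j" if "j < a" for z :: "((real, 'm) vec, 'k) vec" and i j
    by (simp add: q_def mult_householder low that)
  have 2: "(z ** q) $ i $ j = z $ i $ j" if "\<And>l. a \<le> l \<Longrightarrow> z $ i $ l = 0" for z :: "((real, 'm) vec, 'k) vec" and i j
  proof -
    have "z $ i \<bullet> n = 0"
      unfolding inner_vec_def by (rule sum.neutral) (use that low in \<open>auto simp: not_le[symmetric]\<close>)
    then show ?thesis by (simp add: q_def mult_householder)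
  qed
  have rown: "((z ** q) $ i) \<bullet> ((z ** q) $ i) = z $ i \<bullet> z $ i" for z :: "((real, 'm) vec, 'k) vec" and i
  proof -
    let ?c = "2 / (n \<bullet> n) * (z $ i \<bullet> n)"
    have "(z ** q) $ i = z $ i - ?c *\<^sub>R n"
      by (simp add: vec_eq_iff q_def mult_householder)
    then have "((z ** q) $ i) \<bullet> ((z ** q) $ i) = z $ i \<bullet> z $ i - 2 * ?c * (z $ i \<bullet> n) + ?c * ?c * (n \<bullet> n)"
      by (simp add: inner_diff_left inner_diff_right inner_commute[of n "z $ i"])
    also have "?c * ?c * (n \<bullet> n) = 2 * ?c * (z $ i \<bullet> n)"
      by (cases "n = 0") (simp_all add: field_simps)
    finally show ?thesis by simp
  qed
  have split: "x \<bullet> x = (\<Sum>l\<in>{..<c}. (x $ l)\<^sup>2) + (tail_norm c x)\<^sup>2" for x :: "(real, 'm) vec" and c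
  proof -
    have "x \<bullet> x = (\<Sum>l\<in>{..<c} \<union> {c..}. (x $ l)\<^sup>2)"
      unfolding inner_vec_def by (rule sum.cong) (auto simp: power2_eq_square)
    also have "\<dots> = (\<Sum>l\<in>{..<c}. (x $ l)\<^sup>2) + (\<Sum>l\<in>{c..}. (x $ l)\<^sup>2)"
      by (rule sum.union_disjoint) auto
    finally show ?thesis by (simp add: tail_norm_def sum_nonneg)
  qed
  have 3: "tail_norm c ((z ** q) $ i) = tail_norm c (z $ i)" if "c \<le> a" for z :: "((real, 'm) vec, 'k) vec" and i c
  proof -
    have "(\<Sum>l\<in>{..<c}. ((z ** q) $ i $ l)\<^sup>2) = (\<Sum>l\<in>{..<c}. (z $ i $ l)\<^sup>2)"
      by (intro sum.cong refl) (use that 1 in auto)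
    then have "(tail_norm c ((z ** q) $ i))\<^sup>2 = (tail_norm c (z $ i))\<^sup>2"
      using split[of "(z ** q) $ i" c] split[of "z $ i" c] rown[of z i] by simp
    then show ?thesis by simp
  qed
  have t2: "t\<^sup>2 = (\<Sum>l\<in>{a..}. (y $ l)\<^sup>2)" by (simp add: t_def tail_norm_def sum_nonneg)
  have sumtail: "(\<Sum>l\<in>UNIV. g l) = (\<Sum>l\<in>{a..}. g l)" if "\<And>l. l < a \<Longrightarrow> g l = 0" for g :: "'m \<Rightarrow> real"
    by (rule sum.mono_neutral_right) (use that in \<open>auto simp: not_le\<close>)
  \<comment> \<open>Together with \<open>nn\<close> this gives
    \<open>n \<bullet> n = 2 * (y \<bullet> n)\<close>, so the reflection sends \<open>y\<close> to
    \<open>y - n\<close>.\<close>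
  have yn: "y \<bullet> n = t\<^sup>2 - t * y $ a"
  proof -
    have "y \<bullet> n = (\<Sum>l\<in>{a..}. y $ l * n $ l)"
      unfolding inner_vec_def inner_real_def by (rule sumtail) (simp add: low)
    also have "\<dots> = (\<Sum>l\<in>{a..}. (y $ l)\<^sup>2 - (if l = a then t * y $ a else 0))"
      by (intro sum.cong refl) (auto simp: n_def power2_eq_square algebra_simps)
    also have "\<dots> = t\<^sup>2 - t * y $ a" by (simp add: sum_subtractf t2)
    finally show ?thesis .
  qed
  have nn: "n \<bullet> n = 2 * (t\<^sup>2 - t * y $ a)"
  proof -
    have "n \<bullet> n = (\<Sum>l\<in>{a..}. n $ l * n $ l)"
      unfolding inner_vec_def inner_real_def by (rule sumtail) (simp add: low)
    also have "\<dots> = (\<Sum>l\<in>{a..}. (y $ l)\<^sup>2 - (if l = a then 2 * t * y $ a - t\<^sup>2 else 0))"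
      by (intro sum.cong refl) (auto simp: n_def power2_eq_square algebra_simps)
    also have "\<dots> = 2 * (t\<^sup>2 - t * y $ a)" by (simp add: sum_subtractf t2)
    finally show ?thesis .
  qed
  have 4: "(z ** q) $ i $ j = (if j < a then y $ j else if j = a then tail_norm a y else 0)" if "z $ i = y" for z :: "((real, 'm) vec, 'k) vec" and i j
  proof -
    have "(z ** q) $ i $ j = y $ j - n $ j"
    proof (cases "n = 0")
      case True
      then show ?thesis by (simp add: q_def mult_householder that)
    next
      case False
      then have "2 / (n \<bullet> n) * (y \<bullet> n) = 1" using yn nn by (simp add: field_simps)
      then show ?thesis by (simp only: q_def mult_householder that mult_1)
    qed
    then show ?thesis by (auto simp: n_def t_def not_less dest: less_imp_le)
  qed
  show thesis using that[of q] q 1 2 3 4 by blast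
qed

text \<open>
  Rows are triangularised one at a time: given row \<open>a\<close>, a Householder reflection acting on the
  coordinates from \<open>a\<close> on triangularises it without affecting the previous rows, while the
  remaining rows keep their Gaussian distribution.
\<close>

lemma nn_integral_gauss_tri_on_insert:
  fixes h :: "((real, 'm::{finite,linorder}) vec, 'm) vec \<Rightarrow> ennreal"
  assumes h [measurable]: "h \<in> borel_measurable borel"
    and inv: "\<And>z q. orthogonal_matrix q \<Longrightarrow> h (z ** q) = h z"
    and A: "\<And>i. i \<in> A \<Longrightarrow> i < a"
  shows "(\<integral>\<^sup>+z. h (tri_on A z) \<partial>gauss) = (\<integral>\<^sup>+z. h (tri_on (insert a A) z) \<partial>gauss)"
proof -
  have "(\<integral>\<^sup>+z. h (tri_on A (set_row a y z)) \<partial>gauss) = (\<integral>\<^sup>+z. h (tri_on (insert a A) (set_row a y z)) \<partial>gauss)" for y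
  proof -
    obtain q :: "((real, 'm) vec, 'm) vec" where q: "orthogonal_matrix q"
      "\<And>(z::((real, 'm) vec, 'm) vec) i j. j < a \<Longrightarrow> (z ** q) $ i $ j = z $ i $ j"
      "\<And>(z::((real, 'm) vec, 'm) vec) i j. (\<And>l. a \<le> l \<Longrightarrow> z $ i $ l = 0) \<Longrightarrow> (z ** q) $ i $ j = z $ i $ j"
      "\<And>(z::((real, 'm) vec, 'm) vec) i c. c \<le> a \<Longrightarrow> tail_norm c ((z ** q) $ i) = tail_norm c (z $ i)"
      "\<And>(z::((real, 'm) vec, 'm) vec) i j. z $ i = y \<Longrightarrow> (z ** q) $ i $ j = (if j < a then y $ j else if j = a then tail_norm a y else 0)"
      using householder_tail[of a y] by blast
    have "tri_on A (set_row a y z) ** q = tri_on (insert a A) (set_row a y (z ** q))" for z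
    proof -
      have "(tri_on A (set_row a y z) ** q) $ i $ j = tri_on (insert a A) (set_row a y (z ** q)) $ i $ j" for i j
      proof -
        consider "i = a" | "i \<in> A" "i \<noteq> a" | "i \<notin> A" "i \<noteq> a" by blast
        then show ?thesis
        proof cases
          case 1
          then have "i \<notin> A" using A by auto
          then have "tri_on A (set_row a y z) $ i = y" using 1 by (simp add: tri_on_def set_row_nth)
          from q(5)[OF this, of j] show ?thesis
            using 1 by (auto simp: tri_on_def tri_def set_row_nth)
        next
          \<comment> \<open>This row is already triangular and vanishes from column \<open>a\<close>
            on, so \<open>q\<close> fixes it. On the other side \<open>q\<close> changes neither the
            entries of \<open>z\<close> left of column \<open>i\<close> nor the tail norm from
            \<open>i\<close> on, since \<open>i < a\<close>.\<close>
          case 2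
          then have ia: "i < a" using A by auto
          have "(tri_on A (set_row a y z) ** q) $ i $ j = tri_on A (set_row a y z) $ i $ j"
            by (rule q(3)) (use 2 ia in \<open>auto simp: tri_on_def tri_def\<close>)
          then show ?thesis
            using 2 ia q(2)[of j z i] q(4)[of i z i] by (auto simp: tri_on_def tri_def set_row_nth)
        next
          case 3
          then have "tri_on A (set_row a y z) $ i = z $ i" by (simp add: tri_on_def set_row_nth)
          then have "(tri_on A (set_row a y z) ** q) $ i $ j = (z ** q) $ i $ j"
            by (simp add: matrix_matrix_mult_def)
          then show ?thesis using 3 by (simp add: tri_on_def set_row_nth)
        qed
      qed
      then show ?thesis by (simp add: vec_eq_iff)
    qed
    then have "h (tri_on A (set_row a y z)) = h (tri_on (insert a A) (set_row a y (z ** q)))" for z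
      using inv[OF q(1)] by metis
    then have "(\<integral>\<^sup>+z. h (tri_on A (set_row a y z)) \<partial>gauss) = (\<integral>\<^sup>+z. h (tri_on (insert a A) (set_row a y (z ** q))) \<partial>gauss)"
      by simp
    also have "\<dots> = (\<integral>\<^sup>+z. h (tri_on (insert a A) (set_row a y z)) \<partial>gauss)"
      by (rule nn_integral_gauss_norm_preserving[OF linear_matrix_mult_right norm_mult_orthogonal[OF q(1)]]) measurable
    finally show ?thesis .
  qed
  then show ?thesis
    using nn_integral_gauss_set_row[of "\<lambda>z. h (tri_on A z)" a] nn_integral_gauss_set_row[of "\<lambda>z. h (tri_on (insert a A) z)" a]
    by simp
qed

lemma nn_integral_gauss_tri:
  fixes h :: "((real, 'm::{finite,linorder}) vec, 'm) vec \<Rightarrow> ennreal"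
  assumes h: "h \<in> borel_measurable borel"
    and inv: "\<And>z q. orthogonal_matrix q \<Longrightarrow> h (z ** q) = h z"
  shows "(\<integral>\<^sup>+z. h z \<partial>gauss) = (\<integral>\<^sup>+z. h (tri z) \<partial>gauss)"
proof -
  have "(\<integral>\<^sup>+z. h z \<partial>gauss) = (\<integral>\<^sup>+z. h (tri_on A z) \<partial>gauss)" for A :: "'m set"
    using finite[of A]
  proof (induction A rule: finite_linorder_max_induct)
    case empty
    show ?case by (simp add: tri_on_def)
  next
    case (insert b A)
    then show ?case using nn_integral_gauss_tri_on_insert[OF h inv, of A b] by simp
  qed
  from this[of UNIV] show ?thesis by (simp add: tri_on_def)
qed

text \<open>Testing with indicator functions turns the identity of nonnegative integrals into an
  equality of laws, which transfers both integrability and integrals of complex functions.\<close>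

lemma distr_gauss_tri:
  fixes h :: "((real, 'm::{finite,linorder}) vec, 'm) vec \<Rightarrow> 'b::topological_space"
  assumes [measurable]: "h \<in> borel_measurable borel"
    and inv: "\<And>z q. orthogonal_matrix q \<Longrightarrow> h (z ** q) = h z"
  shows "distr gauss borel (\<lambda>z. h (tri z)) = distr gauss borel h"
proof (rule measure_eqI)
  fix A assume "A \<in> sets (distr gauss borel (\<lambda>z. h (tri z)))"
  then have [measurable]: "A \<in> sets borel" by simp
  have "(\<integral>\<^sup>+z. indicator A (h z) \<partial>gauss) = (\<integral>\<^sup>+z. indicator A (h (tri z)) \<partial>gauss)"
    by (rule nn_integral_gauss_tri) (auto simp: inv)
  then show "emeasure (distr gauss borel (\<lambda>z. h (tri z))) A = emeasure (distr gauss borel h) A"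
    using nn_integral_distr[of h gauss borel "indicator A"] nn_integral_distr[of "\<lambda>z. h (tri z)" gauss borel "indicator A"] by simp
qed simp

text \<open>The pointwise counterpart of the triangularisation in law; it yields the LQ
  decomposition of a fixed matrix.\<close>

lemma exists_orthogonal_lower_triangular:
  fixes z :: "((real, 'm::{finite,linorder}) vec, 'm) vec"
  shows "\<exists>q. orthogonal_matrix q \<and> (\<forall>i j. i < j \<longrightarrow> (z ** q) $ i $ j = 0)"
proof -
  have "\<exists>q. orthogonal_matrix q \<and> (\<forall>i\<in>A. \<forall>j. i < j \<longrightarrow> (z ** q) $ i $ j = 0)" for A :: "'m set"
    using finite[of A]
  proof (induction A rule: finite_linorder_max_induct)
    case empty
    show ?case by (intro exI[of _ "mat 1"]) (simp add: orthogonal_matrix_id)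
  next
    case (insert a A)
    from insert.IH obtain q where q: "orthogonal_matrix q" "\<And>i j. i \<in> A \<Longrightarrow> i < j \<Longrightarrow> (z ** q) $ i $ j = 0" by blast
    define y where "y = (z ** q) $ a"
    obtain p :: "((real, 'm) vec, 'm) vec" where p: "orthogonal_matrix p"
      "\<And>(z::((real, 'm) vec, 'm) vec) i j. j < a \<Longrightarrow> (z ** p) $ i $ j = z $ i $ j"
      "\<And>(z::((real, 'm) vec, 'm) vec) i j. (\<And>l. a \<le> l \<Longrightarrow> z $ i $ l = 0) \<Longrightarrow> (z ** p) $ i $ j = z $ i $ j"
      "\<And>(z::((real, 'm) vec, 'm) vec) i c. c \<le> a \<Longrightarrow> tail_norm c ((z ** p) $ i) = tail_norm c (z $ i)"
      "\<And>(z::((real, 'm) vec, 'm) vec) i j. z $ i = y \<Longrightarrow> (z ** p) $ i $ j = (if j < a then y $ j else if j = a then tail_norm a y else 0)"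
      using householder_tail[of a y] by blast
    have "((z ** q) ** p) $ i $ j = 0" if "i \<in> insert a A" "i < j" for i j
    proof (cases "i = a")
      case True
      then show ?thesis using p(5)[of "z ** q" a j] that by (auto simp: y_def)
    next
      case False
      then have i: "i \<in> A" "i < a" using that insert by auto
      have "((z ** q) ** p) $ i $ j = (z ** q) $ i $ j"
        by (rule p(3)) (use i q(2) in auto)
      then show ?thesis using q(2) i that by simp
    qed
    then have "\<forall>i\<in>insert a A. \<forall>j. i < j \<longrightarrow> (z ** (q ** p)) $ i $ j = 0"
      unfolding matrix_mul_assoc by blast
    with orthogonal_matrix_mul[OF q(1) p(1)] show ?case by blast
  qed
  from this[of UNIV] show ?thesis by simp
qed

subsection \<open>The law of the diagonal entries\<close>

text \<open>For a negative base the principal logarithm adds \<open>\<i> * pi\<close>; written out,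
  \<open>powr\<close> consists of measurable pieces.\<close>

lemma borel_measurable_of_real_powr [measurable]:
  "(\<lambda>r. complex_of_real r powr z) \<in> borel_measurable borel"
proof -
  have "complex_of_real r powr z = (if r = 0 then 0 else exp (z * (complex_of_real (ln \<bar>r\<bar>) + (if r < 0 then \<i> * pi else 0))))" for r
  proof (cases "r < 0")
    case True
    then have "Ln (complex_of_real r) = Ln (- complex_of_real (- r))" by simp
    also have "\<dots> = Ln (complex_of_real (- r)) + \<i> * pi"
      using True by (subst Ln_minus) auto
    also have "Ln (complex_of_real (- r)) = complex_of_real (ln (- r))"
      using True by (intro Ln_of_real) auto
    finally show ?thesis using True by (simp add: powr_def)
  next
    case False
    then show ?thesis by (auto simp: powr_def Ln_of_real)
  qed
  then show ?thesis by simp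
qed

lemma prod_Basis_vec: "(\<Prod>b\<in>(Basis::(real^'m) set). f b) = (\<Prod>i\<in>UNIV. f (axis i 1))"
proof -
  have "bij_betw (\<lambda>i. axis i 1) UNIV (Basis::(real^'m) set)"
    by (auto simp: bij_betw_def inj_on_def Basis_vec_def axis_eq_axis)
  then show ?thesis by (simp add: prod.reindex_bij_betw[symmetric])
qed

definition scale_tail :: "'m::{finite,linorder} \<Rightarrow> real \<Rightarrow> real^('m::{finite,linorder}) \<Rightarrow> real^('m::{finite,linorder})" where
  "scale_tail a r y = (\<chi> l. if a \<le> l then r * y $ l else y $ l)"

lemma lborel_scaling_scale_tail:
  fixes a :: "'m::{finite,linorder}"
  assumes "r > 0"
  shows "lborel_scaling (scale_tail a r) (ennreal (1 / r ^ card {a..}))"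
proof -
  define c where "c b = (if \<exists>l\<ge>a. b = axis l (1::real) then r else 1)" for b :: "(real, 'm) vec"
  have c: "c (axis l 1) = (if a \<le> l then r else 1)" for l
    by (auto simp: c_def axis_eq_axis)
  have "(\<Sum>b\<in>Basis. (c b * (x \<bullet> b)) *\<^sub>R b) = scale_tail a r x" for x
  proof (rule euclidean_eqI)
    fix b :: "(real, 'm) vec" assume b: "b \<in> Basis"
    then obtain l where l: "b = axis l 1" by (auto simp: Basis_vec_def)
    have "(\<Sum>b\<in>Basis. (c b * (x \<bullet> b)) *\<^sub>R b) \<bullet> b = c b * (x \<bullet> b)"
      using b by (rule inner_sum_left_Basis)
    also have "\<dots> = scale_tail a r x \<bullet> b"
      unfolding l by (simp add: c inner_axis scale_tail_def)
    finally show "(\<Sum>b\<in>Basis. (c b * (x \<bullet> b)) *\<^sub>R b) \<bullet> b = scale_tail a r x \<bullet> b" .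
  qed
  then have eq: "(\<lambda>x. \<Sum>b\<in>Basis. (c b * (x \<bullet> b)) *\<^sub>R b) = scale_tail a r" by auto
  have "(\<Prod>b\<in>Basis. \<bar>c b\<bar>) = (\<Prod>l\<in>UNIV. if a \<le> l then r else 1)"
    unfolding prod_Basis_vec by (rule prod.cong) (use assms c in auto)
  also have "\<dots> = (\<Prod>l\<in>{a..}. r)"
    by (rule prod.mono_neutral_cong_right) auto
  finally have p: "(\<Prod>b\<in>Basis. \<bar>c b\<bar>) = r ^ card {a..}" by simp
  have "\<And>b. b \<in> Basis \<Longrightarrow> c b \<noteq> 0" using assms by (auto simp: c_def)
  then have "lborel_scaling (\<lambda>x. \<Sum>b\<in>Basis. (c b * (x \<bullet> b)) *\<^sub>R b) (ennreal (1 / (\<Prod>b\<in>Basis. \<bar>c b\<bar>)))"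
    by (rule lborel_scaling_diagonal_map)
  then show ?thesis by (simp only: p eq)
qed

text \<open>Halved squares, so that the Gaussian exponent is minus the sum of head and tail, and the
  tail has a gamma law of scale 1.\<close>

definition head_sq :: "'m::{finite,linorder} \<Rightarrow> real^('m::{finite,linorder}) \<Rightarrow> real" where
  "head_sq a y = (\<Sum>l\<in>{..<a}. (y $ l)\<^sup>2) / 2"

definition tail_sq :: "'m::{finite,linorder} \<Rightarrow> real^('m::{finite,linorder}) \<Rightarrow> real" where
  "tail_sq a y = (\<Sum>l\<in>{a..}. (y $ l)\<^sup>2) / 2"

lemma tail_sq_nonneg [simp]: "tail_sq a y \<ge> 0" and head_sq_nonneg [simp]: "head_sq a y \<ge> 0"
  by (simp_all add: tail_sq_def head_sq_def sum_nonneg)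

lemma tail_sq_measurable [measurable]: "tail_sq a \<in> borel_measurable borel"
  and head_sq_measurable [measurable]: "head_sq a \<in> borel_measurable borel"
  unfolding tail_sq_def[abs_def] head_sq_def[abs_def] by measurable

lemma tail_norm_conv: "tail_norm a y = sqrt (2 * tail_sq a y)"
  by (simp add: tail_norm_def tail_sq_def)

lemma norm_head_tail: "(norm y)\<^sup>2 / 2 = head_sq a y + tail_sq a y"
proof -
  have "(norm y)\<^sup>2 = (\<Sum>l\<in>{..<a} \<union> {a..}. (y $ l)\<^sup>2)"
    unfolding power2_norm_eq_inner inner_vec_def by (rule sum.cong) (auto simp: power2_eq_square)
  also have "\<dots> = (\<Sum>l\<in>{..<a}. (y $ l)\<^sup>2) + (\<Sum>l\<in>{a..}. (y $ l)\<^sup>2)"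
    by (rule sum.union_disjoint) auto
  finally show ?thesis by (simp add: head_sq_def tail_sq_def add_divide_distrib)
qed

lemma tail_sq_scale: "tail_sq a (scale_tail a r y) = r\<^sup>2 * tail_sq a y"
  and head_sq_scale: "head_sq a (scale_tail a r y) = head_sq a y"
proof -
  have "(\<Sum>l\<in>{..<a}. (scale_tail a r y $ l)\<^sup>2) = (\<Sum>l\<in>{..<a}. (y $ l)\<^sup>2)"
    by (rule sum.cong) (auto simp: scale_tail_def)
  then show "head_sq a (scale_tail a r y) = head_sq a y" by (simp add: head_sq_def)
qed (simp add: tail_sq_def scale_tail_def power_mult_distrib sum_distrib_left)

lemma measure_eqI_lessThan_real:
  fixes N L :: "real measure"
  assumes sets: "sets N = sets borel" "sets L = sets borel"
    and eq: "\<And>r. emeasure N {..<r} = emeasure L {..<r}" and fin: "\<And>r. emeasure N {..<r} \<noteq> \<infinity>"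
  shows "N = L"
proof (rule measure_eqI_generator_eq[where E = "range lessThan" and \<Omega> = UNIV and A = "\<lambda>i. {..<real i}"])
  show "Int_stable (range (lessThan :: real \<Rightarrow> real set))"
  proof -
    have "{..<a} \<inter> {..<b} = {..<min a b}" for a b :: real by auto
    then show ?thesis by (auto simp: Int_stable_def)
  qed
  show "sets N = sigma_sets UNIV (range lessThan)" "sets L = sigma_sets UNIV (range lessThan)"
    unfolding sets borel_Iio by simp_all
  show "(\<Union>i. {..<real i}) = UNIV"
    by (auto intro: reals_Archimedean2)
qed (use eq fin in auto)

text \<open>
  The mass of \<open>tail_sq a y < r\<close> under \<open>exp (- head_sq a y) dy\<close> is homogeneous of degree
  \<open>card {a..} / 2\<close> in \<open>r\<close>.
\<close>

lemma distr_tail_sq_lborel: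
  fixes a :: "'m::{finite,linorder}"
  defines "\<nu> \<equiv> real (card {a..})"
  shows "\<exists>C\<ge>0. distr (density lborel (\<lambda>y. ennreal (exp (- head_sq a y)))) borel (tail_sq a)
    = density lborel (\<lambda>s. ennreal (C * indicator {0<..} s * s powr (\<nu> / 2 - 1)))"
proof -
  define Q where "Q = distr (density lborel (\<lambda>y. ennreal (exp (- head_sq a y)))) borel (tail_sq a)"
  have \<nu>: "\<nu> > 0" by (simp add: \<nu>_def card_gt_0_iff)
  define g where "g r y = ennreal (exp (- head_sq a y)) * indicator {..<r} (tail_sq a y)" for r y
  have [measurable]: "g r \<in> borel_measurable borel" for r unfolding g_def by measurable
  have Qr: "emeasure Q {..<r} = (\<integral>\<^sup>+y. g r y \<partial>lborel)" for r
  proof -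
    have "emeasure Q {..<r} = (\<integral>\<^sup>+s. indicator {..<r} s \<partial>Q)" by (simp add: Q_def)
    also have "\<dots> = (\<integral>\<^sup>+y. indicator {..<r} (tail_sq a y) \<partial>density lborel (\<lambda>y. ennreal (exp (- head_sq a y))))"
      unfolding Q_def by (rule nn_integral_distr) measurable
    also have "\<dots> = (\<integral>\<^sup>+y. g r y \<partial>lborel)"
      unfolding g_def by (rule nn_integral_density) measurable
    finally show ?thesis .
  qed
  \<comment> \<open>Where \<open>tail_sq a y < 1\<close>, dropping the tail from the exponent costs
    at most a factor \<open>exp 1\<close>, so the Gaussian density dominates.\<close>
  have fin: "(\<integral>\<^sup>+y. g 1 y \<partial>lborel) < \<infinity>"
  proof -
    let ?K = "exp 1 * sqrt (2 * pi) ^ DIM((real, 'm) vec)"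
    have "g 1 y \<le> ennreal ?K * ennreal (gauss_density y)" for y
    proof (cases "tail_sq a y < 1")
      case True
      then have "exp (- head_sq a y) \<le> exp (1 - (head_sq a y + tail_sq a y))" by simp
      also have "\<dots> = exp 1 * exp (- (norm y)\<^sup>2 / 2)"
        using norm_head_tail[of y a] by (simp add: exp_add[symmetric])
      also have "\<dots> = ?K * gauss_density y"
        by (simp add: gauss_density_def)
      finally show ?thesis
        using True gauss_density_pos[of y] by (simp add: g_def ennreal_mult[symmetric] ennreal_leI)
    qed (simp add: g_def)
    note le = this
    have "(\<integral>\<^sup>+y. g 1 y \<partial>lborel) \<le> (\<integral>\<^sup>+y. ennreal ?K * ennreal (gauss_density (y::(real, 'm) vec)) \<partial>lborel)"
      by (rule nn_integral_mono) (rule le)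
    also have "\<dots> = ennreal ?K * (\<integral>\<^sup>+y. ennreal (gauss_density (y::(real, 'm) vec)) \<partial>lborel)"
      by (rule nn_integral_cmult) measurable
    also have "(\<integral>\<^sup>+y. ennreal (gauss_density (y::(real, 'm) vec)) \<partial>lborel) = 1"
      using gauss.emeasure_space_1[where 'a = "(real, 'm) vec"] by (simp add: gauss_def emeasure_density)
    finally show ?thesis by (rule le_less_trans) simp
  qed
  then obtain C0 where C0: "(\<integral>\<^sup>+y. g 1 y \<partial>lborel) = ennreal C0" "C0 \<ge> 0"
    by (cases "\<integral>\<^sup>+y. g 1 y \<partial>lborel") auto
  \<comment> \<open>Scaling the tail by \<open>sqrt r\<close> carries the region for 1 onto the
    region for \<open>r\<close>, leaves the weight of the head alone, and multiplies Lebesgue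
    measure by the power of \<open>sqrt r\<close> given by the tail dimension.\<close>
  have hom: "emeasure Q {..<r} = ennreal (C0 * r powr (\<nu> / 2))" if "r > 0" for r
  proof -
    have gr: "g r (scale_tail a (sqrt r) y) = g 1 y" for y
      using that by (simp add: g_def tail_sq_scale head_sq_scale indicator_def)
    have "lborel_scaling (scale_tail a (sqrt r)) (ennreal (1 / sqrt r ^ card {a..}))"
      by (rule lborel_scaling_scale_tail) (use that in simp)
    then have "(\<integral>\<^sup>+y. g r (scale_tail a (sqrt r) y) \<partial>lborel) = ennreal (1 / sqrt r ^ card {a..}) * (\<integral>\<^sup>+y. g r y \<partial>lborel)"
      unfolding lborel_scaling_def by auto
    then have e: "ennreal C0 = ennreal (1 / sqrt r ^ card {a..}) * (\<integral>\<^sup>+y. g r y \<partial>lborel)"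
      using C0 by (simp only: gr)
    have "ennreal (sqrt r ^ card {a..}) * ennreal C0
        = (ennreal (sqrt r ^ card {a..}) * ennreal (1 / sqrt r ^ card {a..})) * (\<integral>\<^sup>+y. g r y \<partial>lborel)"
      unfolding e by (simp only: mult.assoc)
    also have "ennreal (sqrt r ^ card {a..}) * ennreal (1 / sqrt r ^ card {a..}) = 1"
      using that by (simp add: ennreal_mult[symmetric])
    finally have "(\<integral>\<^sup>+y. g r y \<partial>lborel) = ennreal (sqrt r ^ card {a..} * C0)"
      using C0 that by (simp add: ennreal_mult)
    moreover have "sqrt r ^ card {a..} = r powr (\<nu> / 2)"
    proof -
      have "sqrt r ^ card {a..} = sqrt r powr \<nu>"
        using that by (simp add: \<nu>_def powr_realpow)
      also have "\<dots> = r powr (\<nu> / 2)"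
        using that by (simp add: powr_half_sqrt[symmetric] powr_powr)
      finally show ?thesis .
    qed
    ultimately show ?thesis by (simp add: Qr mult.commute)
  qed
  have zero: "emeasure Q {..<r} = 0" if "r \<le> 0" for r
  proof -
    have "g r y = 0" for y using that tail_sq_nonneg[of a y] by (simp add: g_def indicator_def not_less del: tail_sq_nonneg)
    then show ?thesis by (simp add: Qr)
  qed
  \<comment> \<open>From differentiating \<open>C0 * r powr (\<nu> / 2)\<close> in \<open>r\<close>.
    The value of \<open>C0\<close> is left open; total mass fixes it in the Gaussian case.\<close>
  define C where "C = C0 * (\<nu> / 2)"
  define L where "L = density lborel (\<lambda>s. ennreal (C * indicator {0<..} s * s powr (\<nu> / 2 - 1)))"
  have L: "emeasure L {..<r} = (\<integral>\<^sup>+s. ennreal (C * indicator {0<..} s * s powr (\<nu> / 2 - 1)) * indicator {..<r} s \<partial>lborel)" for r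
    unfolding L_def by (rule emeasure_density) auto
  have Lr: "emeasure L {..<r} = emeasure Q {..<r}" for r
  proof (cases "r > 0")
    case True
    have "((\<lambda>s. s powr (\<nu> / 2 - 1)) has_integral r powr (\<nu> / 2 - 1 + 1) / (\<nu> / 2 - 1 + 1)) {0..r}"
      by (rule has_integral_powr_from_0) (use True \<nu> in auto)
    then have "((\<lambda>s. C * s powr (\<nu> / 2 - 1)) has_integral C * (r powr (\<nu> / 2 - 1 + 1) / (\<nu> / 2 - 1 + 1))) {0..r}"
      by (rule has_integral_mult_right)
    then have "((\<lambda>s. C * s powr (\<nu> / 2 - 1)) has_integral C0 * r powr (\<nu> / 2)) {0..r}"
      using \<nu> by (simp add: C_def)
    then have "(\<integral>\<^sup>+s. ennreal (C * s powr (\<nu> / 2 - 1)) * indicator {0..r} s \<partial>lborel) = ennreal (C0 * r powr (\<nu> / 2))"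
      using C0 \<nu> by (intro nn_integral_has_integral_lebesgue') (auto simp: C_def)
    moreover have "(\<integral>\<^sup>+s. ennreal (C * indicator {0<..} s * s powr (\<nu> / 2 - 1)) * indicator {..<r} s \<partial>lborel)
      = (\<integral>\<^sup>+s. ennreal (C * s powr (\<nu> / 2 - 1)) * indicator {0..r} s \<partial>lborel)"
    proof (rule nn_integral_cong_AE)
      show "AE s in lborel. ennreal (C * indicator {0<..} s * s powr (\<nu> / 2 - 1)) * indicator {..<r} s
          = ennreal (C * s powr (\<nu> / 2 - 1)) * indicator {0..r} s"
        using AE_lborel_singleton[of 0] AE_lborel_singleton[of r]
        by eventually_elim (auto simp: indicator_def)
    qed
    ultimately show ?thesis using hom[OF True] by (simp add: L)
  next
    case False
    then have "ennreal (C * indicator {0<..} s * s powr (\<nu> / 2 - 1)) * indicator {..<r} s = 0" for s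
      by (auto simp: indicator_def)
    then have "(\<integral>\<^sup>+s. ennreal (C * indicator {0<..} s * s powr (\<nu> / 2 - 1)) * indicator {..<r} s \<partial>lborel)
      = (\<integral>\<^sup>+s. 0 \<partial>(lborel :: real measure))"
      by (intro nn_integral_cong)
    then show ?thesis using False zero[of r] by (simp only: L) simp
  qed
  have "Q = L"
  proof (rule measure_eqI_lessThan_real)
    show "emeasure Q {..<r} = emeasure L {..<r}" for r using Lr by simp
    show "emeasure Q {..<r} \<noteq> \<infinity>" for r
      using hom[of r] zero[of r] by (cases "r > 0") auto
  qed (simp_all add: Q_def L_def)
  moreover have "C \<ge> 0" using C0 \<nu> by (simp add: C_def)
  ultimately show ?thesis unfolding Q_def L_def by blast
qed

text \<open>Restoring the factor \<open>exp (- s)\<close> of the tail turns the power density into a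
  gamma density, whose constant follows from total mass 1 and Euler's integral.\<close>

lemma distr_gauss_tail_sq:
  fixes a :: "'m::{finite,linorder}"
  defines "\<nu> \<equiv> real (card {a..})"
  shows "distr gauss borel (tail_sq a)
    = density lborel (\<lambda>s. ennreal (indicator {0<..} s * s powr (\<nu> / 2 - 1) * exp (- s) / Gamma (\<nu> / 2)))"
proof -
  have \<nu>: "\<nu> > 0" by (simp add: \<nu>_def card_gt_0_iff)
  obtain C where C: "C \<ge> 0" "distr (density lborel (\<lambda>y. ennreal (exp (- head_sq a y)))) borel (tail_sq a)
    = density lborel (\<lambda>s. ennreal (C * indicator {0<..} s * s powr (\<nu> / 2 - 1)))"
    using distr_tail_sq_lborel[of a] unfolding \<nu>_def by blast
  define K where "K = C / sqrt (2 * pi) ^ DIM((real, 'm) vec)"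
  have K: "K \<ge> 0" using C by (simp add: K_def)
  have nn: "(\<integral>\<^sup>+y. \<phi> (tail_sq a y) \<partial>gauss) = (\<integral>\<^sup>+s. ennreal (K * indicator {0<..} s * s powr (\<nu> / 2 - 1) * exp (- s)) * \<phi> s \<partial>lborel)"
    if [measurable]: "\<phi> \<in> borel_measurable borel" for \<phi> :: "real \<Rightarrow> ennreal"
  proof -
    let ?d = "sqrt (2 * pi) ^ DIM((real, 'm) vec)"
    have "(\<integral>\<^sup>+y. \<phi> (tail_sq a y) \<partial>gauss) = (\<integral>\<^sup>+y. ennreal (gauss_density y) * \<phi> (tail_sq a y) \<partial>lborel)"
      by (rule nn_integral_gauss) measurable
    also have "\<dots> = (\<integral>\<^sup>+y. ennreal (exp (- head_sq a y)) * (ennreal (exp (- tail_sq a y) / ?d) * \<phi> (tail_sq a y)) \<partial>lborel)"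
    proof (rule nn_integral_cong)
      fix y :: "(real, 'm) vec"
      have "gauss_density y = exp (- head_sq a y) * (exp (- tail_sq a y) / ?d)"
        using norm_head_tail[of y a] by (simp add: gauss_density_def exp_add[symmetric])
      then have "ennreal (gauss_density y) = ennreal (exp (- head_sq a y)) * ennreal (exp (- tail_sq a y) / ?d)"
        by (metis ennreal_mult exp_ge_zero divide_nonneg_nonneg zero_le_power real_sqrt_ge_zero mult_nonneg_nonneg pi_ge_zero zero_le_numeral)
      then show "ennreal (gauss_density y) * \<phi> (tail_sq a y)
        = ennreal (exp (- head_sq a y)) * (ennreal (exp (- tail_sq a y) / ?d) * \<phi> (tail_sq a y))"
        by (simp only: mult.assoc)
    qed
    also have "\<dots> = (\<integral>\<^sup>+y. ennreal (exp (- tail_sq a y) / ?d) * \<phi> (tail_sq a y) \<partial>density lborel (\<lambda>y. ennreal (exp (- head_sq a y))))"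
      by (rule nn_integral_density[symmetric]) measurable
    also have "\<dots> = (\<integral>\<^sup>+s. ennreal (exp (- s) / ?d) * \<phi> s \<partial>distr (density lborel (\<lambda>y. ennreal (exp (- head_sq a y)))) borel (tail_sq a))"
      by (rule nn_integral_distr[symmetric]) measurable
    also have "\<dots> = (\<integral>\<^sup>+s. ennreal (C * indicator {0<..} s * s powr (\<nu> / 2 - 1)) * (ennreal (exp (- s) / ?d) * \<phi> s) \<partial>lborel)"
      unfolding C(2) by (rule nn_integral_density) measurable
    also have "\<dots> = (\<integral>\<^sup>+s. ennreal (K * indicator {0<..} s * s powr (\<nu> / 2 - 1) * exp (- s)) * \<phi> s \<partial>lborel)"
    proof (rule nn_integral_cong)
      fix s :: real
      have "ennreal (C * indicator {0<..} s * s powr (\<nu> / 2 - 1)) * ennreal (exp (- s) / ?d)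
        = ennreal (K * indicator {0<..} s * s powr (\<nu> / 2 - 1) * exp (- s))"
        using C by (subst ennreal_mult[symmetric]) (auto simp: K_def)
      then show "ennreal (C * indicator {0<..} s * s powr (\<nu> / 2 - 1)) * (ennreal (exp (- s) / ?d) * \<phi> s)
        = ennreal (K * indicator {0<..} s * s powr (\<nu> / 2 - 1) * exp (- s)) * \<phi> s"
        by (simp only: mult.assoc[symmetric])
    qed
    finally show ?thesis .
  qed
  have G: "Gamma (\<nu> / 2) > 0" using \<nu> by (intro Gamma_real_pos) simp
  have "1 = (\<integral>\<^sup>+s. ennreal (K * indicator {0<..} s * s powr (\<nu> / 2 - 1) * exp (- s)) \<partial>lborel)"
    using nn[of "\<lambda>_. 1"] gauss.emeasure_space_1[where 'a = "(real, 'm) vec"] by simp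
  also have "\<dots> = (\<integral>\<^sup>+s. ennreal K * ennreal (indicator {0..} s * s powr (\<nu> / 2 - 1) / exp s) \<partial>lborel)"
  proof (rule nn_integral_cong_AE)
    show "AE s in lborel. ennreal (K * indicator {0<..} s * s powr (\<nu> / 2 - 1) * exp (- s))
      = ennreal K * ennreal (indicator {0..} s * s powr (\<nu> / 2 - 1) / exp s)"
      using AE_lborel_singleton[of 0]
      by eventually_elim (use K in \<open>auto simp: indicator_def ennreal_mult[symmetric] exp_minus field_simps\<close>)
  qed
  also have "\<dots> = ennreal K * ennreal (Gamma (\<nu> / 2))"
    using \<nu> by (subst nn_integral_cmult) (auto simp: Gamma_conv_nn_integral_real)
  also have "\<dots> = ennreal (K * Gamma (\<nu> / 2))"
    using K G by (simp add: ennreal_mult)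
  finally have "K * Gamma (\<nu> / 2) = 1"
    using K G by (metis ennreal_1 ennreal_inj mult_nonneg_nonneg less_imp_le zero_le_one)
  then have Kv: "K = 1 / Gamma (\<nu> / 2)" using G by (simp add: field_simps)
  show ?thesis
  proof (rule measure_eqI)
    fix A assume "A \<in> sets (distr gauss borel (tail_sq a))"
    then have [measurable]: "A \<in> sets borel" by simp
    have "emeasure (distr gauss borel (tail_sq a)) A = (\<integral>\<^sup>+y. indicator A (tail_sq a y) \<partial>gauss)"
      using nn_integral_distr[of "tail_sq a" gauss borel "indicator A"] by simp
    also have "\<dots> = (\<integral>\<^sup>+s. ennreal (K * indicator {0<..} s * s powr (\<nu> / 2 - 1) * exp (- s)) * indicator A s \<partial>lborel)"
      by (rule nn) measurable
    also have "\<dots> = emeasure (density lborel (\<lambda>s. ennreal (indicator {0<..} s * s powr (\<nu> / 2 - 1) * exp (- s) / Gamma (\<nu> / 2)))) A"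
      by (subst emeasure_density) (auto simp: Kv)
    finally show "emeasure (distr gauss borel (tail_sq a)) A
      = emeasure (density lborel (\<lambda>s. ennreal (indicator {0<..} s * s powr (\<nu> / 2 - 1) * exp (- s) / Gamma (\<nu> / 2)))) A" .
  qed simp
qed

definition tail_moment :: "'m::{finite,linorder} \<Rightarrow> complex \<Rightarrow> complex" where
  "tail_moment a z = (LINT y|gauss. complex_of_real (tail_norm a y) powr z)"

text \<open>\<open>tail_norm\<close> is \<open>sqrt (2 * s)\<close> for a gamma variable
  \<open>s\<close> of parameter \<nu> / 2, where \<nu> = \<open>card {a..}\<close>. The bound on
  \<open>Re z\<close> is the convergence at 0 of Euler's integral with parameter (z + \<nu>) / 2,
  and \<open>2 powr (z / 2)\<close> comes from the 2 under the root.\<close>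

lemma
  fixes a :: "'m::{finite,linorder}"
  assumes z: "Re z > - real (card {a..})"
  shows integrable_tail_norm_powr: "integrable gauss (\<lambda>y. complex_of_real (tail_norm a y) powr z)" (is ?I)
    and tail_moment_eq: "tail_moment a z
      = 2 powr (z / 2) * Gamma ((z + of_nat (card {a..})) / 2) / Gamma (of_nat (card {a..}) / 2)" (is ?E)
proof -
  define \<nu> where "\<nu> = real (card {a..})"
  have \<nu>: "\<nu> > 0" by (simp add: \<nu>_def card_gt_0_iff)
  define d where "d s = indicator {0<..} s * s powr (\<nu> / 2 - 1) * exp (- s) / Gamma (\<nu> / 2)" for s
  define f where "f s = complex_of_real (sqrt (2 * s)) powr z" for s
  define w where "w = (z + of_real \<nu>) / 2"
  have w: "Re w > 0" using z by (simp add: w_def \<nu>_def)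
  have G: "Gamma (\<nu> / 2) > 0" using \<nu> by (intro Gamma_real_pos) simp
  have d0: "d s \<ge> 0" for s using G by (simp add: d_def)
  have [measurable]: "d \<in> borel_measurable borel" unfolding d_def by measurable
  have [measurable]: "f \<in> borel_measurable borel" unfolding f_def by measurable
  have law: "distr gauss borel (tail_sq a) = density lborel (\<lambda>s. ennreal (d s))"
    using distr_gauss_tail_sq[of a] by (simp add: d_def[abs_def] \<nu>_def)
  define c where "c = 2 powr (z / 2) / complex_of_real (Gamma (\<nu> / 2))"
  have ln2: "Ln 2 = complex_of_real (ln 2)" using Ln_of_real[of 2] by simp
  have df: "d s *\<^sub>R f s = c * (indicator {0<..} s *\<^sub>R (complex_of_real s powr (w - 1) / of_real (exp s)))" for s
  proof (cases "s > 0")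
    case True
    have "f s = exp (z * of_real (ln (sqrt (2 * s))))"
      using True by (simp add: f_def powr_def Ln_of_real)
    also have "ln (sqrt (2 * s)) = (ln 2 + ln s) / 2"
      using True by (simp add: ln_sqrt ln_mult)
    finally have fs: "f s = 2 powr (z / 2) * complex_of_real s powr (z / 2)"
      using True by (simp add: powr_def Ln_of_real ln2 exp_add[symmetric] algebra_simps add_divide_distrib)
    have "complex_of_real (s powr (\<nu> / 2 - 1)) * complex_of_real s powr (z / 2) = complex_of_real s powr (w - 1)"
      using True by (simp add: powr_of_real[symmetric] powr_add[symmetric] w_def add_divide_distrib algebra_simps)
    then have "d s *\<^sub>R f s = c * (complex_of_real s powr (w - 1) * of_real (exp (- s)))"
      using True by (simp add: d_def fs c_def scaleR_conv_of_real)
    then show ?thesis using True by (simp add: exp_minus divide_inverse)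
  qed (simp add: d_def)
  have "(\<lambda>s. complex_of_real s powr (w - 1) / of_real (exp s)) absolutely_integrable_on {0<..}"
    using w by (rule absolutely_integrable_Gamma_integral')
  then have "set_integrable lborel {0<..} (\<lambda>s. complex_of_real s powr (w - 1) / of_real (exp s))"
    unfolding set_integrable_def by (subst (asm) integrable_completion) measurable
  then have int: "integrable lborel (\<lambda>s. indicator {0<..} s *\<^sub>R (complex_of_real s powr (w - 1) / of_real (exp s)))"
    by (simp add: set_integrable_def)
  have val: "(LINT s|lborel. indicator {0<..} s *\<^sub>R (complex_of_real s powr (w - 1) / of_real (exp s))) = Gamma w"
  proof -
    have "(LINT s|lborel. indicator {0<..} s *\<^sub>R (complex_of_real s powr (w - 1) / of_real (exp s)))
      = integral {0<..} (\<lambda>s. complex_of_real s powr (w - 1) / of_real (exp s))"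
      using set_borel_integral_eq_integral(2)[of "{0<..}" "\<lambda>s. complex_of_real s powr (w - 1) / of_real (exp s)"] int
      by (simp add: set_integrable_def set_lebesgue_integral_def)
    then show ?thesis using integral_unique[OF Gamma_integral_complex'[OF w]] by simp
  qed
  have tn: "complex_of_real (tail_norm a y) powr z = f (tail_sq a y)" for y
    by (simp add: f_def tail_norm_conv)
  have "integrable lborel (\<lambda>s. d s *\<^sub>R f s)"
    unfolding df by (rule integrable_mult_right[OF int])
  then have "integrable (density lborel (\<lambda>s. ennreal (d s))) f"
    using d0 by (subst integrable_density) auto
  then have "integrable (distr gauss borel (tail_sq a)) f" by (simp add: law)
  then show ?I unfolding tn by (subst (asm) integrable_distr_eq) auto
  have "tail_moment a z = (LINT s|distr gauss borel (tail_sq a). f s)"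
    unfolding tail_moment_def tn by (subst integral_distr) auto
  also have "\<dots> = c * Gamma w"
  proof -
    have "(LINT s|density lborel (\<lambda>s. ennreal (d s)). f s) = (LINT s|lborel. d s *\<^sub>R f s)"
      using d0 by (subst integral_density) auto
    also have "\<dots> = c * Gamma w"
      unfolding df by (simp only: integral_mult_right_zero val)
    finally show ?thesis by (simp only: law)
  qed
  finally show ?E by (simp add: c_def w_def \<nu>_def Gamma_complex_of_real[symmetric])
qed

text \<open>The functional equation of Gamma. In terms of the chi density, proportional to
  \<open>t powr (\<nu> - 1) * exp (- t\<^sup>2 / 2)\<close>, it is integration by parts.\<close>

lemma tail_moment_rec:
  assumes z: "Re z > - real (card {a..})"
  shows "tail_moment a (z + 2) = (z + of_nat (card {a..})) * tail_moment a z"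
proof -
  define w where "w = (z + of_nat (card {a..})) / 2"
  have "Re w > 0" using z by (simp add: w_def)
  then have "w \<notin> \<int>\<^sub>\<le>\<^sub>0" by (auto elim!: nonpos_Ints_cases)
  then have G: "Gamma (w + 1) = w * Gamma w" by (rule Gamma_plus1)
  have w1: "(z + 2 + of_nat (card {a..})) / 2 = w + 1" by (simp add: w_def field_simps)
  have "2 powr ((z + 2) / 2) = 2 * 2 powr (z / 2)"
    by (simp add: add_divide_distrib powr_add)
  moreover have "2 * w = z + of_nat (card {a..})" by (simp add: w_def)
  moreover have "Re (z + 2) > - real (card {a..})" using z by simp
  ultimately have "tail_moment a (z + 2) = (2 * w) * tail_moment a z"
    unfolding tail_moment_eq[OF z] tail_moment_eq[OF \<open>Re (z + 2) > _\<close>] w_def[symmetric] w1 G by simp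
  with \<open>2 * w = _\<close> show ?thesis by simp
qed

subsection \<open>Hermite polynomials\<close>

text \<open>Probabilists' normalisation: monic and orthogonal for the standard normal
  weight.\<close>

fun herm :: "nat \<Rightarrow> complex poly" where
  "herm 0 = 1"
| "herm (Suc 0) = [:0, 1:]"
| "herm (Suc (Suc k)) = [:0, 1:] * herm (Suc k) - smult (of_nat (Suc k)) (herm k)"

lemma pderiv_herm: "pderiv (herm (Suc k)) = smult (of_nat (Suc k)) (herm k)"
proof (induction k rule: induct_nat_012)
  case (ge2 k)
  have "pderiv (herm (Suc (Suc (Suc k)))) = herm (Suc (Suc k)) + [:0, 1:] * pderiv (herm (Suc (Suc k)))
      - smult (of_nat (Suc (Suc k))) (pderiv (herm (Suc k)))"
    by (subst herm.simps) (simp add: pderiv_diff pderiv_mult pderiv_smult pderiv_pCons del: herm.simps)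
  also have "\<dots> = herm (Suc (Suc k)) + smult (of_nat (Suc (Suc k))) ([:0, 1:] * herm (Suc k) - smult (of_nat (Suc k)) (herm k))"
    using ge2 by (simp add: smult_diff_right mult_smult_right del: herm.simps)
  also have "[:0, 1:] * herm (Suc k) - smult (of_nat (Suc k)) (herm k) = herm (Suc (Suc k))"
    by simp
  finally show ?case by (simp only: of_nat_Suc[of "Suc (Suc k)"] smult_add_left smult_1_left)
qed (simp_all add: pderiv_pCons pderiv_diff pderiv_mult one_pCons)

text \<open>Splitting off one factor leaves a term with \<open>b\<close> in front, which integration
  by parts turns into a derivative. The two factors \<open>\<i>\<close> that arise give the minus
  sign of the Hermite recursion.\<close>

lemma gauss_complex_shift_power:
  "(LINT b|gauss. (x + \<i> * complex_of_real b) ^ k) = poly (herm k) x"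
proof (induction k rule: herm.induct)
  case 1
  show ?case by simp
next
  case 2
  have "integrable gauss (\<lambda>b. \<i> * complex_of_real b)"
    by (intro integrable_gauss_cpoly cpoly_mult[OF cpoly_const] cpoly_linear) (simp add: linear_iff)
  moreover have "(LINT b|gauss. complex_of_real b) = 0"
    using std_normal_moment_rec[of 0] by simp
  ultimately show ?case by simp
next
  case (3 k)
  let ?f = "\<lambda>k b. (x + \<i> * complex_of_real b) ^ k"
  have cb: "cpoly complex_of_real" by (rule cpoly_linear) (simp add: linear_iff)
  have cf: "cpoly (?f k)" for k
    by (rule cpoly_power[OF cpoly_add[OF cpoly_const cpoly_mult[OF cpoly_const cb]]])
  have "(LINT b|gauss. ?f (Suc (Suc k)) b) = (LINT b|gauss. x * ?f (Suc k) b + \<i> * (complex_of_real b * ?f (Suc k) b))"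
    by (intro Bochner_Integration.integral_cong refl) (simp add: algebra_simps)
  also have "\<dots> = x * (LINT b|gauss. ?f (Suc k) b) + \<i> * (LINT b|gauss. complex_of_real b * ?f (Suc k) b)"
  proof -
    have "integrable gauss (\<lambda>b. x * ?f (Suc k) b)" "integrable gauss (\<lambda>b. \<i> * (complex_of_real b * ?f (Suc k) b))"
      by (rule integrable_mult_right, rule integrable_gauss_cpoly, rule cf,
          rule integrable_mult_right, rule integrable_gauss_cpoly, rule cpoly_mult[OF cb cf])
    from Bochner_Integration.integral_add[OF this] show ?thesis
      by (simp only: integral_mult_right_zero)
  qed
  also have "(LINT b|gauss. complex_of_real b * ?f (Suc k) b) = (LINT b|gauss. complex_of_real (b \<bullet> 1) * ?f (Suc k) b)"
    by simp
  also have "\<dots> = (LINT b|gauss. (of_nat (Suc k) * \<i>) * ?f k b)"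
  proof (rule gauss_integration_by_parts)
    show "cpoly (?f (Suc k))" "cpoly (\<lambda>b. (of_nat (Suc k) * \<i>) * ?f k b)"
      by (intro cpoly_mult cpoly_const cf)+
    fix b :: real
    have "((\<lambda>t. (x + \<i> * complex_of_real (b + t)) ^ Suc k) has_vector_derivative
        (of_nat (Suc k) * \<i>) * ?f k b) (at 0)"
    proof -
      have 1: "((\<lambda>t. x + \<i> * complex_of_real (b + t)) has_vector_derivative \<i>) (at 0)"
        by (auto intro!: derivative_eq_intros)
      have 2: "((\<lambda>u. u ^ Suc k) has_field_derivative of_nat (Suc k) * ?f k b) (at (x + \<i> * complex_of_real (b + 0)))"
        using DERIV_power_Suc[OF DERIV_ident] by simp
      from field_vector_diff_chain_at[OF 1 2] show ?thesis by (simp add: comp_def mult_ac)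
    qed
    then show "((\<lambda>t. ?f (Suc k) (b + t *\<^sub>R 1)) has_vector_derivative (of_nat (Suc k) * \<i>) * ?f k b) (at 0)"
      by simp
  qed simp
  also have "\<dots> = of_nat (Suc k) * \<i> * (LINT b|gauss. ?f k b)"
    by simp
  finally show ?case using 3 by (simp add: algebra_simps)
qed

section \<open>Hermite polynomials integrated against powers of a diagonal entry\<close>

definition tail_fun :: "'m::{finite,linorder} \<Rightarrow> complex \<Rightarrow> complex poly \<Rightarrow> complex" where
  "tail_fun a z q = (LINT y|gauss. poly q (complex_of_real (tail_norm a y)) * complex_of_real (tail_norm a y) powr z)"

text \<open>At \<open>t = 0\<close> both sides are 0 by the convention for \<open>powr\<close> at
  base 0, even when \<open>i = 0\<close>.\<close>

lemma power_mult_of_real_powr: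
  "t \<ge> 0 \<Longrightarrow> complex_of_real t ^ i * complex_of_real t powr z = complex_of_real t powr (z + of_nat i)"
  by (cases "t = 0") (auto simp: powr_add powr_nat algebra_simps)

lemma integrable_poly_tail_norm:
  assumes z: "Re z > - real (card {a..})"
  shows "integrable gauss (\<lambda>y. poly q (complex_of_real (tail_norm a y)) * complex_of_real (tail_norm a y) powr z)"
proof -
  have "integrable gauss (\<lambda>y. \<Sum>i\<le>degree q. coeff q i * (complex_of_real (tail_norm a y) powr (z + of_nat i)))"
    by (intro Bochner_Integration.integrable_sum integrable_mult_right integrable_tail_norm_powr) (use z in simp)
  then show ?thesis
    by (simp add: poly_altdef sum_distrib_right mult.assoc power_mult_of_real_powr)
qed

lemma tail_fun_add: "Re z > - real (card {a..}) \<Longrightarrow> tail_fun a z (p + q) = tail_fun a z p + tail_fun a z q"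
  unfolding tail_fun_def using integrable_poly_tail_norm[of a z] by (simp add: ring_distribs)

lemma tail_fun_diff: "Re z > - real (card {a..}) \<Longrightarrow> tail_fun a z (p - q) = tail_fun a z p - tail_fun a z q"
  unfolding tail_fun_def using integrable_poly_tail_norm[of a z] by (simp add: left_diff_distrib)

lemma tail_fun_smult: "tail_fun a z (smult c q) = c * tail_fun a z q"
  unfolding tail_fun_def by (simp add: mult.assoc)

lemma tail_fun_monom: "tail_fun a z (monom 1 j) = tail_moment a (z + of_nat j)"
  unfolding tail_fun_def tail_moment_def by (simp add: poly_monom power_mult_of_real_powr)

text \<open>Integration by parts against
  \<open>t powr (z + \<nu> - 1) * exp (- t\<^sup>2 / 2)\<close> with \<nu> =
  \<open>card {a..}\<close>. The induction peels off the coefficients of \<open>q\<close> and shifts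
  \<open>j\<close>; for a constant the claim is the moment recursion.\<close>

lemma tail_fun_by_parts_monom:
  assumes z: "Re z > - real (card {a..})"
  shows "tail_fun a z (monom 1 (j + 2) * q) = (z + of_nat (card {a..}) + of_nat j) * tail_fun a z (monom 1 j * q)
    + tail_fun a z (monom 1 (Suc j) * pderiv q)"
proof (induction q arbitrary: j)
  case 0
  show ?case by (simp add: tail_fun_def)
next
  case (pCons c q)
  have p: "monom 1 i * pCons c q = smult c (monom 1 i) + monom 1 (Suc i) * q" for i
    by (simp add: monom_Suc)
  have d: "monom 1 (Suc j) * pderiv (pCons c q) = monom 1 (Suc j) * q + monom 1 (Suc (Suc j)) * pderiv q"
    by (simp add: pderiv_pCons distrib_left monom_Suc)
  have "tail_moment a (z + of_nat (j + 2)) = (z + of_nat j + of_nat (card {a..})) * tail_moment a (z + of_nat j)"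
    using tail_moment_rec[of a "z + of_nat j"] z by (simp add: add_ac)
  then have m: "tail_fun a z (monom 1 (j + 2)) = (z + of_nat (card {a..}) + of_nat j) * tail_fun a z (monom 1 j)"
    by (simp add: tail_fun_monom add_ac)
  have IH: "tail_fun a z (monom 1 (Suc (j + 2)) * q) = (z + of_nat (card {a..}) + of_nat j + 1) * tail_fun a z (monom 1 (Suc j) * q)
    + tail_fun a z (monom 1 (Suc (Suc j)) * pderiv q)"
    using pCons.IH[of "Suc j"] by (simp add: add_ac)
  show ?case
    unfolding p d tail_fun_add[OF z] tail_fun_smult m IH by (simp add: algebra_simps)
qed

text \<open>\<open>herm (Suc k)\<close> is the variable times \<open>herm k\<close> minus the
  derivative of \<open>herm k\<close>. Multiplying by the variable once more and integrating by
  parts cancels the derivative terms and leaves the factor z + \<nu>; the three-term recursion then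
  subtracts k + 1.\<close>

lemma tail_fun_herm_rec:
  assumes z: "Re z > - real (card {a..})"
  shows "tail_fun a z (herm (Suc (Suc k))) = (z + of_nat (card {a..}) - 1 - of_nat k) * tail_fun a z (herm k)"
proof -
  have h: "herm (Suc k) = [:0, 1:] * herm k - pderiv (herm k)"
    by (cases k) (simp_all add: pderiv_herm del: herm.simps(3), simp)
  have m1: "monom 1 (Suc 0) = [:0, 1::complex:]" by (simp add: monom_Suc monom_0)
  have m2: "monom 1 (0 + 2) = [:0, 1::complex:] * [:0, 1:]" by (simp add: monom_Suc monom_0 numeral_2_eq_2)
  have "tail_fun a z ([:0, 1:] * herm (Suc k)) = tail_fun a z (monom 1 (0 + 2) * herm k) - tail_fun a z (monom 1 (Suc 0) * pderiv (herm k))"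
    unfolding h m1 m2 right_diff_distrib tail_fun_diff[OF z] by (simp only: mult.assoc)
  also have "\<dots> = (z + of_nat (card {a..})) * tail_fun a z (herm k)"
    unfolding tail_fun_by_parts_monom[OF z] by simp
  finally show ?thesis
    by (simp add: tail_fun_diff[OF z] tail_fun_smult algebra_simps)
qed

text \<open>The step from 2 j to 2 j + 2 contributes z + \<nu> - 1 - 2 j, which is -2 times the j-th
  factor of the Pochhammer symbol. That symbol becomes the quotient of gamma functions involving the
  reversed exponents, and the signs become a power of the imaginary unit.\<close>

lemma tail_fun_herm_even:
  assumes z: "Re z > - real (card {a..})"
  shows "tail_fun a z (herm (2 * j)) = (-2) ^ j * pochhammer (- (z + of_nat (card {a..}) - 1) / 2) j * tail_moment a z"
proof (induction j)
  case 0
  show ?case by (simp add: tail_fun_def tail_moment_def)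
next
  case (Suc j)
  have c: "z + of_nat (card {a..}) - 1 - of_nat (2 * j) = - 2 * (- (z + of_nat (card {a..}) - 1) / 2 + of_nat j)"
    by (simp add: field_simps)
  have "tail_fun a z (herm (2 * Suc j)) = (z + of_nat (card {a..}) - 1 - of_nat (2 * j)) * tail_fun a z (herm (2 * j))"
    using tail_fun_herm_rec[OF z, of "2 * j"] by (simp del: herm.simps)
  then show ?case
    unfolding c Suc.IH pochhammer_Suc power_Suc by (simp only: mult_ac)
qed

subsection \<open>Principal minors and the power function\<close>

text \<open>The least moved index would be sent to a smaller one, which is fixed, against
  injectivity.\<close>

lemma permutation_le_imp_id:
  fixes p :: "'m::{finite,linorder} \<Rightarrow> 'm"
  assumes p: "p permutes UNIV" and le: "\<And>i. p i \<le> i"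
  shows "p = id"
proof (rule ccontr)
  assume "p \<noteq> id"
  then have ne: "{i. p i \<noteq> i} \<noteq> {}" by (auto simp: fun_eq_iff)
  define i where "i = Min {i. p i \<noteq> i}"
  have i: "p i \<noteq> i" using Min_in[OF _ ne] by (simp add: i_def)
  then have lt: "p i < i" using le[of i] by simp
  have "p (p i) = p i"
  proof (rule ccontr)
    assume "p (p i) \<noteq> p i"
    then have "i \<le> p i" unfolding i_def by (intro Min_le) auto
    with lt show False by simp
  qed
  with permutes_inj[OF p] i show False by (auto dest: injD)
qed

lemma det_lower_triangular:
  fixes A :: "(('a::comm_ring_1, 'm::{finite,linorder}) vec, 'm) vec"
  assumes A: "\<And>i j. i < j \<Longrightarrow> A$i$j = 0"
  shows "det A = (\<Prod>i\<in>UNIV. A$i$i)"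
proof -
  have "det A = (\<Sum>p\<in>{id}. of_int (sign p) * (\<Prod>i\<in>UNIV. A$i$p i))"
    unfolding det_def
  proof (rule sum.mono_neutral_right)
    show "\<forall>p\<in>{p. p permutes UNIV} - {id}. of_int (sign p) * (\<Prod>i\<in>UNIV. A$i$p i) = 0"
    proof
      fix p :: "'m \<Rightarrow> 'm" assume "p \<in> {p. p permutes UNIV} - {id}"
      then obtain i where "i < p i"
        using permutation_le_imp_id[of p] by (auto simp: not_le[symmetric])
      then have "(\<Prod>i\<in>UNIV. A$i$p i) = 0" using A by (intro prod_zero) auto
      then show "of_int (sign p) * (\<Prod>i\<in>UNIV. A$i$p i) = 0" by simp
    qed
  qed (auto simp: permutes_id)
  then show ?thesis by (simp add: sign_id)
qed

lemma det_upper_triangular: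
  fixes A :: "(('a::comm_ring_1, 'm::{finite,linorder}) vec, 'm) vec"
  assumes "\<And>i j. j < i \<Longrightarrow> A$i$j = 0"
  shows "det A = (\<Prod>i\<in>UNIV. A$i$i)"
  using det_lower_triangular[of "transpose A"] assms unfolding det_transpose by (simp add: transpose_def)

text \<open>Padding with the identity turns a minor into a determinant of full size, to which
  multiplicativity of \<open>det\<close> applies.\<close>

definition pad_minor :: "'m set \<Rightarrow> real^'m^'m \<Rightarrow> real^'m^'m" where
  "pad_minor S r = (\<chi> i j. if i \<in> S \<and> j \<in> S then r$i$j else if i = j then 1 else 0)"

lemma det_pad_minor: "det (pad_minor S r) = principal_minor S r"
proof -
  have "det (pad_minor S r) = (\<Sum>p | p permutes S. of_int (sign p) * (\<Prod>i\<in>UNIV. pad_minor S r $ i $ p i))"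
    unfolding det_def
  proof (rule sum.mono_neutral_right)
    show "\<forall>p\<in>{p. p permutes UNIV} - {p. p permutes S}. of_int (sign p) * (\<Prod>i\<in>UNIV. pad_minor S r $ i $ p i) = 0"
    proof
      fix p assume p: "p \<in> {p. p permutes UNIV} - {p. p permutes S}"
      then obtain i where "i \<notin> S" "p i \<noteq> i"
        by (auto simp: permutes_def)
      then have "(\<Prod>i\<in>UNIV. pad_minor S r $ i $ p i) = 0"
        by (intro prod_zero) (auto simp: pad_minor_def)
      then show "of_int (sign p) * (\<Prod>i\<in>UNIV. pad_minor S r $ i $ p i) = 0" by simp
    qed
  qed (auto simp: finite_permutations intro: permutes_subset)
  also have "\<dots> = principal_minor S r"
    unfolding principal_minor_def
  proof (rule sum.cong[OF refl])
    fix p assume "p \<in> {p. p permutes S}"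
    then have p: "p permutes S" by simp
    have "(\<Prod>i\<in>UNIV. pad_minor S r $ i $ p i) = (\<Prod>i\<in>S. pad_minor S r $ i $ p i)"
      by (rule prod.mono_neutral_right) (use p in \<open>auto simp: pad_minor_def permutes_not_in\<close>)
    also have "\<dots> = (\<Prod>i\<in>S. r $ i $ p i)"
      by (rule prod.cong) (use p in \<open>auto simp: pad_minor_def permutes_in_image\<close>)
    finally show "of_int (sign p) * (\<Prod>i\<in>UNIV. pad_minor S r $ i $ p i) = of_int (sign p) * (\<Prod>i\<in>S. r $ i $ p i)"
      by simp
  qed
  finally show ?thesis .
qed

lemma pad_minor_mult:
  "(pad_minor S s ** X) $ i $ j = (if i \<in> S then \<Sum>k\<in>S. s$i$k * X$k$j else X$i$j)"
proof (cases "i \<in> S")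
  case True
  then have "(pad_minor S s ** X) $ i $ j = (\<Sum>k\<in>UNIV. if k \<in> S then s$i$k * X$k$j else 0)"
    unfolding matrix_matrix_mult_def vec_lambda_beta
    by (intro sum.cong refl) (auto simp: pad_minor_def)
  with True show ?thesis by (simp add: sum.If_cases)
next
  case False
  then have "(pad_minor S s ** X) $ i $ j = (\<Sum>k\<in>UNIV. if k = i then X$i$j else 0)"
    unfolding matrix_matrix_mult_def vec_lambda_beta
    by (intro sum.cong refl) (auto simp: pad_minor_def)
  with False show ?thesis by simp
qed

definition lower_triangular :: "((real, 'm::{finite,linorder}) vec, 'm) vec \<Rightarrow> bool" where
  "lower_triangular s \<longleftrightarrow> (\<forall>i j. i < j \<longrightarrow> s$i$j = 0)"

text \<open>For a down-closed \<open>S\<close>, the rows of \<open>s\<close> indexed by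
  \<open>S\<close> have no entries outside \<open>S\<close>, so the \<open>S\<close> block of
  \<open>s ** r ** transpose s\<close> is the product of the \<open>S\<close> blocks.\<close>

lemma principal_minor_lower_triangular:
  fixes s r :: "((real, 'm::{finite,linorder}) vec, 'm) vec"
  assumes s: "lower_triangular s" and S: "\<And>i j. i \<in> S \<Longrightarrow> j \<le> i \<Longrightarrow> j \<in> S"
  shows "principal_minor S (s ** r ** transpose s) = (\<Prod>i\<in>S. s$i$i)\<^sup>2 * principal_minor S r"
proof -
  have z: "s$i$k = 0" if "i \<in> S" "k \<notin> S" for i k
    using s S[of i k] that by (auto simp: lower_triangular_def not_le[symmetric])
  have e1: "(s ** r ** transpose s) $ i $ j = (\<Sum>k\<in>S. s$i$k * (\<Sum>l\<in>S. r$k$l * s$j$l))" if "i \<in> S" "j \<in> S" for i j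
  proof -
    have "(s ** r ** transpose s) $ i $ j = (\<Sum>k\<in>UNIV. s$i$k * (\<Sum>l\<in>UNIV. r$k$l * s$j$l))"
      by (simp add: matrix_mul_assoc[symmetric]) (simp add: matrix_matrix_mult_def transpose_def)
    also have "\<dots> = (\<Sum>k\<in>S. s$i$k * (\<Sum>l\<in>UNIV. r$k$l * s$j$l))"
      by (rule sum.mono_neutral_right) (use z that in auto)
    also have "\<dots> = (\<Sum>k\<in>S. s$i$k * (\<Sum>l\<in>S. r$k$l * s$j$l))"
      by (intro sum.cong refl arg_cong2[where f = "(*)"] sum.mono_neutral_right) (use z that in auto)
    finally show ?thesis .
  qed
  have e2: "(X ** transpose (pad_minor S s)) $ k $ j = (if j \<in> S then \<Sum>l\<in>S. X$k$l * s$j$l else X$k$j)" for X :: "((real, 'm) vec, 'm) vec" and k j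
  proof -
    have "(X ** transpose (pad_minor S s)) $ k $ j = (pad_minor S s ** transpose X) $ j $ k"
      by (simp add: matrix_matrix_mult_def transpose_def mult.commute)
    then show ?thesis by (simp add: pad_minor_mult transpose_def mult.commute)
  qed
  have "(pad_minor S s ** (pad_minor S r ** transpose (pad_minor S s))) $ i $ j = pad_minor S (s ** r ** transpose s) $ i $ j" for i j
  proof -
    consider "i \<in> S" "j \<in> S" | "i \<in> S" "j \<notin> S" | "i \<notin> S" "j \<in> S" | "i \<notin> S" "j \<notin> S" by blast
    then show ?thesis
    proof cases
      case 1
      have "pad_minor S (s ** r ** transpose s) $ i $ j = (s ** r ** transpose s) $ i $ j"
        using 1 by (simp add: pad_minor_def)
      moreover have "(pad_minor S s ** (pad_minor S r ** transpose (pad_minor S s))) $ i $ j = (\<Sum>k\<in>S. s$i$k * (\<Sum>l\<in>S. pad_minor S r $k$l * s$j$l))"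
        using 1 by (simp add: pad_minor_mult e2)
      moreover have "\<dots> = (\<Sum>k\<in>S. s$i$k * (\<Sum>l\<in>S. r$k$l * s$j$l))"
        by (intro sum.cong refl arg_cong2[where f = "(*)"]) (auto simp: pad_minor_def)
      ultimately show ?thesis using e1[OF 1] by simp
    next
      case 2
      then have "(\<Sum>k\<in>S. s$i$k * pad_minor S r $ k $ j) = 0"
        by (intro sum.neutral) (auto simp: pad_minor_def)
      then have "(pad_minor S s ** (pad_minor S r ** transpose (pad_minor S s))) $ i $ j = 0"
        using 2 by (simp only: pad_minor_mult e2 if_True if_False)
      then show ?thesis using 2 by (auto simp: pad_minor_def)
    next
      case 3
      then have "(\<Sum>l\<in>S. pad_minor S r $ i $ l * s$j$l) = 0"
        by (intro sum.neutral) (auto simp: pad_minor_def)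
      then have "(pad_minor S s ** (pad_minor S r ** transpose (pad_minor S s))) $ i $ j = 0"
        using 3 by (simp only: pad_minor_mult e2 if_True if_False)
      then show ?thesis using 3 by (auto simp: pad_minor_def)
    next
      case 4
      then have "(pad_minor S s ** (pad_minor S r ** transpose (pad_minor S s))) $ i $ j = pad_minor S r $ i $ j"
        by (simp only: pad_minor_mult e2 if_True if_False)
      then show ?thesis using 4 by (simp add: pad_minor_def)
    qed
  qed
  then have "pad_minor S (s ** r ** transpose s) = pad_minor S s ** (pad_minor S r ** transpose (pad_minor S s))"
    by (simp add: vec_eq_iff)
  then have "principal_minor S (s ** r ** transpose s) = det (pad_minor S s) * (principal_minor S r * det (pad_minor S s))"
    by (simp only: det_pad_minor[symmetric] det_mul det_transpose)
  moreover have "det (pad_minor S s) = (\<Prod>i\<in>S. s$i$i)"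
  proof -
    have "det (pad_minor S s) = (\<Prod>i\<in>UNIV. pad_minor S s $ i $ i)"
      by (rule det_lower_triangular) (use s in \<open>auto simp: pad_minor_def lower_triangular_def\<close>)
    also have "\<dots> = (\<Prod>i\<in>S. pad_minor S s $ i $ i)"
      by (rule prod.mono_neutral_right) (auto simp: pad_minor_def)
    also have "\<dots> = (\<Prod>i\<in>S. s$i$i)"
      by (rule prod.cong) (auto simp: pad_minor_def)
    finally show ?thesis .
  qed
  ultimately show ?thesis by (simp add: power2_eq_square)
qed

section \<open>The power function of a Gram matrix\<close>

definition minor_ratio :: "'m \<Rightarrow> ((real, 'm::{finite,linorder}) vec, 'm) vec \<Rightarrow> real" where
  "minor_ratio a r = principal_minor {..a} r / principal_minor {..<a} r"

lemma principal_minor_mat_1: "principal_minor S (mat 1) = 1"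
proof -
  have "pad_minor S (mat 1) = (mat 1 :: real^'a^'a)"
    by (auto simp: pad_minor_def mat_def vec_eq_iff)
  then show ?thesis by (metis det_pad_minor det_I)
qed

text \<open>The quotients also factor when a diagonal entry of \<open>s\<close> is 0, because
  division by 0 gives 0 on both sides.\<close>

lemma minor_ratio_lower_triangular:
  assumes "lower_triangular s"
  shows "minor_ratio a (s ** r ** transpose s) = minor_ratio a (s ** transpose s) * minor_ratio a r"
    and "minor_ratio a (s ** transpose s) = ((\<Prod>i\<in>{..a}. s$i$i) / (\<Prod>i\<in>{..<a}. s$i$i))\<^sup>2"
proof -
  have le: "principal_minor {..a} (s ** r ** transpose s) = (\<Prod>i\<in>{..a}. s$i$i)\<^sup>2 * principal_minor {..a} r"
    and lt: "principal_minor {..<a} (s ** r ** transpose s) = (\<Prod>i\<in>{..<a}. s$i$i)\<^sup>2 * principal_minor {..<a} r" for r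
    by (intro principal_minor_lower_triangular[OF assms]; auto)+
  have 1: "s ** transpose s = s ** mat 1 ** transpose s" by (simp add: matrix_mul_rid)
  show "minor_ratio a (s ** transpose s) = ((\<Prod>i\<in>{..a}. s$i$i) / (\<Prod>i\<in>{..<a}. s$i$i))\<^sup>2"
    unfolding 1 minor_ratio_def le lt principal_minor_mat_1 by (simp add: power_divide)
  then show "minor_ratio a (s ** r ** transpose s) = minor_ratio a (s ** transpose s) * minor_ratio a r"
    unfolding minor_ratio_def[of a "s ** r ** transpose s"] le lt
    by (simp add: power_divide minor_ratio_def[of a r])
qed

definition gram_power :: "complex^('m::{finite,linorder}) \<Rightarrow> ((real, 'm) vec, 'm) vec \<Rightarrow> complex" where
  "gram_power l A = matrix_power (A ** transpose A) l"

lemma gram_power_eq: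
  "gram_power l A = (\<Prod>a\<in>UNIV. complex_of_real (minor_ratio a (A ** transpose A)) powr (l $ a / 2))"
  by (simp add: gram_power_def matrix_power_def minor_ratio_def)

lemma cosine_kernel_eq: "cosine_kernel l u v = gram_power l (transpose u ** v)"
  by (simp add: cosine_kernel_def gram_power_def matrix_transpose_mul transpose_transpose matrix_mul_assoc)

lemma gram_power_mult_orthogonal:
  assumes "orthogonal_matrix q"
  shows "gram_power l (A ** q) = gram_power l A"
proof -
  have "(A ** q) ** transpose (A ** q) = A ** (q ** transpose q) ** transpose A"
    by (simp add: matrix_transpose_mul matrix_mul_assoc)
  also have "\<dots> = A ** transpose A"
    using assms by (simp add: orthogonal_matrix_def matrix_mul_rid)
  finally show ?thesis by (simp add: gram_power_def)
qed

lemma LQ_decomposition: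
  fixes A :: "((real, 'm::{finite,linorder}) vec, 'm) vec"
  obtains s q where "orthogonal_matrix q" "lower_triangular s" "A = s ** q"
proof -
  obtain p where p: "orthogonal_matrix p" "\<forall>i j. i < j \<longrightarrow> (A ** p) $ i $ j = 0"
    using exists_orthogonal_lower_triangular by blast
  have "A = (A ** p) ** transpose p"
    using p(1) by (simp add: matrix_mul_assoc[symmetric] orthogonal_matrix_def matrix_mul_rid)
  moreover have "orthogonal_matrix (transpose p)"
    using p(1) by (simp add: orthogonal_matrix_transpose)
  ultimately show thesis using that[of "transpose p" "A ** p"] p(2) by (simp add: lower_triangular_def)
qed

text \<open>Nonnegative bases make complex \<open>powr\<close> multiplicative, which the triangular
  product rule for the power function relies on.\<close>

lemma minor_ratio_gram_nonneg:
  fixes A :: "((real, 'm::{finite,linorder}) vec, 'm) vec"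
  shows "minor_ratio a (A ** transpose A) \<ge> 0"
proof -
  obtain s q where sq: "orthogonal_matrix q" "lower_triangular s" "A = s ** q"
    by (rule LQ_decomposition)
  have "A ** transpose A = s ** (q ** transpose q) ** transpose s"
    by (simp add: sq(3) matrix_transpose_mul matrix_mul_assoc)
  also have "\<dots> = s ** transpose s"
    using sq(1) by (simp add: orthogonal_matrix_def matrix_mul_rid)
  finally show ?thesis by (simp add: minor_ratio_lower_triangular(2)[OF sq(2)])
qed

text \<open>The minors of \<open>s ** r ** transpose s\<close> factor, so the power function is
  multiplicative under lower triangular left factors, singular ones included. With right orthogonal
  invariance, it is determined by its values on lower triangular matrices.\<close>

lemma gram_power_lower_triangular_mult:
  assumes s: "lower_triangular s"
  shows "gram_power l (s ** A) = gram_power l s * gram_power l A"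
proof -
  have "(s ** A) ** transpose (s ** A) = s ** (A ** transpose A) ** transpose s"
    by (simp add: matrix_transpose_mul matrix_mul_assoc)
  then have "minor_ratio a ((s ** A) ** transpose (s ** A)) = minor_ratio a (s ** transpose s) * minor_ratio a (A ** transpose A)" for a
    by (simp add: minor_ratio_lower_triangular(1)[OF s])
  moreover have "complex_of_real (x * y) powr z = complex_of_real x powr z * complex_of_real y powr z"
    if "x \<ge> 0" "y \<ge> 0" for x y z
    using that by (simp add: powr_times_real)
  ultimately show ?thesis
    unfolding gram_power_eq prod.distrib[symmetric] by (simp only: minor_ratio_gram_nonneg)
qed

lemma gram_power_lower_triangular:
  assumes s: "lower_triangular s" and pos: "\<And>i. s$i$i \<ge> 0"
  shows "gram_power l s = (\<Prod>a\<in>UNIV. complex_of_real (s$a$a) powr (l $ a))"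
proof (cases "\<exists>a. s$a$a = 0")
  case False
  then have p: "s$i$i > 0" for i using pos[of i] by (metis less_eq_real_def)
  have "minor_ratio a (s ** transpose s) = (s$a$a)\<^sup>2" for a
  proof -
    have "{..a} = insert a {..<a}" by auto
    then have "(\<Prod>i\<in>{..a}. s$i$i) = s$a$a * (\<Prod>i\<in>{..<a}. s$i$i)" by simp
    moreover have "(\<Prod>i\<in>{..<a}. s$i$i) \<noteq> 0"
      by (rule less_imp_neq[symmetric], rule prod_pos, rule p)
    ultimately have "(\<Prod>i\<in>{..a}. s$i$i) / (\<Prod>i\<in>{..<a}. s$i$i) = s$a$a"
      by (metis nonzero_mult_div_cancel_right)
    then show ?thesis by (simp only: minor_ratio_lower_triangular(2)[OF s])
  qed
  moreover have "complex_of_real ((s$a$a)\<^sup>2) powr (l $ a / 2) = complex_of_real (s$a$a) powr (l $ a)" for a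
    using p[of a] by (simp add: powr_def Ln_of_real ln_realpow flip: of_real_power)
  ultimately show ?thesis by (simp add: gram_power_eq)
next
  \<comment> \<open>A zero diagonal entry makes both sides 0: the minor up to \<open>a\<close>
    vanishes, and \<open>powr\<close> has the value 0 at base 0.\<close>
  case True
  then have ne: "{a. s$a$a = 0} \<noteq> {}" by auto
  define a where "a = Min {a. s$a$a = 0}"
  have a: "s$a$a = 0" using Min_in[OF _ ne] by (simp add: a_def)
  then have "(\<Prod>i\<in>{..a}. s$i$i) = 0" by (intro prod_zero) auto
  then have "minor_ratio a (s ** transpose s) = 0" by (simp add: minor_ratio_lower_triangular(2)[OF s])
  then have "gram_power l s = 0"
    unfolding gram_power_eq by (intro prod_zero) (auto intro!: exI[of _ a])
  moreover have "(\<Prod>a\<in>UNIV. complex_of_real (s$a$a) powr (l $ a)) = 0"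
    using a by (intro prod_zero) (auto intro!: exI[of _ a])
  ultimately show ?thesis by simp
qed

lemma borel_measurable_matrix_mult [measurable (raw)]:
  fixes f :: "'a \<Rightarrow> real^'m^'n" and g :: "'a \<Rightarrow> real^'k^'m"
  assumes [measurable]: "f \<in> borel_measurable M" "g \<in> borel_measurable M"
  shows "(\<lambda>x. f x ** g x) \<in> borel_measurable M"
proof (rule borel_measurable_matrixI)
  fix i j
  have [measurable]: "(\<lambda>x. f x $ k $ l) \<in> borel_measurable M" "(\<lambda>x. g x $ k' $ l') \<in> borel_measurable M" for k l k' l'
    using measurable_compose[OF assms(1) borel_measurable_entry] measurable_compose[OF assms(2) borel_measurable_entry]
    by auto
  show "(\<lambda>x. (f x ** g x) $ i $ j) \<in> borel_measurable M"
    unfolding matrix_matrix_mult_def by simp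
qed

lemma borel_measurable_transpose [measurable]: "(transpose :: real^'m^'n \<Rightarrow> _) \<in> borel_measurable borel"
  using borel_measurable_linear[OF linear_transpose] .

lemma borel_measurable_principal_minor [measurable]: "principal_minor S \<in> borel_measurable borel"
  unfolding principal_minor_def[abs_def] by measurable

lemma borel_measurable_det [measurable]: "(det :: real^'m^'m \<Rightarrow> real) \<in> borel_measurable borel"
  unfolding principal_minor_UNIV[symmetric, abs_def] by measurable

lemma gram_power_measurable [measurable]: "gram_power l \<in> borel_measurable borel"
proof -
  have [measurable]: "minor_ratio a \<in> borel_measurable borel" for a :: 'a
    unfolding minor_ratio_def[abs_def] by measurable
  show ?thesis unfolding gram_power_eq[abs_def] by measurable
qed

subsection \<open>Gaussian integrals of the power function\<close>

lemma lower_triangular_tri: "lower_triangular (tri z)"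
  by (auto simp: lower_triangular_def tri_def)

lemma tri_diag: "tri z $ i $ i = tail_norm i (z $ i)"
  by (simp add: tri_def)

lemma det_tri: "det (tri z) = (\<Prod>i\<in>UNIV. tail_norm i (z $ i))"
  by (subst det_lower_triangular) (auto simp: tri_def)

lemma gram_power_tri: "gram_power l (tri z) = (\<Prod>a\<in>UNIV. complex_of_real (tail_norm a (z $ a)) powr (l $ a))"
  by (subst gram_power_lower_triangular) (auto simp: lower_triangular_tri tri_diag)

lemma abs_det_mult_orthogonal:
  "orthogonal_matrix q \<Longrightarrow> \<bar>det (z ** q)\<bar> = \<bar>det (z::real^'m^'m)\<bar>"
  "orthogonal_matrix q \<Longrightarrow> \<bar>det (q ** z)\<bar> = \<bar>det (z::real^'m^'m)\<bar>"
  by (simp_all add: det_mul abs_mult det_orthogonal_abs)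

text \<open>The exponent \<open>N\<close> gathers the weight n - m of polar coordinates and the
  degree of the polynomial.\<close>

definition det_gram :: "nat \<Rightarrow> complex^('m::{finite,linorder}) \<Rightarrow> ((real, 'm) vec, 'm) vec \<Rightarrow> complex" where
  "det_gram N l g = complex_of_real (\<bar>det g\<bar> ^ N) * gram_power l g"

lemma det_gram_measurable [measurable]: "det_gram N l \<in> borel_measurable borel"
  unfolding det_gram_def[abs_def] by measurable

lemma det_gram_mult_orthogonal: "orthogonal_matrix q \<Longrightarrow> det_gram N l (g ** q) = det_gram N l g"
  by (simp add: det_gram_def gram_power_mult_orthogonal abs_det_mult_orthogonal)

lemma integrable_gauss_tri:
  fixes h :: "((real, 'm::{finite,linorder}) vec, 'm) vec \<Rightarrow> complex"
  assumes h: "h \<in> borel_measurable borel" and inv: "\<And>z q. orthogonal_matrix q \<Longrightarrow> h (z ** q) = h z"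
  shows "integrable gauss h \<longleftrightarrow> integrable gauss (\<lambda>z. h (tri z))"
    and "(LINT z|gauss. h z) = (LINT z|gauss. h (tri z))"
proof -
  define T where "T = (\<lambda>z. h (tri z))"
  have d: "distr gauss borel T = distr gauss borel h"
    unfolding T_def by (rule distr_gauss_tri[OF h inv])
  have "T \<in> borel_measurable borel"
    unfolding T_def using measurable_compose[OF tri_measurable h] .
  then have m: "T \<in> measurable gauss borel" "h \<in> measurable gauss borel"
    using h by simp_all
  have id: "(\<lambda>x. x) \<in> borel_measurable (borel :: complex measure)" by simp
  have "integrable gauss h \<longleftrightarrow> integrable gauss T"
    using integrable_distr_eq[OF m(1) id] integrable_distr_eq[OF m(2) id] by (simp only: d)
  then show "integrable gauss h \<longleftrightarrow> integrable gauss (\<lambda>z. h (tri z))" by (simp only: T_def)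
  have "(LINT z|gauss. h z) = (LINT z|gauss. T z)"
    using integral_distr[OF m(1) id] integral_distr[OF m(2) id] by (simp only: d)
  then show "(LINT z|gauss. h z) = (LINT z|gauss. h (tri z))" by (simp only: T_def)
qed

text \<open>On \<open>tri z\<close> the integrand is a product over rows of powers of tail norms,
  and independence of the rows factors the integral.\<close>

lemma
  fixes l :: "complex^('m::{finite,linorder})"
  assumes l: "\<And>a. Re (l $ a) + real N > - real (card {a..})"
  shows integrable_det_gram: "integrable gauss (det_gram N l)"
    and integral_det_gram: "(LINT g|gauss. det_gram N l g) = (\<Prod>a\<in>UNIV. tail_moment a (l $ a + of_nat N))"
proof -
  have t: "det_gram N l (tri z) = (\<Prod>a\<in>UNIV. complex_of_real (tail_norm a (z $ a)) powr (l $ a + of_nat N))" for z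
  proof -
    have "complex_of_real (\<bar>det (tri z)\<bar> ^ N) = (\<Prod>a\<in>UNIV. complex_of_real (tail_norm a (z $ a)) ^ N)"
      by (simp add: det_tri abs_prod prod_power_distrib)
    then show ?thesis
      unfolding det_gram_def gram_power_tri by (simp only: prod.distrib[symmetric] power_mult_of_real_powr tail_norm_nonneg)
  qed
  have i: "integrable gauss (\<lambda>y. complex_of_real (tail_norm a y) powr (l $ a + of_nat N))" for a
    by (rule integrable_tail_norm_powr) (use l[of a] in simp)
  have "integrable gauss (\<lambda>z. det_gram N l (tri z))"
    unfolding t by (rule integrable_gauss_prod_rows[OF i])
  with integrable_gauss_tri(1)[of "det_gram N l", OF det_gram_measurable det_gram_mult_orthogonal]
  show "integrable gauss (det_gram N l)" by blast
  show "(LINT g|gauss. det_gram N l g) = (\<Prod>a\<in>UNIV. tail_moment a (l $ a + of_nat N))"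
    unfolding integrable_gauss_tri(2)[of "det_gram N l", OF det_gram_measurable det_gram_mult_orthogonal, simplified] t tail_moment_def
    by (rule integral_gauss_prod_rows[OF i])
qed

lemma det_gram_mult_LQ:
  assumes "orthogonal_matrix q" "lower_triangular s"
  shows "complex_of_real (\<bar>det g\<bar> ^ N) * gram_power l (s ** q ** g) = gram_power l (s ** q) * det_gram N l (q ** g)"
proof -
  have "gram_power l (s ** q ** g) = gram_power l s * gram_power l (q ** g)"
    by (simp add: matrix_mul_assoc[symmetric] gram_power_lower_triangular_mult[OF assms(2)])
  then show ?thesis
    using assms(1) by (simp add: det_gram_def gram_power_mult_orthogonal abs_det_mult_orthogonal)
qed

text \<open>With \<open>A = s ** q\<close>, the Gaussian law absorbs the orthogonal
  \<open>q\<close>, while the triangular \<open>s\<close> comes out as the factor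
  \<open>gram_power l s\<close>, which equals \<open>gram_power l A\<close>.\<close>

lemma integral_det_gram_mult:
  "(LINT g|gauss. complex_of_real (\<bar>det g\<bar> ^ N) * gram_power l (A ** g))
    = gram_power l A * (LINT g|gauss. det_gram N l g)"
proof -
  obtain s q where sq: "orthogonal_matrix q" "lower_triangular s" "A = s ** q"
    by (rule LQ_decomposition)
  have "(LINT g|gauss. det_gram N l (q ** g)) = (LINT g|gauss. det_gram N l g)"
    by (rule integral_gauss_norm_preserving[OF linear_matrix_mult_left norm_orthogonal_mult[OF sq(1)]]) measurable
  then show ?thesis
    unfolding sq(3) det_gram_mult_LQ[OF sq(1,2)] by (simp only: integral_mult_right_zero)
qed

lemma nn_integral_det_gram_mult:
  "(\<integral>\<^sup>+g. ennreal (norm (complex_of_real (\<bar>det g\<bar> ^ N) * gram_power l (A ** g))) \<partial>gauss)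
    = ennreal (norm (gram_power l A)) * (\<integral>\<^sup>+g. ennreal (norm (det_gram N l g)) \<partial>gauss)"
proof -
  obtain s q where sq: "orthogonal_matrix q" "lower_triangular s" "A = s ** q"
    by (rule LQ_decomposition)
  have "(\<integral>\<^sup>+g. ennreal (norm (det_gram N l (q ** g))) \<partial>gauss) = (\<integral>\<^sup>+g. ennreal (norm (det_gram N l g)) \<partial>gauss)"
    by (rule nn_integral_gauss_norm_preserving[OF linear_matrix_mult_left norm_orthogonal_mult[OF sq(1)]]) measurable
  moreover have "(\<lambda>g. ennreal (norm (det_gram N l (q ** g)))) \<in> borel_measurable gauss"
    using borel_measurable_linear[OF linear_matrix_mult_left[of q]] by measurable
  ultimately show ?thesis
    unfolding sq(3) det_gram_mult_LQ[OF sq(1,2)] by (simp add: norm_mult ennreal_mult nn_integral_cmult)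
qed

text \<open>Below, \<open>gauss_det k\<close> is the Hermite analogue of \<open>(det z)\<^sup>k\<close>.\<close>

definition complex_matrix :: "real^'m^'m \<Rightarrow> real^'m^'m \<Rightarrow> complex^'m^'m" where
  "complex_matrix z b = (\<chi> i j. complex_of_real (z$i$j) + \<i> * complex_of_real (b$i$j))"

definition gauss_det :: "nat \<Rightarrow> real^'m^'m \<Rightarrow> complex" where
  "gauss_det k z = (LINT b|gauss. det (complex_matrix z b) ^ k)"

lemma cpoly_det_complex_matrix: "cpoly (\<lambda>p. det (complex_matrix (fst p) (snd p)) ^ k)"
proof (intro cpoly_power cpoly_det)
  fix i j
  show "cpoly (\<lambda>p. complex_matrix (fst p) (snd p) $ i $ j)"
    by (auto simp: complex_matrix_def intro!: cpoly_intros cpoly_linear linear_entry_fst linear_entry_snd)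
qed

lemma cpoly_gauss_det: "cpoly (gauss_det k)"
proof -
  have "cpoly (\<lambda>z. LINT b|gauss. (\<lambda>p. det (complex_matrix (fst p) (snd p)) ^ k) ((z, 0) + (0, b)))"
    by (rule cpoly_gauss_convolution[OF cpoly_det_complex_matrix]) (auto simp: linear_iff)
  then show ?thesis by (simp add: gauss_det_def[abs_def])
qed

lemma det_of_real: "det (\<chi> i j. complex_of_real (q$i$j)) = complex_of_real (det q)"
  by (simp add: det_def)

text \<open>Rotating \<open>b\<close> along with \<open>z\<close> multiplies the determinant by
  \<open>det q\<close>, which is 1 or -1; evenness of \<open>k\<close> removes the sign.\<close>

lemma gauss_det_mult_orthogonal:
  assumes q: "orthogonal_matrix q" and k: "even k"
  shows "gauss_det k (z ** q) = gauss_det k z"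
proof -
  have m: "complex_matrix (z ** q) (b ** q) = complex_matrix z b ** (\<chi> i j. complex_of_real (q$i$j))" for b
    by (simp add: complex_matrix_def matrix_matrix_mult_def vec_eq_iff sum.distrib sum_distrib_left ring_distribs mult_ac)
  have "det q = 1 \<or> det q = - 1" using det_orthogonal_matrix q by blast
  then have dq: "complex_of_real (det q) ^ k = 1"
    using k by (auto simp: uminus_power_if)
  have meas: "(\<lambda>b. det (complex_matrix (z ** q) b) ^ k) \<in> borel_measurable borel"
  proof -
    have "cpoly (\<lambda>b. (\<lambda>p. det (complex_matrix (fst p) (snd p)) ^ k) ((z ** q, 0) + (0, b)))"
      by (rule cpoly_affine_image[OF cpoly_det_complex_matrix]) (auto simp: linear_iff)
    then show ?thesis by (intro cpoly_measurable) simp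
  qed
  have "gauss_det k (z ** q) = (LINT b|gauss. det (complex_matrix (z ** q) (b ** q)) ^ k)"
    unfolding gauss_det_def
    by (rule integral_gauss_norm_preserving[OF linear_matrix_mult_right norm_mult_orthogonal[OF q] meas, symmetric])
  also have "\<dots> = gauss_det k z"
    unfolding m det_mul det_of_real power_mult_distrib dq gauss_det_def by simp
  finally show ?thesis .
qed

text \<open>A real Gaussian shift completes every entry \<open>\<i> * b\<close> to a rotation
  invariant complex Gaussian, and such entries average out. So \<open>gauss_det k\<close> is the
  preimage of the \<open>k\<close>-th power of \<open>det\<close> under Gaussian
  convolution.\<close>

lemma gauss_convolution_gauss_det:
  "(LINT z|gauss. gauss_det k (y + z)) = complex_of_real (det y) ^ k"
proof -
  define D where "D = (\<chi> i j. complex_of_real (y$i$j))"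
  have "complex_matrix (y + z) b = masked (\<lambda>_ _. True) D 1 z b" for z b
    by (simp add: complex_matrix_def masked_def D_def vec_eq_iff)
  then have "(LINT z|gauss. gauss_det k (y + z)) = (LINT b|gauss. det (masked (\<lambda>_ _. True) D 0 0 (b::real^'a^'a)) ^ k)"
    unfolding gauss_det_def by (simp add: gauss_masked_mean)
  also have "\<dots> = det D ^ k"
  proof -
    have "masked (\<lambda>_ _. True) D 0 0 b = D" for b
      by (simp add: masked_def vec_eq_iff)
    then show ?thesis by simp
  qed
  finally show ?thesis by (simp add: D_def det_of_real)
qed

definition strict_lower :: "((real, 'm::{finite,linorder}) vec, 'm) vec \<Rightarrow> ((real, 'm) vec, 'm) vec" where
  "strict_lower z = (\<chi> i j. if j < i then z$i$j else 0)"

lemma linear_strict_lower: "linear strict_lower"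
  by (auto simp: linear_iff strict_lower_def vec_eq_iff)

lemma strict_lower_idem: "strict_lower (strict_lower z) = strict_lower z"
  by (auto simp: strict_lower_def vec_eq_iff)

lemma partial_isometry_strict_lower: "partial_isometry strict_lower strict_lower"
  unfolding partial_isometry_def
proof (intro conjI allI linear_strict_lower)
  fix a y :: "((real, 'm::{finite,linorder}) vec, 'm) vec"
  show "strict_lower a \<bullet> y = a \<bullet> strict_lower y"
    unfolding inner_matrix by (intro sum.cong refl) (auto simp: strict_lower_def)
  show "strict_lower (strict_lower (strict_lower a)) = strict_lower a"
    by (auto simp: strict_lower_def vec_eq_iff)
qed

lemma integral_gauss_coordinate:
  fixes f :: "real \<Rightarrow> complex"
  assumes "integrable gauss f"
  shows "integrable gauss (\<lambda>y::real^'m. f (y $ j))" "(LINT y|gauss. f ((y::real^'m) $ j)) = (LINT s|gauss. f s)"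
proof -
  have e: "(\<lambda>y::real^'m. f (y $ j)) = (\<lambda>y. \<Prod>i\<in>{j}. (\<lambda>_. f) i (y $ i))" by auto
  show "integrable gauss (\<lambda>y::real^'m. f (y $ j))"
    unfolding e by (rule integrable_gauss_prod_rows) (rule assms)
  show "(LINT y|gauss. f ((y::real^'m) $ j)) = (LINT s|gauss. f s)"
    unfolding e by (subst integral_gauss_prod_rows) (use assms in auto)
qed

text \<open>On \<open>tri z\<close>, averaging over the strictly lower entries completes them with
  \<open>b\<close> to complex Gaussians, which average out. What is left is upper triangular with a
  tail norm plus an imaginary Gaussian at each diagonal place, so the determinant is a product over
  rows and each row yields a Hermite polynomial.\<close>

lemma integral_gauss_det_gram_power:
  fixes l :: "complex^('m::{finite,linorder})"
  assumes l: "\<And>a. Re (l $ a) > - real (card {a..})" and k: "even k"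
    and int: "integrable gauss (\<lambda>z. gauss_det k z * gram_power l z)"
  shows "(LINT z|gauss. gauss_det k z * gram_power l z) = (\<Prod>a\<in>UNIV. tail_fun a (l $ a) (herm k))"
proof -
  let ?h = "\<lambda>z. gauss_det k z * gram_power l z"
  have [measurable]: "gauss_det k \<in> borel_measurable borel" by (rule cpoly_measurable[OF cpoly_gauss_det])
  have h: "?h \<in> borel_measurable borel" by measurable
  have inv: "?h (z ** q) = ?h z" if "orthogonal_matrix q" for z q
    using that k by (simp add: gauss_det_mult_orthogonal gram_power_mult_orthogonal)
  note tri = integrable_gauss_tri[OF h inv]
  define w where "w z = (\<Prod>a\<in>UNIV. complex_of_real (tail_norm a (z $ a)) powr (l $ a))" for z :: "((real, 'm) vec, 'm) vec"
  define dg where "dg z = (\<chi> i j. if i = j then tail_norm i (z $ i) else 0)" for z :: "((real, 'm) vec, 'm) vec"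
  \<comment> \<open>Only the entries strictly below the diagonal are resampled, so the row tails,
    and with them the power factor, do not change.\<close>
  define R where "R a y = strict_lower a + (y - strict_lower y)" for a y :: "((real, 'm) vec, 'm) vec"
  have tail: "tail_norm i (R a y $ i) = tail_norm i (y $ i)" for a y i
    unfolding tail_norm_def by (intro arg_cong[of _ _ sqrt] sum.cong refl) (auto simp: R_def strict_lower_def)
  have triR: "tri (R a y) = strict_lower a + dg y" for a y
    by (auto simp: vec_eq_iff tri_def dg_def tail) (simp_all add: R_def strict_lower_def)
  have wR: "w (R a y) = w y" for a y by (simp add: w_def tail)
  have int1: "integrable gauss (\<lambda>z. gauss_det k (tri z) * w z)"
    using int tri(1) by (simp add: gram_power_tri w_def)
  have inner: "(LINT a|gauss. gauss_det k (strict_lower a + dg y)) = (\<Prod>i\<in>UNIV. poly (herm k) (complex_of_real (tail_norm i (y $ i))))" for y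
  proof -
    define D where "D = (\<chi> i j. complex_of_real (dg y $ i $ j))"
    have "complex_matrix (strict_lower a + dg y) b = masked (\<lambda>i j. j < i) D 1 a b" for a b
      by (auto simp: complex_matrix_def masked_def D_def vec_eq_iff strict_lower_def)
    then have "(LINT a|gauss. gauss_det k (strict_lower a + dg y)) = (LINT b|gauss. det (masked (\<lambda>i j. j < i) D 0 0 b) ^ k)"
      unfolding gauss_det_def by (simp add: gauss_masked_mean)
    also have "\<dots> = (LINT b|gauss. (\<Prod>i\<in>UNIV. (complex_of_real (tail_norm i (y $ i)) + \<i> * complex_of_real (b $ i $ i)) ^ k))"
    proof (intro Bochner_Integration.integral_cong refl)
      fix b :: "((real, 'm) vec, 'm) vec"
      have "det (masked (\<lambda>i j. j < i) D 0 0 b) = (\<Prod>i\<in>UNIV. masked (\<lambda>i j. j < i) D 0 0 b $ i $ i)"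
        by (rule det_upper_triangular) (auto simp: masked_def D_def dg_def)
      then show "det (masked (\<lambda>i j. j < i) D 0 0 b) ^ k = (\<Prod>i\<in>UNIV. (complex_of_real (tail_norm i (y $ i)) + \<i> * complex_of_real (b $ i $ i)) ^ k)"
        by (simp add: masked_def D_def dg_def prod_power_distrib)
    qed
    also have "\<dots> = (\<Prod>i\<in>UNIV. LINT x|gauss. (complex_of_real (tail_norm i (y $ i)) + \<i> * complex_of_real ((x::(real, 'm) vec) $ i)) ^ k)"
    proof (rule integral_gauss_prod_rows)
      fix i
      have "integrable gauss (\<lambda>s. (complex_of_real (tail_norm i (y $ i)) + \<i> * complex_of_real s) ^ k)"
        by (rule integrable_gauss_cpoly, rule cpoly_power[OF cpoly_add[OF cpoly_const cpoly_mult[OF cpoly_const cpoly_linear]]])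
          (simp add: linear_iff)
      from integral_gauss_coordinate(1)[OF this]
      show "integrable gauss (\<lambda>x::(real, 'm) vec. (complex_of_real (tail_norm i (y $ i)) + \<i> * complex_of_real (x $ i)) ^ k)" .
    qed
    also have "\<dots> = (\<Prod>i\<in>UNIV. poly (herm k) (complex_of_real (tail_norm i (y $ i))))"
    proof (rule prod.cong[OF refl])
      fix i
      have "integrable gauss (\<lambda>s. (complex_of_real (tail_norm i (y $ i)) + \<i> * complex_of_real s) ^ k)"
        by (rule integrable_gauss_cpoly, rule cpoly_power[OF cpoly_add[OF cpoly_const cpoly_mult[OF cpoly_const cpoly_linear]]])
          (simp add: linear_iff)
      from integral_gauss_coordinate(2)[OF this, of i]
      show "(LINT x|gauss. (complex_of_real (tail_norm i (y $ i)) + \<i> * complex_of_real ((x::(real, 'm) vec) $ i)) ^ k)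
          = poly (herm k) (complex_of_real (tail_norm i (y $ i)))"
        by (simp only: gauss_complex_shift_power)
    qed
    finally show ?thesis .
  qed
  have "(LINT z|gauss. ?h z) = (LINT z|gauss. ?h (tri z))"
    by (rule tri(2))
  also have "\<dots> = (LINT z|gauss. gauss_det k (tri z) * w z)"
    by (simp only: gram_power_tri w_def)
  also have "\<dots> = (LINT a|gauss. LINT y|gauss. gauss_det k (strict_lower a + dg y) * w y)"
    unfolding integral_gauss_resample[OF partial_isometry_strict_lower int1] by (simp add: strict_lower_idem R_def[symmetric] triR wR)
  also have "\<dots> = (LINT y|gauss. LINT a|gauss. gauss_det k (strict_lower a + dg y) * w y)"
    using gauss_pair.Fubini_integral[OF integrable_gauss_resample[OF partial_isometry_strict_lower int1]]
    by (simp add: strict_lower_idem R_def[symmetric] triR wR)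
  also have "\<dots> = (LINT y|gauss. (\<Prod>i\<in>UNIV. poly (herm k) (complex_of_real (tail_norm i (y $ i))) * complex_of_real (tail_norm i (y $ i)) powr (l $ i)))"
    by (simp add: inner w_def prod.distrib)
  also have "\<dots> = (\<Prod>a\<in>UNIV. tail_fun a (l $ a) (herm k))"
    unfolding tail_fun_def by (rule integral_gauss_prod_rows[OF integrable_poly_tail_norm[OF l]])
  finally show ?thesis .
qed

subsection \<open>Gram--Schmidt orthonormalisation\<close>

text \<open>Columns are processed in the order of a rank function \<open>r\<close>, because the
  construction is also applied to n x n matrices, whose index type carries no order. The recursion
  is explicit so that measurability follows by induction on the rank; a vanishing residual yields
  the zero column.\<close>

function gs :: "('k::finite \<Rightarrow> nat) \<Rightarrow> real^'k^'n \<Rightarrow> 'k \<Rightarrow> real^'n" where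
  "gs r x j = (let u = column j x - (\<Sum>i\<in>{i. r i < r j}. (column j x \<bullet> gs r x i) *\<^sub>R gs r x i)
    in u /\<^sub>R norm u)"
  by pat_completeness auto
termination by (relation "Wellfounded.measure (\<lambda>(r, x, j). r j)") auto

declare gs.simps [simp del]

definition gs_residual :: "('k::finite \<Rightarrow> nat) \<Rightarrow> real^'k^'n \<Rightarrow> 'k \<Rightarrow> real^'n" where
  "gs_residual r x j = column j x - (\<Sum>i\<in>{i. r i < r j}. (column j x \<bullet> gs r x i) *\<^sub>R gs r x i)"

lemma gs_eq: "gs r x j = gs_residual r x j /\<^sub>R norm (gs_residual r x j)"
  by (subst gs.simps) (simp add: gs_residual_def Let_def)

lemma borel_measurable_column [measurable]: "(\<lambda>x::real^'k^'n. column j x) \<in> borel_measurable borel"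
  by (rule borel_measurable_linear) (simp add: linear_iff column_def vec_eq_iff)

lemma gs_measurable: "(\<lambda>x::real^'k^'n. gs r x j) \<in> borel_measurable borel"
proof (induction "r j" arbitrary: j rule: less_induct)
  case less
  have [measurable]: "(\<lambda>x::real^'k^'n. gs r x i) \<in> borel_measurable borel" if "i \<in> {i. r i < r j}" for i
    using less.hyps[of i] that by blast
  have [measurable]: "(\<lambda>x::real^'k^'n. gs_residual r x j) \<in> borel_measurable borel"
    unfolding gs_residual_def by measurable
  show ?case unfolding gs_eq by measurable
qed

lemma gs_mult_orthogonal:
  assumes \<gamma>: "orthogonal_matrix \<gamma>"
  shows "gs r (\<gamma> ** x) j = \<gamma> *v gs r x j"
proof (induction "r j" arbitrary: j rule: less_induct)
  case less
  have o: "orthogonal_transformation ((*v) \<gamma>)"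
    using \<gamma> by (simp add: orthogonal_transformation_matrix)
  then have inner: "(\<gamma> *v u) \<bullet> (\<gamma> *v w) = u \<bullet> w" and norm: "norm (\<gamma> *v u) = norm u" for u w
    by (simp_all add: orthogonal_transformation_def orthogonal_transformation_norm)
  have col: "column j (\<gamma> ** x) = \<gamma> *v column j x"
    by (simp add: column_def matrix_matrix_mult_def matrix_vector_mult_def vec_eq_iff)
  have lin: "linear ((*v) \<gamma>)" by simp
  have "gs_residual r (\<gamma> ** x) j = \<gamma> *v gs_residual r x j"
  proof -
    have "(\<Sum>i\<in>{i. r i < r j}. (column j (\<gamma> ** x) \<bullet> gs r (\<gamma> ** x) i) *\<^sub>R gs r (\<gamma> ** x) i)
        = (\<Sum>i\<in>{i. r i < r j}. \<gamma> *v ((column j x \<bullet> gs r x i) *\<^sub>R gs r x i))"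
      using less by (intro sum.cong refl) (simp add: col inner linear_scale[OF lin])
    then show ?thesis
      by (simp add: gs_residual_def col linear_diff[OF lin] linear_sum[OF lin])
  qed
  then show ?case by (simp add: gs_eq norm linear_scale[OF lin])
qed

text \<open>The support conditions give the residual of column \<open>j\<close> the coefficient 1 at
  \<open>j\<close> itself, so that it cannot vanish when \<open>x\<close> has full rank.\<close>

lemma gs_in_span:
  "\<exists>c. gs r x j = x *v c \<and> (\<forall>l. c $ l \<noteq> 0 \<longrightarrow> r l \<le> r j)"
  "\<exists>c. gs_residual r x j = x *v (axis j 1 - c) \<and> (\<forall>l. c $ l \<noteq> 0 \<longrightarrow> r l < r j)"
proof -
  have col: "column j x = x *v axis j 1" for j
    by (simp add: matrix_vector_mul_component vec_eq_iff column_def matrix_vector_mult_def axis_def if_distrib cong: if_cong)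
  have both: "(\<exists>c. gs r x j = x *v c \<and> (\<forall>l. c $ l \<noteq> 0 \<longrightarrow> r l \<le> r j)) \<and>
    (\<exists>c. gs_residual r x j = x *v (axis j 1 - c) \<and> (\<forall>l. c $ l \<noteq> 0 \<longrightarrow> r l < r j))" for j
  proof (induction "r j" arbitrary: j rule: less_induct)
    case less
    then have "\<forall>i\<in>{i. r i < r j}. \<exists>c. gs r x i = x *v c \<and> (\<forall>l. c $ l \<noteq> 0 \<longrightarrow> r l \<le> r i)"
      by blast
    then obtain C where C: "\<And>i. r i < r j \<Longrightarrow> gs r x i = x *v C i" "\<And>i l. r i < r j \<Longrightarrow> C i $ l \<noteq> 0 \<Longrightarrow> r l \<le> r i"
      by (metis mem_Collect_eq)
    define c where "c = (\<Sum>i\<in>{i. r i < r j}. (column j x \<bullet> gs r x i) *\<^sub>R C i)"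
    have "x *v c = (\<Sum>i\<in>{i. r i < r j}. (column j x \<bullet> gs r x i) *\<^sub>R (x *v C i))"
      unfolding c_def by (simp add: linear_sum[OF matrix_vector_mul_linear] linear_scale[OF matrix_vector_mul_linear])
    also have "\<dots> = (\<Sum>i\<in>{i. r i < r j}. (column j x \<bullet> gs r x i) *\<^sub>R gs r x i)"
      by (intro sum.cong refl) (simp add: C)
    finally have res: "gs_residual r x j = x *v (axis j 1 - c)"
      by (simp add: gs_residual_def col matrix_vector_mult_diff_distrib)
    have supp: "r l < r j" if "c $ l \<noteq> 0" for l
    proof -
      have "\<exists>i\<in>{i. r i < r j}. C i $ l \<noteq> 0"
      proof (rule ccontr)
        assume "\<not> ?thesis"
        then have "c $ l = 0" by (simp add: c_def)
        with that show False by simp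
      qed
      then show ?thesis using C(2) by force
    qed
    have "gs r x j = x *v ((axis j 1 - c) /\<^sub>R norm (gs_residual r x j))"
      unfolding gs_eq by (simp add: res[symmetric] linear_scale[OF matrix_vector_mul_linear])
    moreover have "\<forall>l. ((axis j 1 - c) /\<^sub>R norm (gs_residual r x j)) $ l \<noteq> 0 \<longrightarrow> r l \<le> r j"
    proof (intro allI impI)
      fix l assume "((axis j 1 - c) /\<^sub>R norm (gs_residual r x j)) $ l \<noteq> 0"
      then have "l = j \<or> c $ l \<noteq> 0" by (auto simp: axis_def split: if_splits)
      then show "r l \<le> r j" using supp by (auto intro: less_imp_le)
    qed
    ultimately show ?case using res supp by blast
  qed
  from both[of j] show "\<exists>c. gs r x j = x *v c \<and> (\<forall>l. c $ l \<noteq> 0 \<longrightarrow> r l \<le> r j)"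
    "\<exists>c. gs_residual r x j = x *v (axis j 1 - c) \<and> (\<forall>l. c $ l \<noteq> 0 \<longrightarrow> r l < r j)" by blast+
qed

lemma full_rank_mult_nonzero:
  fixes x :: "real^'m^'n"
  assumes "det (transpose x ** x) \<noteq> 0" "x *v c = 0"
  shows "c = 0"
proof -
  have "(transpose x ** x) *v c = 0" using assms(2) by (simp add: matrix_vector_mul_assoc[symmetric])
  then show ?thesis
    using assms(1) by (metis invertible_det_nz matrix_left_invertible_ker invertible_left_inverse)
qed

lemma gs_residual_nonzero:
  assumes "det (transpose x ** x) \<noteq> 0"
  shows "gs_residual r x j \<noteq> 0"
proof
  assume "gs_residual r x j = 0"
  moreover obtain c where c: "gs_residual r x j = x *v (axis j 1 - c)" "\<forall>l. c $ l \<noteq> 0 \<longrightarrow> r l < r j"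
    using gs_in_span(2) by blast
  ultimately have "axis j 1 - c = 0" using full_rank_mult_nonzero[OF assms] by metis
  then have "c $ j = 1" by (metis axis_nth eq_iff_diff_eq_0)
  then show False using c(2) by force
qed

lemma gs_orthonormal:
  assumes x: "det (transpose x ** x) \<noteq> 0" and r: "inj r"
  shows "gs r x i \<bullet> gs r x j = (if i = j then 1 else 0)"
proof -
  have norm1: "gs r x j \<bullet> gs r x j = 1" for j
    using gs_residual_nonzero[OF x] by (simp add: gs_eq power2_norm_eq_inner[symmetric] power2_eq_square dot_square_norm)
  have less: "gs r x k \<bullet> gs r x j = 0" if "r k < r j" for k j
    using that
  proof (induction "r j" arbitrary: j k rule: less_induct)
    case less
    have IH: "gs r x k \<bullet> gs r x i = (if i = k then 1 else 0)" if "r i < r j" for i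
    proof (cases "i = k")
      case False
      then consider "r i < r k" | "r k < r i" using r by (metis injD linorder_neqE_nat)
      then show ?thesis
        using less.hyps[of k i] less.hyps[of i k] that less.prems False by cases (auto simp: inner_commute)
    qed (simp add: norm1)
    have "gs r x k \<bullet> (\<Sum>i\<in>{i. r i < r j}. (column j x \<bullet> gs r x i) *\<^sub>R gs r x i)
        = (\<Sum>i\<in>{i. r i < r j}. if i = k then column j x \<bullet> gs r x k else 0)"
      unfolding inner_sum_right by (intro sum.cong refl) (auto simp: IH)
    also have "\<dots> = column j x \<bullet> gs r x k" using less.prems by simp
    finally have "gs r x k \<bullet> gs_residual r x j = 0"
      by (simp add: gs_residual_def inner_diff_right inner_commute)
    then show ?case by (simp add: gs_eq[of r x j])
  qed
  show ?thesis
  proof (cases "i = j")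
    case False
    then consider "r i < r j" | "r j < r i" using r by (metis injD linorder_neqE_nat)
    then show ?thesis using less[of i j] less[of j i] False by cases (auto simp: inner_commute)
  qed (simp add: norm1)
qed

text \<open>The orthonormal factor of a QR decomposition, chosen measurably and equivariant under
  left rotations. For Gaussian \<open>x\<close> and injective \<open>r\<close> its law is the
  invariant distribution.\<close>

definition rho :: "('k::finite \<Rightarrow> nat) \<Rightarrow> real^'k^'n \<Rightarrow> real^'k^'n" where
  "rho r x = (\<chi> a j. gs r x j $ a)"

lemma rho_measurable [measurable]: "rho r \<in> borel_measurable borel"
proof (rule borel_measurable_matrixI)
  fix i j
  show "(\<lambda>x. rho r x $ i $ j) \<in> borel_measurable borel"
    unfolding rho_def using measurable_compose[OF gs_measurable[of r j] borel_measurable_row[where i = i]] by simp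
qed

lemma rho_mult_orthogonal: "orthogonal_matrix \<gamma> \<Longrightarrow> rho r (\<gamma> ** x) = \<gamma> ** rho r x"
  by (simp add: rho_def gs_mult_orthogonal) (simp add: vec_eq_iff matrix_vector_mult_def matrix_matrix_mult_def)

lemma transpose_rho_rho:
  assumes "det (transpose x ** x) \<noteq> 0" "inj r"
  shows "transpose (rho r x) ** rho r x = mat 1"
proof -
  have "(transpose (rho r x) ** rho r x) $ i $ j = gs r x i \<bullet> gs r x j" for i j
    by (simp add: matrix_matrix_mult_def transpose_def rho_def inner_vec_def)
  then show ?thesis using gs_orthonormal[OF assms] by (simp add: vec_eq_iff mat_def)
qed

lemma rho_rho_mult:
  assumes x: "det (transpose x ** x) \<noteq> 0" and r: "inj r"
  shows "rho r x ** (transpose (rho r x) ** x) = x"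
proof -
  \<comment> \<open>The triangular factor. Once \<open>x\<close> is \<open>rho r x ** C\<close>,
    orthonormality lets \<open>transpose (rho r x) ** x\<close> take the place of
    \<open>C\<close>.\<close>
  define C where "C = (\<chi> i j. if i = j then norm (gs_residual r x j) else if r i < r j then column j x \<bullet> gs r x i else 0)"
  have "column j (rho r x ** C) = column j x" for j
  proof -
    have "column j (rho r x ** C) = (\<Sum>i\<in>UNIV. C $ i $ j *\<^sub>R gs r x i)"
      by (simp add: vec_eq_iff column_def matrix_matrix_mult_def rho_def mult.commute)
    also have "\<dots> = (\<Sum>i\<in>UNIV. (if i = j then norm (gs_residual r x j) *\<^sub>R gs r x j else 0)
        + (if i \<in> {i. r i < r j} then (column j x \<bullet> gs r x i) *\<^sub>R gs r x i else 0))"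
      by (intro sum.cong refl) (auto simp: C_def)
    also have "\<dots> = norm (gs_residual r x j) *\<^sub>R gs r x j + (\<Sum>i\<in>{i. r i < r j}. (column j x \<bullet> gs r x i) *\<^sub>R gs r x i)"
      by (simp only: sum.distrib) (simp add: sum.If_cases)
    also have "norm (gs_residual r x j) *\<^sub>R gs r x j = gs_residual r x j"
      using gs_residual_nonzero[OF x] by (simp add: gs_eq)
    finally show ?thesis by (simp add: gs_residual_def)
  qed
  then have xC: "rho r x ** C = x"
    by (simp add: vec_eq_iff column_def)
  have "rho r x ** (transpose (rho r x) ** (rho r x ** C)) = rho r x ** ((transpose (rho r x) ** rho r x) ** C)"
    by (simp add: matrix_mul_assoc)
  also have "\<dots> = rho r x ** C" by (simp add: transpose_rho_rho[OF x r])
  finally show ?thesis by (simp only: xC)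
qed

text \<open>Columns are matched one at a time by reflections. The mirror vector is the difference of
  the present and the desired column \<open>a\<close>; both are orthogonal to the columns already
  matched, which therefore stay fixed.\<close>

lemma stiefel_transitive:
  fixes u w :: "real^'m^'n"
  assumes u: "u \<in> stiefel" and w: "w \<in> stiefel"
  shows "\<exists>\<gamma>. orthogonal_matrix \<gamma> \<and> \<gamma> ** u = w"
proof -
  have inner: "column i v \<bullet> column j v = (if i = j then 1 else 0)" if "v \<in> stiefel" for v :: "real^'m^'n" and i j
  proof -
    have "(transpose v ** v) $ i $ j = column i v \<bullet> column j v"
      by (simp add: matrix_matrix_mult_def transpose_def column_def inner_vec_def)
    then show ?thesis using that by (simp add: stiefel_def mat_def)
  qed
  have "\<exists>\<gamma>. orthogonal_matrix \<gamma> \<and> (\<forall>j\<in>A. \<gamma> *v column j u = column j w)" for A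
    using finite[of A]
  proof (induction A rule: finite_induct)
    case empty
    show ?case by (intro exI[of _ "mat 1"]) (simp add: orthogonal_matrix_id)
  next
    case (insert a A)
    then obtain \<gamma> where \<gamma>: "orthogonal_matrix \<gamma>" "\<And>j. j \<in> A \<Longrightarrow> \<gamma> *v column j u = column j w" by blast
    define p where "p = \<gamma> *v column a u"
    define n where "n = p - column a w"
    have "orthogonal_transformation ((*v) \<gamma>)"
      using \<gamma>(1) by (simp add: orthogonal_transformation_matrix)
    then have o: "(\<gamma> *v x) \<bullet> (\<gamma> *v y) = x \<bullet> y" for x y
      by (simp add: orthogonal_transformation_def)
    have H: "householder n *v x = x - (2 / (n \<bullet> n) * (x \<bullet> n)) *\<^sub>R n" for x
    proof -
      have "(householder n *v x) $ i = x $ i - (2 / (n \<bullet> n) * (x \<bullet> n)) * n $ i" for i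
      proof -
        have "(householder n *v x) $ i = (\<Sum>k\<in>UNIV. (if i = k then x $ i else 0) - 2 / (n \<bullet> n) * n $ i * (x $ k * n $ k))"
          unfolding matrix_vector_mult_def vec_lambda_beta
          by (intro sum.cong refl) (simp add: householder_def algebra_simps)
        also have "\<dots> = x $ i - 2 / (n \<bullet> n) * n $ i * (x \<bullet> n)"
          unfolding sum_subtractf sum_distrib_left[symmetric] by (simp add: inner_vec_def)
        finally show ?thesis by simp
      qed
      then show ?thesis by (simp add: vec_eq_iff)
    qed
    have pp: "p \<bullet> p = 1" "column a w \<bullet> column a w = 1"
      using inner[OF u, of a a] inner[OF w, of a a] by (simp_all add: p_def o)
    have nn: "n \<bullet> n = 2 * (p \<bullet> n)"
      by (simp add: n_def inner_diff_left inner_diff_right pp inner_commute)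
    have "householder n *v p = p - (2 / (n \<bullet> n) * (p \<bullet> n)) *\<^sub>R n" by (rule H)
    also have "(2 / (n \<bullet> n) * (p \<bullet> n)) *\<^sub>R n = n"
      using nn by (cases "n = 0") (auto simp: field_simps)
    also have "p - n = column a w" by (simp add: n_def)
    finally have "householder n *v p = column a w" .
    moreover have "householder n *v column j w = column j w" if "j \<in> A" for j
    proof -
      have "j \<noteq> a" using that insert by auto
      have "column j w \<bullet> p = 0"
        using inner[OF u, of j a] \<open>j \<noteq> a\<close> by (simp add: p_def \<gamma>(2)[OF that, symmetric] o)
      then have "column j w \<bullet> n = 0"
        using inner[OF w, of j a] \<open>j \<noteq> a\<close> by (simp add: n_def inner_diff_right)
      then show ?thesis by (simp add: H)
    qed
    ultimately have "\<forall>j\<in>insert a A. (householder n ** \<gamma>) *v column j u = column j w"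
      using \<gamma>(2) by (simp add: matrix_vector_mul_assoc[symmetric] p_def)
    with orthogonal_matrix_mul[OF orthogonal_householder \<gamma>(1)] show ?case by blast
  qed
  then obtain \<gamma> where \<gamma>: "orthogonal_matrix \<gamma>" "\<And>j. \<gamma> *v column j u = column j w" by blast
  have "column j (\<gamma> ** u) = \<gamma> *v column j u" for j
    by (simp add: column_def matrix_matrix_mult_def matrix_vector_mult_def vec_eq_iff)
  then have "\<gamma> ** u = w" using \<gamma>(2) by (simp add: vec_eq_iff column_def)
  with \<gamma>(1) show ?thesis by blast
qed

subsection \<open>Null sets\<close>

text \<open>Once \<open>s\<close> exceeds the operator norm of \<open>B\<close>, the shifted matrix
  is invertible, so the determinant is a nonzero polynomial in \<open>s\<close>.\<close>

lemma finite_det_shift_zero: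
  fixes B :: "real^'m^'m"
  shows "finite {s. det (B + s *\<^sub>R mat 1) = 0}"
proof -
  obtain p where p: "\<And>s. poly p s = det (\<chi> i j. B$i$j + s * mat 1 $ i $ j)"
    using det_affine_poly[of B "mat 1"] by blast
  have e: "(\<chi> i j. B$i$j + s * mat 1 $ i $ j) = B + s *\<^sub>R mat 1" for s
    by (simp add: vec_eq_iff)
  define K where "K = onorm ((*v) B)"
  have "det (B + (K + 1) *\<^sub>R mat 1) \<noteq> 0"
  proof
    assume "det (B + (K + 1) *\<^sub>R mat 1) = 0"
    then obtain v where v: "v \<noteq> 0" "(B + (K + 1) *\<^sub>R mat 1) *v v = 0"
      by (metis invertible_det_nz matrix_left_invertible_ker invertible_left_inverse)
    have "(K + 1) *\<^sub>R v = - (B *v v)"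
      using v(2) by (simp add: matrix_vector_mult_add_rdistrib eq_neg_iff_add_eq_0 scaleR_matrix_vector_assoc[symmetric] add.commute)
    then have "norm ((K + 1) *\<^sub>R v) = norm (B *v v)" by simp
    also have "\<dots> \<le> K * norm v" unfolding K_def by (rule onorm) simp
    finally have "\<bar>K + 1\<bar> \<le> K" using v(1) by simp
    then show False by simp
  qed
  then have "p \<noteq> 0" using p[of "K + 1"] by (auto simp: e)
  then have "finite {s. poly p s = 0}" by (rule poly_roots_finite)
  then show ?thesis by (simp add: p e)
qed

text \<open>Along a line in direction \<open>v\<close> the matrix \<open>transpose v ** x\<close>
  changes by multiples of the identity, so each such line meets the exceptional set finitely often
  and Fubini applies. A Gaussian weight in \<open>s\<close> gives the line total mass 1.\<close>

lemma AE_det_stiefel_mult_nonzero: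
  fixes v :: "real^'m^'n"
  assumes v: "v \<in> stiefel"
  shows "AE x in lborel. det (transpose v ** (x::real^'m^'n)) \<noteq> 0"
proof -
  define N where "N = {x::real^'m^'n. det (transpose v ** x) = 0}"
  have [measurable]: "N \<in> sets borel" unfolding N_def by measurable
  define \<phi> :: "real \<Rightarrow> ennreal" where "\<phi> s = ennreal (gauss_density s)" for s
  have [measurable]: "\<phi> \<in> borel_measurable borel" unfolding \<phi>_def by measurable
  have \<phi>1: "(\<integral>\<^sup>+s. \<phi> s \<partial>lborel) = 1"
    using gauss.emeasure_space_1[where 'a = real] by (simp add: gauss_def emeasure_density \<phi>_def)
  have z: "(\<integral>\<^sup>+s. \<phi> s * indicator N (s *\<^sub>R v + x) \<partial>lborel) = 0" for x
  proof -
    have "transpose v ** (s *\<^sub>R v + x) = transpose v ** x + s *\<^sub>R mat 1" for s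
      using v linear_add[OF linear_matrix_mult_left[of "transpose v"], of "s *\<^sub>R v" x]
        linear_scale[OF linear_matrix_mult_left[of "transpose v"], of s v]
      by (simp add: stiefel_def add.commute)
    then have "finite {s. s *\<^sub>R v + x \<in> N}"
      using finite_det_shift_zero[of "transpose v ** x"] by (simp add: N_def)
    then have "{s. s *\<^sub>R v + x \<in> N} \<in> null_sets lborel"
      by (intro finite_imp_null_set_lborel)
    then have "AE s in lborel. s \<notin> {s. s *\<^sub>R v + x \<in> N}" by (rule AE_not_in)
    then have "AE s in lborel. \<phi> s * indicator N (s *\<^sub>R v + x) = 0"
      by eventually_elim auto
    then show ?thesis by (subst nn_integral_0_iff_AE) auto
  qed
  have "emeasure lborel N = (\<integral>\<^sup>+s. \<phi> s * emeasure lborel N \<partial>lborel)"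
    by (simp add: nn_integral_multc \<phi>1)
  also have "\<dots> = (\<integral>\<^sup>+s. \<integral>\<^sup>+x. \<phi> s * indicator N (s *\<^sub>R v + x) \<partial>lborel \<partial>lborel)"
  proof (rule nn_integral_cong)
    fix s
    have "emeasure lborel N = (\<integral>\<^sup>+x. indicator N (s *\<^sub>R v + x) \<partial>lborel)"
      using nn_integral_lborel_translate[of "indicator N" "s *\<^sub>R v"] by simp
    then show "\<phi> s * emeasure lborel N = (\<integral>\<^sup>+x. \<phi> s * indicator N (s *\<^sub>R v + x) \<partial>lborel)"
      by (simp add: nn_integral_cmult)
  qed
  also have "\<dots> = (\<integral>\<^sup>+x. \<integral>\<^sup>+s. \<phi> s * indicator N (s *\<^sub>R v + x) \<partial>lborel \<partial>lborel)"
    by (rule lborel_pair.Fubini') measurable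
  also have "\<dots> = 0" by (simp add: z)
  finally have "N \<in> null_sets lborel" by (simp add: null_sets_def)
  then show ?thesis using AE_not_in[of N lborel] by (simp add: N_def)
qed

text \<open>A kernel vector of the Gram matrix is a kernel vector of \<open>x\<close>, hence of
  \<open>transpose v ** x\<close>.\<close>

lemma det_stiefel_mult_full_rank:
  fixes x :: "real^'m^'n"
  assumes "det (transpose v ** x) \<noteq> 0"
  shows "det (transpose x ** x) \<noteq> 0"
proof
  assume "det (transpose x ** x) = 0"
  then obtain c where c: "c \<noteq> 0" "(transpose x ** x) *v c = 0"
    by (metis invertible_det_nz matrix_left_invertible_ker invertible_left_inverse)
  have "(transpose x ** x) *v c = transpose x *v (x *v c)"
    by (rule matrix_vector_mul_assoc[symmetric])
  also have "\<dots> = (x *v c) v* x" by (rule transpose_matrix_vector)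
  finally have "((x *v c) v* x) \<bullet> c = 0" using c(2) by (metis inner_zero_left)
  then have "(x *v c) \<bullet> (x *v c) = 0" by (simp only: dot_lmul_matrix)
  then have "x *v c = 0" by simp
  then have "(transpose v ** x) *v c = 0" by (simp add: matrix_vector_mul_assoc[symmetric])
  then show False
    using assms c by (metis invertible_det_nz matrix_left_invertible_ker invertible_left_inverse)
qed

lemma AE_full_rank:
  fixes v :: "real^'m^'n"
  assumes "v \<in> stiefel"
  shows "AE x in lborel. det (transpose x ** (x::real^'m^'n)) \<noteq> 0"
  using AE_det_stiefel_mult_nonzero[OF assms] by eventually_elim (rule det_stiefel_mult_full_rank)

lemma AE_det_nonzero: "AE x in lborel. det (x::real^'m^'m) \<noteq> 0"
  using AE_det_stiefel_mult_nonzero[of "mat 1 :: real^'m^'m"] by (simp add: stiefel_def)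

subsection \<open>Uniqueness of the invariant measure\<close>

lemma stiefel_measure_facts:
  fixes M :: "(real^'m^'n) measure"
  assumes "is_stiefel_measure M"
  shows "sets M = sets (restrict_space borel stiefel)" "space M = stiefel" "finite_measure M"
    "(\<lambda>w. w) \<in> M \<rightarrow>\<^sub>M borel"
proof -
  show 1: "sets M = sets (restrict_space borel stiefel)"
    using assms by (simp add: is_stiefel_measure_def)
  show 2: "space M = stiefel"
    using sets_eq_imp_space_eq[OF 1] by (simp add: space_restrict_space)
  show "finite_measure M"
    using assms by (intro finite_measureI) (simp add: is_stiefel_measure_def)
  have "(\<lambda>w. w) \<in> restrict_space borel stiefel \<rightarrow>\<^sub>M borel"
    by (rule measurable_restrict_space1) simp
  then show "(\<lambda>w. w) \<in> M \<rightarrow>\<^sub>M borel"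
    using measurable_cong_sets[OF 1 refl] by blast
qed

lemma orthogonal_mult_stiefel:
  assumes "orthogonal_matrix \<gamma>" "w \<in> stiefel"
  shows "\<gamma> ** w \<in> stiefel"
proof -
  have "transpose (\<gamma> ** w) ** (\<gamma> ** w) = transpose w ** (transpose \<gamma> ** \<gamma>) ** w"
    by (simp add: matrix_transpose_mul matrix_mul_assoc)
  then show ?thesis using assms by (simp add: stiefel_def orthogonal_matrix_def matrix_mul_rid)
qed

lemma nn_integral_stiefel_invariant:
  fixes M :: "(real^'m^'n) measure"
  assumes M: "is_stiefel_measure M" and \<gamma>: "orthogonal_matrix \<gamma>" and f: "f \<in> borel_measurable borel"
  shows "(\<integral>\<^sup>+w. f (\<gamma> ** w) \<partial>M) = (\<integral>\<^sup>+w. f w \<partial>M)"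
proof -
  note id = stiefel_measure_facts(4)[OF M]
  have fM: "f \<in> borel_measurable M" using measurable_compose[OF id f] .
  have g0: "(\<lambda>w. \<gamma> ** w) \<in> M \<rightarrow>\<^sub>M borel"
    using measurable_compose[OF id borel_measurable_linear[OF linear_matrix_mult_left]] .
  have "(\<lambda>w. \<gamma> ** w) \<in> M \<rightarrow>\<^sub>M restrict_space borel stiefel"
    using g0 orthogonal_mult_stiefel[OF \<gamma>] stiefel_measure_facts(2)[OF M]
    by (intro measurable_restrict_space2) auto
  then have g: "(\<lambda>w. \<gamma> ** w) \<in> M \<rightarrow>\<^sub>M M"
    using measurable_cong_sets[OF refl stiefel_measure_facts(1)[OF M]] by blast
  have "(\<integral>\<^sup>+w. f w \<partial>distr M M (\<lambda>w. \<gamma> ** w)) = (\<integral>\<^sup>+w. f (\<gamma> ** w) \<partial>M)"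
    by (rule nn_integral_distr[OF g]) (simp add: fM)
  moreover have "distr M M (\<lambda>w. \<gamma> ** w) = M"
    using M \<gamma> by (simp add: is_stiefel_measure_def)
  ultimately show ?thesis by simp
qed

text \<open>
  The transpose of \<open>rho r z\<close>, for a square Gaussian \<open>z\<close>, is a random orthogonal matrix whose law
  is invariant under right translations; averaging over it identifies every invariant measure.
\<close>

lemma nn_integral_stiefel_eq:
  fixes M :: "(real^'m^'n) measure" and r :: "'m \<Rightarrow> nat"
  assumes M: "is_stiefel_measure M" and r: "inj r" and v: "v \<in> (stiefel :: (real^'m^'n) set)"
    and f [measurable]: "f \<in> borel_measurable borel"
  shows "(\<integral>\<^sup>+w. f w \<partial>M) = emeasure M (space M) * (\<integral>\<^sup>+x. f (rho r x) \<partial>gauss)"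
proof -
  obtain e :: "'n \<Rightarrow> nat" where e: "inj e"
    using finite_imp_inj_to_nat_seg[of "UNIV :: 'n set"] by auto
  define Q where "Q z = transpose (rho e z)" for z :: "real^'n^'n"
  have [measurable]: "Q \<in> borel_measurable borel" unfolding Q_def by measurable
  have Qo: "AE z in gauss. orthogonal_matrix (Q z)"
  proof -
    have "AE z in gauss. det (z::real^'n^'n) \<noteq> 0" using AE_det_nonzero by (simp add: AE_gauss_iff)
    then show ?thesis
    proof eventually_elim
      case (elim z)
      then have "det (transpose z ** z) \<noteq> 0" by (simp add: det_mul det_transpose)
      then have "transpose (rho e z) ** rho e z = mat 1" using e by (rule transpose_rho_rho)
      then have "orthogonal_matrix (rho e z)" by (simp add: orthogonal_matrix)
      then show ?case by (simp add: Q_def orthogonal_matrix_transpose)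
    qed
  qed
  define K where "K w = (\<integral>\<^sup>+z. f (Q z ** w) \<partial>gauss)" for w
  \<comment> \<open>Transitivity rotates \<open>v\<close> to \<open>w\<close>, and the law of
    \<open>Q\<close> absorbs the rotation.\<close>
  have K: "K w = K v" if w: "w \<in> stiefel" for w
  proof -
    obtain g where g: "orthogonal_matrix g" "g ** v = w"
      using stiefel_transitive[OF v w] by blast
    then have gt: "orthogonal_matrix (transpose g)" by (simp add: orthogonal_matrix_transpose)
    have "Q z ** w = Q (transpose g ** z) ** v" for z
      by (simp add: Q_def rho_mult_orthogonal[OF gt] matrix_transpose_mul transpose_transpose g(2)[symmetric] matrix_mul_assoc)
    then have "K w = (\<integral>\<^sup>+z. f (Q (transpose g ** z) ** v) \<partial>gauss)" by (simp add: K_def)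
    also have "\<dots> = K v"
      unfolding K_def
      by (rule nn_integral_gauss_norm_preserving[OF linear_matrix_mult_left norm_orthogonal_mult[OF gt]]) measurable
    finally show ?thesis .
  qed
  interpret M: finite_measure M by (rule stiefel_measure_facts(3)[OF M])
  interpret P: pair_sigma_finite gauss M ..
  have id [measurable]: "(\<lambda>w. w) \<in> M \<rightarrow>\<^sub>M borel" by (rule stiefel_measure_facts(4)[OF M])
  have "(\<integral>\<^sup>+w. f w \<partial>M) = (\<integral>\<^sup>+z. (\<integral>\<^sup>+w. f w \<partial>M) \<partial>(gauss :: (real^'n^'n) measure))"
    using gauss.emeasure_space_1[where 'a = "real^'n^'n"] by simp
  also have "\<dots> = (\<integral>\<^sup>+z. (\<integral>\<^sup>+w. f (Q z ** w) \<partial>M) \<partial>gauss)"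
    by (rule nn_integral_cong_AE, use Qo in eventually_elim) (simp add: nn_integral_stiefel_invariant[OF M _ f])
  also have "\<dots> = (\<integral>\<^sup>+w. K w \<partial>M)"
    unfolding K_def
  proof (rule P.Fubini'[symmetric])
    have [measurable]: "(\<lambda>p. Q (fst p)) \<in> gauss \<Otimes>\<^sub>M M \<rightarrow>\<^sub>M borel" "(\<lambda>p. snd p) \<in> gauss \<Otimes>\<^sub>M M \<rightarrow>\<^sub>M borel"
      using measurable_compose[OF measurable_snd id] by measurable
    show "(\<lambda>(z, w). f (Q z ** w)) \<in> borel_measurable (gauss \<Otimes>\<^sub>M M)"
      unfolding case_prod_beta' by measurable
  qed
  also have "\<dots> = (\<integral>\<^sup>+w. K v \<partial>M)"
    by (rule nn_integral_cong) (simp add: K stiefel_measure_facts(2)[OF M])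
  finally have 1: "(\<integral>\<^sup>+w. f w \<partial>M) = emeasure M (space M) * K v" by (simp add: mult.commute)
  \<comment> \<open>The law of \<open>rho r x\<close> is invariant too, so the same averaging
    evaluates its integral as \<open>K v\<close>; the two measures differ only in total
    mass.\<close>
  have rho_st: "AE x in gauss. rho r (x::real^'m^'n) \<in> stiefel"
    using AE_full_rank[OF v] unfolding AE_gauss_iff
    by eventually_elim (simp add: stiefel_def transpose_rho_rho[OF _ r])
  have "(\<integral>\<^sup>+x. f (rho r (x::real^'m^'n)) \<partial>gauss) = (\<integral>\<^sup>+z. (\<integral>\<^sup>+x. f (rho r x) \<partial>gauss) \<partial>(gauss :: (real^'n^'n) measure))"
    using gauss.emeasure_space_1[where 'a = "real^'n^'n"] by simp
  also have "\<dots> = (\<integral>\<^sup>+z. (\<integral>\<^sup>+x. f (Q z ** rho r (x::real^'m^'n)) \<partial>gauss) \<partial>gauss)"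
  proof (rule nn_integral_cong_AE, use Qo in eventually_elim)
    fix z assume q: "orthogonal_matrix (Q z)"
    have "(\<integral>\<^sup>+x. f (rho r (Q z ** x)) \<partial>gauss) = (\<integral>\<^sup>+x. f (rho r (x::real^'m^'n)) \<partial>gauss)"
      by (rule nn_integral_gauss_norm_preserving[OF linear_matrix_mult_left norm_orthogonal_mult[OF q]]) measurable
    then show "(\<integral>\<^sup>+x. f (rho r x) \<partial>gauss) = (\<integral>\<^sup>+x. f (Q z ** rho r (x::real^'m^'n)) \<partial>gauss)"
      by (simp add: rho_mult_orthogonal[OF q])
  qed
  also have "\<dots> = (\<integral>\<^sup>+x. K (rho r (x::real^'m^'n)) \<partial>gauss)"
    unfolding K_def by (rule gauss_pair.Fubini'[symmetric]) measurable
  also have "\<dots> = (\<integral>\<^sup>+x. K v \<partial>(gauss :: (real^'m^'n) measure))"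
    by (rule nn_integral_cong_AE, use rho_st in eventually_elim) (rule K)
  also have "\<dots> = K v"
    using gauss.emeasure_space_1[where 'a = "real^'m^'n"] by simp
  finally show ?thesis using 1 by simp
qed

subsection \<open>Polar coordinates\<close>

text \<open>Cramer's rule, so that the inverse is visibly a measurable function of its
  argument.\<close>

definition minv :: "real^'m^'m \<Rightarrow> real^'m^'m" where
  "minv h = (\<chi> k j. det (\<chi> i l. if l = k then axis j 1 $ i else h$i$l) / det h)"

lemma minv_measurable [measurable]: "(minv :: real^'m^'m \<Rightarrow> _) \<in> borel_measurable borel"
proof (rule borel_measurable_matrixI)
  fix k j :: 'm
  have [measurable]: "(\<lambda>h::real^'m^'m. (\<chi> i l. if l = k then axis j 1 $ i else h$i$l)) \<in> borel_measurable borel"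
    by (rule borel_measurable_matrixI) auto
  show "(\<lambda>x. minv x $ k $ j) \<in> borel_measurable borel"
    unfolding minv_def by simp
qed

lemma minv_right: "det h \<noteq> 0 \<Longrightarrow> h ** minv h = mat 1"
proof -
  assume d: "det h \<noteq> 0"
  have "h *v (\<chi> k. minv h $ k $ j) = axis j 1" for j
    by (subst cramer[OF d]) (simp add: minv_def)
  then have "(h ** minv h) $ i $ j = mat 1 $ i $ j" for i j
    by (simp add: matrix_vector_mult_def matrix_matrix_mult_def vec_eq_iff axis_def mat_def)
  then show ?thesis by (simp add: vec_eq_iff)
qed

lemma minv_left: "det h \<noteq> 0 \<Longrightarrow> minv h ** h = mat 1"
  using minv_right matrix_left_right_inverse by blast

lemma det_minv: "det h \<noteq> 0 \<Longrightarrow> \<bar>det (minv h)\<bar> = 1 / \<bar>det h\<bar>"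
  using arg_cong[OF minv_right[of h], of "\<lambda>x. \<bar>det x\<bar>"]
  by (simp add: det_mul abs_mult field_simps)

lemma minv_mult:
  assumes "det h \<noteq> 0" "det t \<noteq> 0"
  shows "t ** minv (h ** t) = minv h"
proof -
  have d: "det (h ** t) \<noteq> 0" using assms by (simp add: det_mul)
  have "h ** (t ** minv (h ** t)) = mat 1" using minv_right[OF d] by (simp add: matrix_mul_assoc)
  then have "minv h ** (h ** (t ** minv (h ** t))) = minv h" by (simp add: matrix_mul_rid)
  then show ?thesis using minv_left[OF assms(1)] by (simp add: matrix_mul_assoc)
qed

lemma nn_integral_scaling:
  fixes f :: "'a::euclidean_space \<Rightarrow> 'a"
  assumes "lborel_scaling f (ennreal (1 / c))" "c > 0" "k \<in> borel_measurable borel"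
  shows "(\<integral>\<^sup>+x. k x \<partial>lborel) = ennreal c * (\<integral>\<^sup>+x. k (f x) \<partial>lborel)"
proof -
  have "ennreal c * ennreal (1 / c) = 1" using assms(2) by (simp add: ennreal_mult[symmetric])
  then show ?thesis using assms by (simp add: lborel_scaling_def mult.assoc[symmetric])
qed

definition gexp :: "'a::real_normed_vector \<Rightarrow> real" where
  "gexp x = exp (- (norm x)\<^sup>2 / 2)"

lemma gexp_pos [simp]: "gexp x > 0" by (simp add: gexp_def)

lemma gexp_measurable [measurable]: "(gexp :: 'a::euclidean_space \<Rightarrow> real) \<in> borel_measurable borel"
  unfolding gexp_def[abs_def] by measurable

lemma nn_integral_gauss_gexp:
  fixes f :: "'a::euclidean_space \<Rightarrow> ennreal"
  assumes [measurable]: "f \<in> borel_measurable borel"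
  shows "(\<integral>\<^sup>+x. ennreal (gexp x) * f x \<partial>lborel) = ennreal (sqrt (2 * pi) ^ DIM('a)) * (\<integral>\<^sup>+x. f x \<partial>gauss)"
proof -
  let ?c = "sqrt (2 * pi) ^ DIM('a)"
  have "ennreal (gexp x) = ennreal ?c * ennreal (gauss_density x)" for x :: 'a
    by (subst ennreal_mult[symmetric]) (auto simp: gexp_def gauss_density_def)
  then have "(\<integral>\<^sup>+x. ennreal (gexp x) * f x \<partial>lborel) = (\<integral>\<^sup>+x. ennreal ?c * (ennreal (gauss_density x) * f x) \<partial>lborel)"
    by (simp add: mult.assoc)
  also have "\<dots> = ennreal ?c * (\<integral>\<^sup>+x. ennreal (gauss_density x) * f x \<partial>lborel)"
    by (rule nn_integral_cmult) measurable
  finally show ?thesis by (simp add: nn_integral_gauss)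
qed

definition gram_det :: "real^'m^'n \<Rightarrow> real" where
  "gram_det x = sqrt (det (transpose x ** x))"

lemma gram_det_measurable [measurable]: "(gram_det :: real^'m^'n \<Rightarrow> real) \<in> borel_measurable borel"
  unfolding gram_det_def[abs_def] by measurable

lemma gram_det_rho:
  assumes x: "det (transpose x ** x) \<noteq> 0" and r: "inj r"
  shows "gram_det x = \<bar>det (transpose (rho r x) ** x)\<bar>"
proof -
  let ?t = "transpose (rho r x) ** x"
  have "transpose x ** x = transpose (rho r x ** ?t) ** (rho r x ** ?t)"
    by (simp only: rho_rho_mult[OF x r])
  also have "\<dots> = transpose ?t ** ((transpose (rho r x) ** rho r x) ** ?t)"
    by (simp only: matrix_transpose_mul matrix_mul_assoc)
  also have "\<dots> = transpose ?t ** ?t"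
    by (simp only: transpose_rho_rho[OF x r] matrix_mul_lid)
  finally have "det (transpose x ** x) = det ?t * det ?t" by (simp only: det_mul det_transpose)
  then show ?thesis by (simp add: gram_det_def)
qed

lemma gram_det_mult: 
  assumes "det (transpose y ** y) \<ge> 0"
  shows "gram_det (y ** (t::real^'m^'m)) = gram_det y * \<bar>det t\<bar>"
proof -
  have "transpose (y ** t) ** (y ** t) = transpose t ** (transpose y ** y) ** t"
    by (simp only: matrix_transpose_mul matrix_mul_assoc)
  then have "det (transpose (y ** t) ** (y ** t)) = det (transpose y ** y) * (det t)\<^sup>2"
    by (simp add: det_mul det_transpose power2_eq_square)
  then show ?thesis by (simp add: gram_det_def real_sqrt_mult)
qed

text \<open>
  Integrating over \<open>x = rho x t\<close> and \<open>g = t h\<close> turns \<open>F (rho x g)\<close> into \<open>F (x h)\<close>; the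
  substitutions \<open>y = x h\<close> and \<open>h = h' t\<close> then separate the variables.
\<close>

lemma nn_integral_polar_lborel:
  fixes F :: "real^'m^'n \<Rightarrow> ennreal" and r :: "'m \<Rightarrow> nat"
  assumes r: "inj r" and v: "v \<in> (stiefel :: (real^'m^'n) set)" and N: "N + CARD('m) = CARD('n)"
    and [measurable]: "F \<in> borel_measurable borel"
  shows "(\<integral>\<^sup>+x. ennreal (gexp x) * (\<integral>\<^sup>+g. ennreal (gexp g) * (ennreal (\<bar>det g\<bar> ^ N) * F (rho r x ** g)) \<partial>lborel) \<partial>lborel)
    = (\<integral>\<^sup>+h. ennreal (\<bar>det (h::real^'m^'m)\<bar> ^ N / \<bar>det h\<bar> ^ (2 * CARD('n))) * ennreal (gexp (minv h)) \<partial>lborel)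
      * (\<integral>\<^sup>+y. ennreal (gexp y) * F y \<partial>lborel)"
proof -
  \<comment> \<open>Collects |det h|^N from the weight, |det h|^(-n) from the substitution
    \<open>y = x ** h\<close>, and another |det h|^(-n) from the n-th power of
    \<open>gram_det (y ** minv h)\<close>.\<close>
  define w where "w h = \<bar>det h\<bar> ^ N / \<bar>det h\<bar> ^ (2 * CARD('n))" for h :: "real^'m^'m"
  have w0: "w h \<ge> 0" for h by (simp add: w_def)
  have [measurable]: "w \<in> borel_measurable borel" unfolding w_def by measurable
  have full: "AE x in lborel. det (transpose x ** (x::real^'m^'n)) \<noteq> 0" by (rule AE_full_rank[OF v])
  define L where "L x h = ennreal (\<bar>det h\<bar> ^ N) * (ennreal (gram_det x ^ CARD('n) * gexp x) * (ennreal (gexp (x ** h)) * F (x ** h)))"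
    for x :: "real^'m^'n" and h :: "real^'m^'m"
  have 1: "ennreal (gexp x) * (\<integral>\<^sup>+g. ennreal (gexp g) * (ennreal (\<bar>det g\<bar> ^ N) * F (rho r x ** g)) \<partial>lborel) = (\<integral>\<^sup>+h. L x h \<partial>lborel)"
    if x: "det (transpose x ** x) \<noteq> 0" for x :: "real^'m^'n"
  proof -
    define t where "t = transpose (rho r x) ** x"
    have gt: "gram_det x = \<bar>det t\<bar>" unfolding t_def by (rule gram_det_rho[OF x r])
    have "gram_det x \<noteq> 0" using x by (simp add: gram_det_def)
    then have dt: "det t \<noteq> 0" using gt by auto
    have xt: "rho r x ** t = x" unfolding t_def by (rule rho_rho_mult[OF x r])
    have xh: "rho r x ** (t ** h) = x ** h" for h :: "real^'m^'m" using xt by (simp add: matrix_mul_assoc)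
    have nt: "gexp (t ** h) = gexp (x ** h)" for h :: "real^'m^'m"
      using norm_stiefel_mult[OF transpose_rho_rho[OF x r], of "t ** h"] by (simp add: gexp_def xh)
    define k where "k g = ennreal (gexp g) * (ennreal (\<bar>det g\<bar> ^ N) * F (rho r x ** g))" for g
    have [measurable]: "k \<in> borel_measurable borel" unfolding k_def by measurable
    have "(\<integral>\<^sup>+g. k g \<partial>lborel) = ennreal (\<bar>det t\<bar> ^ CARD('m)) * (\<integral>\<^sup>+h. k (t ** h) \<partial>lborel)"
      by (rule nn_integral_scaling[OF lborel_scaling_mult_left[OF dt]]) (use dt in auto)
    then have "ennreal (gexp x) * (\<integral>\<^sup>+g. k g \<partial>lborel) = (\<integral>\<^sup>+h. ennreal (gexp x * \<bar>det t\<bar> ^ CARD('m)) * k (t ** h) \<partial>lborel)"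
      using borel_measurable_linear[OF linear_matrix_mult_left[of t]]
      by (subst nn_integral_cmult) (auto simp: ennreal_mult less_imp_le mult.assoc)
    also have "\<dots> = (\<integral>\<^sup>+h. L x h \<partial>lborel)"
    proof (rule nn_integral_cong)
      \<comment> \<open>The substitution gives |det t|^m and the weight |det t|^N. As N + m = n,
        together they are the n-th power of \<open>gram_det x\<close>, which no longer refers to the
        chosen frame.\<close>
      fix h :: "real^'m^'m"
      have "ennreal (gexp x * \<bar>det t\<bar> ^ CARD('m)) * k (t ** h)
        = ennreal (gexp x * \<bar>det t\<bar> ^ CARD('m)) * ennreal (\<bar>det (t ** h)\<bar> ^ N) * (ennreal (gexp (x ** h)) * F (x ** h))"
        by (simp add: k_def xh nt mult_ac)
      also have "ennreal (gexp x * \<bar>det t\<bar> ^ CARD('m)) * ennreal (\<bar>det (t ** h)\<bar> ^ N)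
          = ennreal (\<bar>det h\<bar> ^ N * (gram_det x ^ CARD('n) * gexp x))"
        by (subst ennreal_mult[symmetric])
          (auto simp: less_imp_le gt det_mul abs_mult power_mult_distrib N[symmetric] power_add)
      also have "\<dots> = ennreal (\<bar>det h\<bar> ^ N) * ennreal (gram_det x ^ CARD('n) * gexp x)"
        by (rule ennreal_mult) (auto simp: less_imp_le gt)
      finally show "ennreal (gexp x * \<bar>det t\<bar> ^ CARD('m)) * k (t ** h) = L x h"
        by (simp add: L_def mult.assoc)
    qed
    finally show ?thesis by (simp add: k_def)
  qed
  define J where "J h y = ennreal (w h) * (ennreal (gram_det y ^ CARD('n) * gexp (y ** minv h)) * (ennreal (gexp y) * F y))"
    for y :: "real^'m^'n" and h :: "real^'m^'m"
  have 2: "(\<integral>\<^sup>+x. L x h \<partial>lborel) = (\<integral>\<^sup>+y. J h y \<partial>lborel)" if h: "det h \<noteq> 0" for h :: "real^'m^'m"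
  proof -
    let ?c = "1 / \<bar>det h\<bar> ^ CARD('n)"
    define k where "k y = ennreal (gram_det (y ** minv h) ^ CARD('n) * gexp (y ** minv h)) * (ennreal (gexp y) * F y)" for y
    have [measurable]: "(\<lambda>y::real^'m^'n. y ** minv h) \<in> borel_measurable borel"
      by (rule borel_measurable_linear[OF linear_matrix_mult_right])
    have [measurable]: "k \<in> borel_measurable borel" unfolding k_def by measurable
    have xk: "L x h = ennreal (\<bar>det h\<bar> ^ N) * k (x ** h)" for x
      using minv_right[OF h] by (simp add: L_def k_def matrix_mul_assoc[symmetric] matrix_mul_rid)
    have "(\<integral>\<^sup>+x. k (x ** h) \<partial>lborel) = ennreal ?c * (\<integral>\<^sup>+y. k y \<partial>lborel)"
      using lborel_scaling_mult_right[OF h, where 'n = 'n] by (simp add: lborel_scaling_def)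
    then have "(\<integral>\<^sup>+x. L x h \<partial>lborel) = ennreal (\<bar>det h\<bar> ^ N) * (ennreal ?c * (\<integral>\<^sup>+y. k y \<partial>lborel))"
      unfolding xk using borel_measurable_linear[OF linear_matrix_mult_right[of h]]
      by (subst nn_integral_cmult) auto
    also have "\<dots> = (\<integral>\<^sup>+y. ennreal (\<bar>det h\<bar> ^ N * ?c) * k y \<partial>lborel)"
    proof -
      have "ennreal (\<bar>det h\<bar> ^ N * ?c) = ennreal (\<bar>det h\<bar> ^ N) * ennreal ?c" by (rule ennreal_mult) auto
      moreover have "(\<integral>\<^sup>+y. ennreal (\<bar>det h\<bar> ^ N * ?c) * k y \<partial>lborel) = ennreal (\<bar>det h\<bar> ^ N * ?c) * (\<integral>\<^sup>+y. k y \<partial>lborel)"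
        by (rule nn_integral_cmult) measurable
      ultimately show ?thesis by (simp only: mult.assoc)
    qed
    also have "\<dots> = (\<integral>\<^sup>+y. J h y \<partial>lborel)"
    proof (rule nn_integral_cong_AE, use full in eventually_elim)
      fix y :: "real^'m^'n"
      have pos: "det (transpose y ** y) \<ge> 0" if "det (transpose y ** y) \<noteq> 0"
      proof -
        have "gram_det y = \<bar>det (transpose (rho r y) ** y)\<bar>" by (rule gram_det_rho[OF that r])
        then have "gram_det y \<ge> 0" by simp
        then show ?thesis by (simp add: gram_det_def)
      qed
      assume y: "det (transpose y ** y) \<noteq> 0"
      have "gram_det (y ** minv h) = gram_det y / \<bar>det h\<bar>"
        by (simp add: gram_det_mult[OF pos[OF y]] det_minv[OF h])
      moreover have "gram_det y \<ge> 0" using pos[OF y] by (simp add: gram_det_def)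
      ultimately have "ennreal (\<bar>det h\<bar> ^ N * ?c) * ennreal (gram_det (y ** minv h) ^ CARD('n) * gexp (y ** minv h))
        = ennreal (w h) * ennreal (gram_det y ^ CARD('n) * gexp (y ** minv h))"
        using h by (simp add: ennreal_mult[symmetric] less_imp_le w_def power_divide power2_eq_square mult_2 power_add w0[unfolded w_def])
      then show "ennreal (\<bar>det h\<bar> ^ N * ?c) * k y = J h y"
        by (simp only: k_def J_def mult.assoc[symmetric])
    qed
    finally show ?thesis .
  qed
  \<comment> \<open>This constant is never evaluated; comparison with the constant function 1
    eliminates it later.\<close>
  define \<kappa> where "\<kappa> = (\<integral>\<^sup>+h. ennreal (w h) * ennreal (gexp (minv h)) \<partial>lborel)"
  have 3: "(\<integral>\<^sup>+h. J h y \<partial>lborel) = \<kappa> * (ennreal (gexp y) * F y)" if y: "det (transpose y ** y) \<noteq> 0" for y :: "real^'m^'n"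
  proof -
    define t where "t = transpose (rho r y) ** y"
    have gt: "gram_det y = \<bar>det t\<bar>" unfolding t_def by (rule gram_det_rho[OF y r])
    have "gram_det y \<noteq> 0" using y by (simp add: gram_det_def)
    then have dt: "det t \<noteq> 0" using gt by auto
    have yt: "rho r y ** t = y" unfolding t_def by (rule rho_rho_mult[OF y r])
    have ny: "gexp (y ** h) = gexp (t ** h)" for h :: "real^'m^'m"
      using norm_stiefel_mult[OF transpose_rho_rho[OF y r], of "t ** h"] yt by (simp add: gexp_def matrix_mul_assoc)
    define k where "k h = ennreal (w h) * ennreal (gexp (t ** minv h))" for h
    have [measurable]: "k \<in> borel_measurable borel" unfolding k_def by measurable
    have "(\<integral>\<^sup>+h. k h \<partial>lborel) = ennreal (\<bar>det t\<bar> ^ CARD('m)) * (\<integral>\<^sup>+h. k (h ** t) \<partial>lborel)"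
      by (rule nn_integral_scaling[OF lborel_scaling_mult_right[OF dt]]) (use dt in auto)
    also have "(\<integral>\<^sup>+h. k (h ** t) \<partial>lborel) = (\<integral>\<^sup>+h. ennreal (\<bar>det t\<bar> ^ N / \<bar>det t\<bar> ^ (2 * CARD('n))) * (ennreal (w h) * ennreal (gexp (minv h))) \<partial>lborel)"
    proof (rule nn_integral_cong_AE, use AE_det_nonzero in eventually_elim)
      fix h :: "real^'m^'m" assume h: "det h \<noteq> 0"
      have wht: "w (h ** t) = \<bar>det t\<bar> ^ N / \<bar>det t\<bar> ^ (2 * CARD('n)) * w h"
        by (simp add: w_def det_mul abs_mult power_mult_distrib mult.commute)
      then show "k (h ** t) = ennreal (\<bar>det t\<bar> ^ N / \<bar>det t\<bar> ^ (2 * CARD('n))) * (ennreal (w h) * ennreal (gexp (minv h)))"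
      proof -
        have "ennreal (w (h ** t)) = ennreal (\<bar>det t\<bar> ^ N / \<bar>det t\<bar> ^ (2 * CARD('n))) * ennreal (w h)"
          unfolding wht by (rule ennreal_mult) (auto simp: w0)
        then show ?thesis by (simp only: k_def minv_mult[OF h dt] mult.assoc)
      qed
    qed
    also have "\<dots> = ennreal (\<bar>det t\<bar> ^ N / \<bar>det t\<bar> ^ (2 * CARD('n))) * \<kappa>"
      unfolding \<kappa>_def by (rule nn_integral_cmult) measurable
    finally have k: "(\<integral>\<^sup>+h. k h \<partial>lborel) = ennreal (\<bar>det t\<bar> ^ CARD('m)) * (ennreal (\<bar>det t\<bar> ^ N / \<bar>det t\<bar> ^ (2 * CARD('n))) * \<kappa>)" .
    have "(\<integral>\<^sup>+h. J h y \<partial>lborel) = (\<integral>\<^sup>+h. (ennreal (\<bar>det t\<bar> ^ CARD('n)) * (ennreal (gexp y) * F y)) * k h \<partial>lborel)"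
      by (rule nn_integral_cong) (simp add: J_def k_def ny gt ennreal_mult less_imp_le mult_ac)
    also have "\<dots> = (ennreal (\<bar>det t\<bar> ^ CARD('n)) * (ennreal (gexp y) * F y)) * (\<integral>\<^sup>+h. k h \<partial>lborel)"
      by (rule nn_integral_cmult) measurable
    also have "\<dots> = (ennreal (\<bar>det t\<bar> ^ CARD('n)) * ennreal (\<bar>det t\<bar> ^ CARD('m)) * ennreal (\<bar>det t\<bar> ^ N / \<bar>det t\<bar> ^ (2 * CARD('n)))) * (\<kappa> * (ennreal (gexp y) * F y))"
      unfolding k by (simp only: mult_ac)
    \<comment> \<open>The exponents of |det t| are n from \<open>gram_det y\<close>, m from the
      substitution and N - 2 n from \<open>w\<close>; since N + m = n, they add up to 0.\<close>
    also have "ennreal (\<bar>det t\<bar> ^ CARD('n)) * ennreal (\<bar>det t\<bar> ^ CARD('m)) * ennreal (\<bar>det t\<bar> ^ N / \<bar>det t\<bar> ^ (2 * CARD('n))) = 1"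
    proof -
      have "\<bar>det t\<bar> ^ CARD('n) * \<bar>det t\<bar> ^ CARD('m) * (\<bar>det t\<bar> ^ N / \<bar>det t\<bar> ^ (2 * CARD('n))) = 1"
        using dt by (simp add: N[symmetric] mult_2 power_add)
      then show ?thesis by (metis ennreal_mult ennreal_1 zero_le_power abs_ge_zero mult_nonneg_nonneg divide_nonneg_nonneg)
    qed
    finally show ?thesis by simp
  qed
  have "(\<integral>\<^sup>+x. ennreal (gexp x) * (\<integral>\<^sup>+g. ennreal (gexp g) * (ennreal (\<bar>det g\<bar> ^ N) * F (rho r x ** g)) \<partial>lborel) \<partial>lborel)
      = (\<integral>\<^sup>+x. \<integral>\<^sup>+h. L x h \<partial>lborel \<partial>lborel)"
    by (rule nn_integral_cong_AE, use full in eventually_elim) (rule 1)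
  also have "\<dots> = (\<integral>\<^sup>+h. \<integral>\<^sup>+x. L x h \<partial>lborel \<partial>lborel)"
    unfolding L_def by (rule lborel_pair.Fubini'[symmetric]) measurable
  also have "\<dots> = (\<integral>\<^sup>+h. \<integral>\<^sup>+y. J h y \<partial>lborel \<partial>lborel)"
    by (rule nn_integral_cong_AE, use AE_det_nonzero in eventually_elim) (rule 2)
  also have "\<dots> = (\<integral>\<^sup>+y. \<integral>\<^sup>+h. J h y \<partial>lborel \<partial>lborel)"
    unfolding J_def by (rule lborel_pair.Fubini'[symmetric]) measurable
  also have "\<dots> = (\<integral>\<^sup>+y. \<kappa> * (ennreal (gexp y) * F y) \<partial>lborel)"
    by (rule nn_integral_cong_AE, use full in eventually_elim) (rule 3)
  also have "\<dots> = \<kappa> * (\<integral>\<^sup>+y. ennreal (gexp y) * F y \<partial>lborel)"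
    by (rule nn_integral_cmult) measurable
  finally show ?thesis by (simp add: \<kappa>_def w_def)
qed

text \<open>Testing with \<open>F = 1\<close> identifies the constant through the mean of |det g|^N,
  so no Jacobian of the Stiefel manifold has to be computed. The Gaussian normalisations
  \<open>c\<close> and \<open>d\<close> are finite and nonzero and can be cancelled.\<close>

lemma nn_integral_polar:
  fixes M :: "(real^'m^'n) measure" and F :: "real^'m^'n \<Rightarrow> ennreal"
  assumes M: "is_stiefel_measure M" and v: "v \<in> (stiefel :: (real^'m^'n) set)" and N: "N + CARD('m) = CARD('n)"
    and [measurable]: "F \<in> borel_measurable borel"
  shows "(\<integral>\<^sup>+w. \<integral>\<^sup>+g. ennreal (\<bar>det g\<bar> ^ N) * F (w ** g) \<partial>gauss \<partial>M)
    = emeasure M (space M) * (\<integral>\<^sup>+g. ennreal (\<bar>det (g::real^'m^'m)\<bar> ^ N) \<partial>gauss) * (\<integral>\<^sup>+x. F x \<partial>gauss)"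
proof -
  obtain r :: "'m \<Rightarrow> nat" where r: "inj r"
    using finite_imp_inj_to_nat_seg[of "UNIV :: 'm set"] by auto
  define A where "A F = (\<integral>\<^sup>+x. \<integral>\<^sup>+g. ennreal (\<bar>det g\<bar> ^ N) * F (rho r (x::real^'m^'n) ** g) \<partial>gauss \<partial>gauss)"
    for F :: "real^'m^'n \<Rightarrow> ennreal"
  define \<kappa> where "\<kappa> = (\<integral>\<^sup>+h. ennreal (\<bar>det (h::real^'m^'m)\<bar> ^ N / \<bar>det h\<bar> ^ (2 * CARD('n))) * ennreal (gexp (minv h)) \<partial>lborel)"
  define c :: ennreal where "c = ennreal (sqrt (2 * pi) ^ DIM(real^'m^'m))"
  define d :: ennreal where "d = ennreal (sqrt (2 * pi) ^ DIM(real^'m^'n))"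
  have d0: "d \<noteq> 0" "d \<noteq> \<infinity>" by (simp_all add: d_def)
  have c0: "c \<noteq> 0" "c \<noteq> \<infinity>" by (simp_all add: c_def)
  have A: "d * (c * A F) = \<kappa> * (d * (\<integral>\<^sup>+x. F x \<partial>gauss))"
    if [measurable]: "F \<in> borel_measurable borel" for F :: "real^'m^'n \<Rightarrow> ennreal"
  proof -
    have "d * (c * A F) = d * (\<integral>\<^sup>+x. c * (\<integral>\<^sup>+g. ennreal (\<bar>det g\<bar> ^ N) * F (rho r (x::real^'m^'n) ** g) \<partial>gauss) \<partial>gauss)"
      unfolding A_def by (subst nn_integral_cmult) auto
    also have "\<dots> = d * (\<integral>\<^sup>+x. (\<integral>\<^sup>+g. ennreal (gexp g) * (ennreal (\<bar>det g\<bar> ^ N) * F (rho r (x::real^'m^'n) ** g)) \<partial>lborel) \<partial>gauss)"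
      unfolding c_def by (subst nn_integral_gauss_gexp) auto
    also have "\<dots> = (\<integral>\<^sup>+x. ennreal (gexp x) * (\<integral>\<^sup>+g. ennreal (gexp g) * (ennreal (\<bar>det g\<bar> ^ N) * F (rho r x ** g)) \<partial>lborel) \<partial>lborel)"
      unfolding d_def by (rule nn_integral_gauss_gexp[symmetric]) measurable
    also have "\<dots> = \<kappa> * (\<integral>\<^sup>+y. ennreal (gexp y) * F y \<partial>lborel)"
      unfolding \<kappa>_def by (rule nn_integral_polar_lborel[OF r v N]) measurable
    also have "\<dots> = \<kappa> * (d * (\<integral>\<^sup>+x. F x \<partial>gauss))"
      unfolding d_def by (subst nn_integral_gauss_gexp) auto
    finally show ?thesis .
  qed
  define m where "m = (\<integral>\<^sup>+g. ennreal (\<bar>det (g::real^'m^'m)\<bar> ^ N) \<partial>gauss)"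
  have "A (\<lambda>_. 1) = m"
    using gauss.emeasure_space_1[where 'a = "real^'m^'n"] by (simp add: A_def m_def)
  then have "d * (c * m) = \<kappa> * d"
    using A[of "\<lambda>_. 1"] gauss.emeasure_space_1[where 'a = "real^'m^'n"] by simp
  then have "d * (c * A F) = d * (c * (m * (\<integral>\<^sup>+x. F x \<partial>gauss)))"
    using A[of F] by (simp add: mult_ac) (metis mult.assoc mult.commute)
  then have AF: "A F = m * (\<integral>\<^sup>+x. F x \<partial>gauss)"
    using d0 c0 by (auto simp: ennreal_mult_cancel_left)
  have "(\<integral>\<^sup>+w. \<integral>\<^sup>+g. ennreal (\<bar>det g\<bar> ^ N) * F (w ** g) \<partial>gauss \<partial>M) = emeasure M (space M) * A F"
    unfolding A_def by (rule nn_integral_stiefel_eq[OF M r v]) measurable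
  then show ?thesis by (simp add: AF m_def mult.assoc)
qed

subsection \<open>The cosine transform of an \<open>H\<close>-polynomial\<close>

lemma emeasure_gauss_UNIV [simp]: "emeasure gauss UNIV = 1"
  using gauss.emeasure_space_1 by simp

lemma H_polynomial_odd_zero:
  fixes P :: "real^'m^'n \<Rightarrow> complex"
  assumes P: "H_polynomial k P" and k: "odd k"
  shows "P x = 0"
proof -
  define a :: 'm where "a = undefined"
  define q :: "real^'m^'m" where "q = (\<chi> i j. if i = j then if i = a then - 1 else 1 else 0)"
  have q: "orthogonal_matrix q"
    unfolding orthogonal_matrix
    by (auto simp: q_def vec_eq_iff matrix_matrix_mult_def transpose_def mat_def
        if_distrib[of "\<lambda>u. u * _"] cong: if_cong)
  have "det q = (\<Prod>i\<in>UNIV. q$i$i)" by (rule det_diagonal) (simp add: q_def)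
  also have "\<dots> = (\<Prod>i\<in>UNIV. if i = a then - 1 else 1)" by (simp add: q_def)
  also have "\<dots> = - 1" by (simp add: prod.delta)
  finally have d: "det q = - 1" .
  then have "invertible q" by (simp add: invertible_det_nz)
  then have "P (x ** q) = complex_of_real (det q ^ k) * P x"
    using P by (simp add: H_polynomial_def)
  moreover have "P (x ** q) = P x" using P q by (simp add: H_polynomial_def)
  ultimately show ?thesis using k d by simp
qed

lemma H_polynomial_cpoly: "H_polynomial k P \<Longrightarrow> cpoly P"
  by (simp add: H_polynomial_def cpoly_polynomial_function)

text \<open>Homogeneity is assumed for invertible \<open>g\<close> only. A singular \<open>g\<close>
  is the limit of \<open>g + s *\<^sub>R mat 1\<close>, which is invertible for all small nonzero
  \<open>s\<close>, and both sides are continuous.\<close>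

lemma H_polynomial_homogeneous:
  fixes P :: "real^'m^'n \<Rightarrow> complex"
  assumes P: "H_polynomial k P"
  shows "P (x ** g) = complex_of_real (det g) ^ k * P x"
proof -
  have cP: "cpoly P" using P by (rule H_polynomial_cpoly)
  have inv: "P (x ** h) = complex_of_real (det h) ^ k * P x" if "det h \<noteq> 0" for h
    using P that by (simp add: H_polynomial_def invertible_det_nz)
  define f where "f s = P (x ** (g + s *\<^sub>R mat 1)) - complex_of_real (det (g + s *\<^sub>R mat 1)) ^ k * P x" for s
  have "cpoly (\<lambda>h. P (x ** h) - complex_of_real (det h) ^ k * P x)"
  proof (intro cpoly_diff cpoly_mult cpoly_const cpoly_power)
    show "cpoly (\<lambda>h. P (x ** h))" by (rule cpoly_linear_image[OF cP linear_matrix_mult_left])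
    have "cpoly (\<lambda>h. det (\<chi> i j. complex_of_real ((h::real^'m^'m)$i$j)))"
    proof (rule cpoly_det)
      fix i j
      show "cpoly (\<lambda>h. (\<chi> i j. complex_of_real ((h::real^'m^'m)$i$j)) $ i $ j)"
        by (simp, rule cpoly_linear) (simp add: linear_iff)
    qed
    then show "cpoly (\<lambda>h. complex_of_real (det (h::real^'m^'m)))" by (simp add: det_of_real)
  qed
  then have "continuous_on UNIV (\<lambda>h. P (x ** h) - complex_of_real (det h) ^ k * P x)"
    by (rule continuous_cpoly)
  then have "continuous_on UNIV f"
    unfolding f_def by (rule continuous_on_compose2) (auto intro!: continuous_intros)
  then have "(f \<longlongrightarrow> f 0) (at 0)" by (simp add: continuous_on_def)
  moreover have "(f \<longlongrightarrow> 0) (at 0)"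
  proof (rule tendsto_eventually)
    have "\<not> 0 islimpt {s. det (g + s *\<^sub>R mat 1) = 0}"
      by (rule islimpt_finite) (rule finite_det_shift_zero)
    then have "eventually (\<lambda>s. s \<notin> {s. det (g + s *\<^sub>R mat 1) = 0}) (at 0)"
      by (simp add: islimpt_iff_eventually)
    then show "eventually (\<lambda>s. f s = 0) (at 0)"
      by eventually_elim (simp add: f_def inv)
  qed
  ultimately have "f 0 = 0" using tendsto_unique trivial_limit_at by blast
  then show ?thesis by (simp add: f_def)
qed

text \<open>
  Both sides have the same Gaussian convolution, by the mean value property of \<open>P\<close>.
\<close>

lemma H_polynomial_partial_average:
  fixes P :: "real^'m^'n \<Rightarrow> complex"
  assumes P: "H_polynomial k P" and v: "v \<in> stiefel"
  shows "(LINT x|gauss. P (v ** z + (x - v ** (transpose v ** x)))) = P v * gauss_det k z"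
proof -
  have cP: "cpoly P" using P by (rule H_polynomial_cpoly)
  have vv: "transpose v ** v = mat 1" using v by (simp add: stiefel_def)
  note iso = partial_isometry_stiefel[OF vv]
  define p where "p z = (LINT x|gauss. P (v ** z + (x - v ** (transpose v ** x))))" for z :: "real^'m^'m"
  have lin: "linear (\<lambda>x::real^'m^'n. x - v ** (transpose v ** x))"
    using linear_compose_sub[OF linear_id[unfolded id_def] linear_compose[OF linear_matrix_mult_left[of "transpose v"] linear_matrix_mult_left[of v]]]
    by (simp add: comp_def)
  have cp: "cpoly p"
    unfolding p_def by (rule cpoly_gauss_convolution[OF cP linear_matrix_mult_left lin])
  \<comment> \<open>The mean value property at \<open>v ** y\<close>, with the Gaussian shift split
    into \<open>v ** z\<close> and its complement, says that the convolution of \<open>p\<close> at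
    \<open>y\<close> is \<open>P (v ** y)\<close>.\<close>
  have pconv: "(LINT z|gauss. p (y + z)) = complex_of_real (det y) ^ k * P v" for y
  proof -
    have c: "cpoly (\<lambda>X. P (v ** y + X))" by (rule cpoly_translate[OF cP])
    have "(LINT X|gauss. P (v ** y + X)) = P (v ** y)"
      by (rule harmonic_gauss_mean_value[OF cP]) (use P in \<open>simp add: H_polynomial_def\<close>)
    then have "P (v ** y) = (LINT z|gauss. LINT x|gauss. P (v ** y + (v ** z + (x - v ** (transpose v ** x)))))"
      using integral_gauss_resample[OF iso integrable_gauss_cpoly[OF c]] by simp
    also have "\<dots> = (LINT z|gauss. p (y + z))"
      by (simp add: p_def add.assoc matrix_add_ldistrib)
    finally show ?thesis by (simp add: H_polynomial_homogeneous[OF P])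
  qed
  have "p z - P v * gauss_det k z = 0"
  proof (rule gauss_convolution_injective[of "\<lambda>z. p z - P v * gauss_det k z"])
    show "cpoly (\<lambda>z. p z - P v * gauss_det k z)"
      by (intro cpoly_diff cpoly_mult cpoly_const cp cpoly_gauss_det)
    show "(LINT z|gauss. p (y + z) - P v * gauss_det k (y + z)) = 0" for y
    proof -
      have "integrable gauss (\<lambda>z. p (y + z))" "integrable gauss (\<lambda>z. P v * gauss_det k (y + z))"
        by (intro integrable_gauss_cpoly cpoly_mult[OF cpoly_const] cpoly_translate cp cpoly_gauss_det)+
      then show ?thesis
        by (simp add: pconv gauss_convolution_gauss_det)
    qed
  qed
  then show ?thesis by (simp add: p_def)
qed

lemma card_atLeast_pos: "card {a::'m::{finite,linorder}..} > 0"
  by (simp add: card_gt_0_iff)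

lemma tail_moment_nonzero:
  assumes "Re z > - real (card {a..})"
  shows "tail_moment a z \<noteq> 0"
proof -
  have c: "card {a..} > 0" by (rule card_atLeast_pos)
  have pos: "w \<notin> \<int>\<^sub>\<le>\<^sub>0" if "Re w > 0" for w :: complex using that by (auto elim!: nonpos_Ints_cases)
  have "Gamma ((z + of_nat (card {a..})) / 2) \<noteq> 0" "Gamma (of_nat (card {a..}) / 2 :: complex) \<noteq> 0"
    using assms c by (auto simp: Gamma_eq_zero_iff dest: pos intro!: pos)
  then show ?thesis by (simp add: tail_moment_eq[OF assms])
qed

text \<open>With \<open>N > 0\<close> the powers by \<open>^\<close> and by \<open>powr\<close>
  agree also at 0, where \<open>0 powr 0\<close> would be 0.\<close>

lemma integral_gauss_det_power:
  assumes N: "N > 0"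
  shows "integrable gauss (\<lambda>g::((real, 'm::{finite,linorder}) vec, 'm) vec. complex_of_real (\<bar>det g\<bar> ^ N))"
    and "(LINT g|gauss. complex_of_real (\<bar>det (g::((real, 'm::{finite,linorder}) vec, 'm) vec)\<bar> ^ N))
      = (\<Prod>a\<in>(UNIV :: 'm set). tail_moment a (of_nat N))"
proof -
  let ?h = "\<lambda>g::((real, 'm::{finite,linorder}) vec, 'm) vec. complex_of_real (\<bar>det g\<bar> ^ N)"
  have h: "?h \<in> borel_measurable borel" by measurable
  have inv: "?h (z ** q) = ?h z" if "orthogonal_matrix q" for z q
    using that by (simp add: abs_det_mult_orthogonal)
  have i: "integrable gauss (\<lambda>y. complex_of_real (tail_norm a y) powr of_nat N)" for a :: 'm
    by (rule integrable_tail_norm_powr) (use card_atLeast_pos[of a] in simp)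
  have t: "?h (tri z) = (\<Prod>a\<in>UNIV. complex_of_real (tail_norm a (z $ a)) powr of_nat N)" for z
  proof -
    have "complex_of_real x ^ N = complex_of_real x powr of_nat N" if "x \<ge> 0" for x
      using N that by (cases "x = 0") (auto simp: powr_nat)
    then show ?thesis by (simp add: det_tri abs_prod prod_power_distrib)
  qed
  have "integrable gauss (\<lambda>z. ?h (tri z))"
    unfolding t by (rule integrable_gauss_prod_rows[OF i])
  then show "integrable gauss ?h" using integrable_gauss_tri(1)[OF h inv] by blast
  have "(LINT g|gauss. ?h g) = (LINT z|gauss. ?h (tri z))" by (rule integrable_gauss_tri(2)[OF h inv])
  also have "\<dots> = (\<Prod>a\<in>(UNIV :: 'm set). tail_moment a (of_nat N))"
    unfolding t tail_moment_def by (rule integral_gauss_prod_rows[OF i])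
  finally show "(LINT g|gauss. ?h g) = (\<Prod>a\<in>(UNIV :: 'm set). tail_moment a (of_nat N))" .
qed

lemma nn_integral_norm_eq_0_imp_integral:
  fixes f :: "'a \<Rightarrow> complex"
  assumes "f \<in> borel_measurable M" "(\<integral>\<^sup>+x. ennreal (norm (f x)) \<partial>M) = 0"
  shows "(LINT x|M. f x) = 0"
proof -
  have "AE x in M. f x = 0"
    using assms by (subst (asm) nn_integral_0_iff_AE) auto
  then show ?thesis by (rule integral_eq_zero_AE)
qed

text \<open>The Gaussian mean of \<open>f\<close> is evaluated twice, and convergence has to come
  first. It is settled for the power function alone, in absolute value, carried to the Stiefel
  manifold through polar coordinates, combined there with the boundedness of \<open>P\<close>, and
  carried back to the Gaussian mean of \<open>f\<close>.\<close>

lemma composite_cosine_H_polynomial: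
  fixes M :: "(((real, 'm::{finite,linorder}) vec, 'n::finite) vec) measure"
    and l :: "(complex, 'm) vec" and P :: "((real, 'm) vec, 'n) vec \<Rightarrow> complex"
  assumes nm: "N + CARD('m) = CARD('n)" "N > 0"
    and M: "is_stiefel_measure M"
    and l: "\<And>a. Re (l $ a) > - real (card {a..})"
    and P: "H_polynomial k P" and k: "even k"
    and v: "v \<in> stiefel" and mass: "stiefel_mass CARD('n) CARD('m) > 0"
  shows "integrable M (\<lambda>w. P w * cosine_kernel l v w)"
    and "complex_of_real (stiefel_mass CARD('n) CARD('m)) * (\<Prod>a\<in>(UNIV :: 'm set). tail_moment a (of_nat N)) *
        (P v * (\<Prod>a\<in>UNIV. tail_fun a (l $ a) (herm k)))
      = (\<Prod>a\<in>UNIV. tail_moment a (l $ a + of_nat (N + k))) * composite_cosine M l P v"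
proof -
  define \<sigma> where "\<sigma> = stiefel_mass CARD('n) CARD('m)"
  have \<sigma>: "\<sigma> > 0" "emeasure M (space M) = ennreal \<sigma>"
    using mass M by (simp_all add: \<sigma>_def is_stiefel_measure_def)
  have vv: "transpose v ** v = mat 1" using v by (simp add: stiefel_def)
  note iso = partial_isometry_stiefel[OF vv, where 'k = 'm]
  have cP: "cpoly P" using P by (rule H_polynomial_cpoly)
  have [measurable]: "P \<in> borel_measurable borel" by (rule cpoly_measurable[OF cP])
  note idM = stiefel_measure_facts(4)[OF M]
  have [measurable]: "(\<lambda>w. w) \<in> M \<rightarrow>\<^sub>M borel" by (rule idM)
  have PM [measurable]: "P \<in> borel_measurable M"
    using measurable_compose[OF idM, of P borel] by simp
  have vM [measurable]: "(\<lambda>w. transpose v ** w) \<in> M \<rightarrow>\<^sub>M borel"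
    using measurable_compose[OF idM borel_measurable_linear[OF linear_matrix_mult_left]] .
  have vb [measurable]: "(\<lambda>x::((real, 'm) vec, 'n) vec. transpose v ** x) \<in> borel_measurable borel"
    by (rule borel_measurable_linear[OF linear_matrix_mult_left])
  have vz: "transpose v ** (v ** z + (x - v ** (transpose v ** x))) = z"
    for z :: "((real, 'm) vec, 'm) vec" and x :: "((real, 'm) vec, 'n) vec"
  proof -
    have c: "transpose v ** (v ** y) = y" for y :: "((real, 'm) vec, 'm) vec"
      by (simp only: matrix_mul_assoc vv matrix_mul_lid)
    show ?thesis by (simp add: matrix_add_ldistrib linear_diff[OF linear_matrix_mult_left] c)
  qed
  define m where "m = (\<integral>\<^sup>+g. ennreal (\<bar>det (g::((real, 'm) vec, 'm) vec)\<bar> ^ N) \<partial>gauss)"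
  define \<mu>N where "\<mu>N = (LINT g|gauss. \<bar>det (g::((real, 'm) vec, 'm) vec)\<bar> ^ N)"
  have intdet: "integrable gauss (\<lambda>g::((real, 'm) vec, 'm) vec. \<bar>det g\<bar> ^ N)"
    using integrable_Re[OF integral_gauss_det_power(1)[OF nm(2), where 'm = 'm]] by simp
  have m: "m = ennreal \<mu>N"
    unfolding m_def \<mu>N_def by (rule nn_integral_eq_integral[OF intdet]) simp
  have \<mu>N: "complex_of_real \<mu>N = (\<Prod>a\<in>(UNIV :: 'm set). tail_moment a (of_nat N))"
    using integral_gauss_det_power(2)[OF nm(2), where 'm = 'm] by (simp only: \<mu>N_def integral_complex_of_real)
  have "tail_moment a (of_nat N) \<noteq> 0" for a :: 'm
    by (rule tail_moment_nonzero) (use card_atLeast_pos[of a] in simp)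
  then have "\<mu>N \<noteq> 0" using \<mu>N by (metis finite of_real_eq_0_iff prod_zero_iff)
  moreover have "\<mu>N \<ge> 0" unfolding \<mu>N_def by (rule Bochner_Integration.integral_nonneg) simp
  ultimately have \<mu>N0: "\<mu>N > 0" by simp
  define c where "c = \<sigma> * \<mu>N"
  have c0: "c > 0" using \<sigma> \<mu>N0 by (simp add: c_def)
  have polar: "(\<integral>\<^sup>+w. \<integral>\<^sup>+g. ennreal (\<bar>det g\<bar> ^ N) * F (w ** g) \<partial>gauss \<partial>M) = ennreal c * (\<integral>\<^sup>+x. F x \<partial>gauss)"
    if "F \<in> borel_measurable borel" for F :: "((real, 'm) vec, 'n) vec \<Rightarrow> ennreal"
    using nn_integral_polar[OF M v nm(1) that] \<sigma> \<mu>N0 by (simp add: m_def[symmetric] m c_def ennreal_mult)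
  define I where "I j = (\<integral>\<^sup>+g. ennreal (norm (det_gram j l g)) \<partial>gauss)" for j
  have lj: "Re (l $ a) + real j > - real (card {a..})" for a j using l[of a] by simp
  have Ifin: "I j < \<infinity>" for j
    using integrable_det_gram[OF lj, of j] by (simp add: I_def integrable_iff_bounded)
  \<comment> \<open>A vanishing absolute integral would make the integral 0, but that is a product
    of moments, each a quotient of gamma values without zeros.\<close>
  have Ipos: "I j \<noteq> 0" for j
  proof
    assume "I j = 0"
    then have "(LINT g|gauss. det_gram j l g) = 0"
      unfolding I_def by (rule nn_integral_norm_eq_0_imp_integral[rotated]) simp
    then obtain a where "tail_moment a (l $ a + of_nat j) = 0"
      unfolding integral_det_gram[OF lj] by auto
    then show False using tail_moment_nonzero[of a "l $ a + of_nat j"] lj[of a j] by simp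
  qed
  define K where "K = (\<integral>\<^sup>+w. ennreal (norm (gram_power l (transpose v ** w))) \<partial>M)"
  have "(\<integral>\<^sup>+w. \<integral>\<^sup>+g. ennreal (\<bar>det g\<bar> ^ N) * ennreal (norm (gram_power l (transpose v ** (w ** g)))) \<partial>gauss \<partial>M)
      = (\<integral>\<^sup>+w. ennreal (norm (gram_power l (transpose v ** w))) * I N \<partial>M)"
    unfolding I_def nn_integral_det_gram_mult[symmetric]
    by (simp add: norm_mult ennreal_mult matrix_mul_assoc norm_power)
  also have "\<dots> = K * I N"
    unfolding K_def by (rule nn_integral_multc) measurable
  finally have KI: "K * I N = ennreal c * (\<integral>\<^sup>+x. ennreal (norm (gram_power l (transpose v ** x))) \<partial>gauss)"
    by (subst (asm) polar) simp_all
  also have "(\<integral>\<^sup>+x. ennreal (norm (gram_power l (transpose v ** x))) \<partial>gauss) = I 0"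
    by (subst nn_integral_gauss_resample[OF iso]) (auto simp: vz I_def det_gram_def)
  \<comment> \<open>\<open>I 0\<close> is finite and \<open>I N\<close> is nonzero, so this identity
    forces \<open>K\<close> to be finite.\<close>
  finally have KI: "K * I N = ennreal c * I 0" .
  have Kfin: "K < \<infinity>"
  proof (rule ccontr)
    assume "\<not> K < \<infinity>"
    then have "K = \<infinity>" by (simp add: not_less top.extremum_unique)
    then have "K * I N = \<infinity>" using Ipos[of N] by (simp add: ennreal_top_mult)
    then show False using KI Ifin[of 0] by (simp add: ennreal_mult_eq_top_iff)
  qed
  \<comment> \<open>All points of the Stiefel manifold have the norm of the identity matrix, so the
    exponential bound for polynomials is a constant there.\<close>
  obtain B where B: "B \<ge> 0" "\<And>x. norm (P x) \<le> B * exp (1 * (norm x)\<^sup>2)"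
    using cpoly_bound[OF cP, of 1] by auto
  define B' where "B' = B * exp (1 * (norm (mat 1 :: ((real, 'm) vec, 'm) vec))\<^sup>2)"
  have PB: "norm (P w) \<le> B'" if "w \<in> stiefel" for w
  proof -
    have "norm (w ** mat 1) = norm (mat 1 :: ((real, 'm) vec, 'm) vec)"
      using that by (intro norm_stiefel_mult) (simp add: stiefel_def)
    then show ?thesis using B(2)[of w] by (simp add: B'_def matrix_mul_rid)
  qed
  have spM: "space M = stiefel" by (rule stiefel_measure_facts(2)[OF M])
  have PKfin: "(\<integral>\<^sup>+w. ennreal (norm (P w * gram_power l (transpose v ** w))) \<partial>M) < \<infinity>"
  proof -
    have "B' \<ge> 0" using PB[OF v] norm_ge_zero order_trans by blast
    have "(\<integral>\<^sup>+w. ennreal (norm (P w * gram_power l (transpose v ** w))) \<partial>M)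
        \<le> (\<integral>\<^sup>+w. ennreal B' * ennreal (norm (gram_power l (transpose v ** w))) \<partial>M)"
      by (rule nn_integral_mono)
        (use PB \<open>B' \<ge> 0\<close> in \<open>auto simp: spM norm_mult ennreal_mult[symmetric] intro!: ennreal_leI mult_right_mono\<close>)
    also have "\<dots> = ennreal B' * K"
      unfolding K_def by (rule nn_integral_cmult) measurable
    also have "\<dots> < \<infinity>" using Kfin by (simp add: ennreal_mult_less_top)
    finally show ?thesis .
  qed
  have intPK: "integrable M (\<lambda>w. P w * gram_power l (transpose v ** w))"
    by (rule integrableI_bounded[OF _ PKfin]) measurable
  then show "integrable M (\<lambda>w. P w * cosine_kernel l v w)" by (simp add: cosine_kernel_eq)
  define f where "f x = P x * gram_power l (transpose v ** x)" for x
  have fb [measurable]: "f \<in> borel_measurable borel" unfolding f_def by measurable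
  \<comment> \<open>For even \<open>k\<close>, homogeneity yields |det g|^k, which joins the weight
    |det g|^N of polar coordinates.\<close>
  have fg: "complex_of_real (\<bar>det g\<bar> ^ N) * f (w ** g) = P w * (complex_of_real (\<bar>det g\<bar> ^ (N + k)) * gram_power l ((transpose v ** w) ** g))"
    for w and g :: "((real, 'm) vec, 'm) vec"
  proof -
    have "complex_of_real (det g) ^ k = complex_of_real (\<bar>det g\<bar> ^ k)"
      using k by (simp add: power_even_abs)
    then show ?thesis by (simp add: f_def H_polynomial_homogeneous[OF P] matrix_mul_assoc power_add)
  qed
  have ffin: "(\<integral>\<^sup>+x. ennreal (norm (f x)) \<partial>gauss) < \<infinity>"
  proof -
    have e: "(\<integral>\<^sup>+g. ennreal (\<bar>det g\<bar> ^ N) * ennreal (norm (f (w ** g))) \<partial>gauss)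
        = ennreal (norm (P w * gram_power l (transpose v ** w))) * I (N + k)" for w
    proof -
      have "ennreal (\<bar>det g\<bar> ^ N) * ennreal (norm (f (w ** g)))
        = ennreal (norm (P w)) * ennreal (norm (complex_of_real (\<bar>det g\<bar> ^ (N + k)) * gram_power l ((transpose v ** w) ** g)))" for g
        using arg_cong[OF fg[of g w], of "\<lambda>u. ennreal (norm u)"] by (simp add: norm_mult ennreal_mult norm_power)
      then have "(\<integral>\<^sup>+g. ennreal (\<bar>det g\<bar> ^ N) * ennreal (norm (f (w ** g))) \<partial>gauss)
        = ennreal (norm (P w)) * (\<integral>\<^sup>+g. ennreal (norm (complex_of_real (\<bar>det g\<bar> ^ (N + k)) * gram_power l ((transpose v ** w) ** g))) \<partial>gauss)"
        by (simp only: nn_integral_cmult) (subst nn_integral_cmult; measurable)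
      then show ?thesis
        unfolding nn_integral_det_gram_mult by (simp add: I_def norm_mult ennreal_mult mult.assoc)
    qed
    have "ennreal c * (\<integral>\<^sup>+x. ennreal (norm (f x)) \<partial>gauss) = (\<integral>\<^sup>+w. ennreal (norm (P w * gram_power l (transpose v ** w))) * I (N + k) \<partial>M)"
      by (subst polar[symmetric]) (simp_all add: e)
    also have "\<dots> = (\<integral>\<^sup>+w. ennreal (norm (P w * gram_power l (transpose v ** w))) \<partial>M) * I (N + k)"
      by (rule nn_integral_multc) measurable
    also have "\<dots> < \<infinity>" using PKfin Ifin[of "N + k"] by (simp add: ennreal_mult_less_top)
    finally show ?thesis using c0 by (auto simp: ennreal_mult_less_top)
  qed
  have fG: "f \<in> borel_measurable gauss"
    by (simp add: fb measurable_cong_sets[OF sets_gauss refl])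
  have intf: "integrable gauss f"
    by (rule integrableI_bounded[OF fG ffin])
  interpret M: finite_measure M by (rule stiefel_measure_facts(3)[OF M])
  interpret MG: pair_sigma_finite M gauss ..
  have [measurable]: "(\<lambda>p. fst p ** snd p) \<in> M \<Otimes>\<^sub>M (gauss :: (((real, 'm) vec, 'm) vec) measure) \<rightarrow>\<^sub>M borel"
  proof -
    have [measurable]: "(\<lambda>p. fst p) \<in> M \<Otimes>\<^sub>M (gauss :: (((real, 'm) vec, 'm) vec) measure) \<rightarrow>\<^sub>M borel"
      using measurable_compose[OF measurable_fst idM] .
    show ?thesis by measurable
  qed
  define D where "D = density (M \<Otimes>\<^sub>M gauss) (\<lambda>p. ennreal (\<bar>det (snd p :: ((real, 'm) vec, 'm) vec)\<bar> ^ N))"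
  \<comment> \<open>The polar formula is available for nonnegative functions; read as an equality of
    measures, it carries over to the complex integrand \<open>f\<close>.\<close>
  have law: "distr D borel (\<lambda>p. fst p ** snd p) = density gauss (\<lambda>_. ennreal c)"
  proof (rule measure_eqI)
    fix A assume "A \<in> sets (distr D borel (\<lambda>p. fst p ** snd p))"
    then have [measurable]: "A \<in> sets borel" by simp
    have "emeasure (distr D borel (\<lambda>p. fst p ** snd p)) A = (\<integral>\<^sup>+p. indicator A (fst p ** snd p) \<partial>D)"
      using nn_integral_distr[of "\<lambda>p. fst p ** snd p" D borel "indicator A"] by (simp add: D_def)
    also have "\<dots> = (\<integral>\<^sup>+p. ennreal (\<bar>det (snd p)\<bar> ^ N) * indicator A (fst p ** snd p) \<partial>(M \<Otimes>\<^sub>M gauss))"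
      unfolding D_def by (rule nn_integral_density) measurable
    also have "\<dots> = (\<integral>\<^sup>+w. \<integral>\<^sup>+g. ennreal (\<bar>det g\<bar> ^ N) * indicator A (w ** g) \<partial>gauss \<partial>M)"
      by (subst gauss.nn_integral_fst[symmetric]) (auto)
    also have "\<dots> = ennreal c * (\<integral>\<^sup>+x. indicator A x \<partial>gauss)"
      by (rule polar) simp
    also have "\<dots> = emeasure (density gauss (\<lambda>_. ennreal c)) A"
      by (simp add: emeasure_density_const)
    finally show "emeasure (distr D borel (\<lambda>p. fst p ** snd p)) A = emeasure (density gauss (\<lambda>_. ennreal c)) A" .
  qed simp
  have mD: "(\<lambda>p. fst p ** snd p) \<in> D \<rightarrow>\<^sub>M borel" by (simp add: D_def)
  have "integrable (density gauss (\<lambda>_. ennreal c)) f"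
    using intf c0 by (subst integrable_density) (auto simp: fG)
  then have "integrable D (\<lambda>p. f (fst p ** snd p))"
    unfolding law[symmetric] by (subst (asm) integrable_distr_eq[OF mD]) auto
  then have int2: "integrable (M \<Otimes>\<^sub>M gauss) (\<lambda>p. \<bar>det (snd p)\<bar> ^ N *\<^sub>R f (fst p ** snd p))"
    unfolding D_def by (subst (asm) integrable_density) auto
  have "complex_of_real c * (LINT x|gauss. f x) = (LINT x|density gauss (\<lambda>_. ennreal c). f x)"
    using c0 by (subst integral_density) (auto simp: scaleR_conv_of_real fG)
  also have "\<dots> = (LINT p|D. f (fst p ** snd p))"
    unfolding law[symmetric] by (rule integral_distr[OF mD]) simp
  also have "\<dots> = (LINT p|(M \<Otimes>\<^sub>M gauss). \<bar>det (snd p)\<bar> ^ N *\<^sub>R f (fst p ** snd p))"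
    unfolding D_def by (rule integral_density) auto
  also have "\<dots> = (LINT w|M. LINT g|gauss. \<bar>det g\<bar> ^ N *\<^sub>R f (w ** g))"
    using MG.integral_fst'[OF int2] by simp
  also have "\<dots> = (LINT w|M. (P w * gram_power l (transpose v ** w)) * (LINT g|gauss. det_gram (N + k) l g))"
  proof (intro Bochner_Integration.integral_cong refl)
    fix w
    have "(LINT g|gauss. \<bar>det g\<bar> ^ N *\<^sub>R f (w ** g)) = (LINT g|gauss. P w * (complex_of_real (\<bar>det g\<bar> ^ (N + k)) * gram_power l ((transpose v ** w) ** g)))"
      by (simp only: scaleR_conv_of_real fg)
    also have "\<dots> = P w * (gram_power l (transpose v ** w) * (LINT g|gauss. det_gram (N + k) l g))"
      by (simp only: integral_mult_right_zero integral_det_gram_mult)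
    finally show "(LINT g|gauss. \<bar>det g\<bar> ^ N *\<^sub>R f (w ** g)) = (P w * gram_power l (transpose v ** w)) * (LINT g|gauss. det_gram (N + k) l g)"
      by (simp only: mult.assoc)
  qed
  also have "\<dots> = composite_cosine M l P v * (\<Prod>a\<in>UNIV. tail_moment a (l $ a + of_nat (N + k)))"
    by (simp only: integral_mult_left_zero integral_det_gram[OF lj] composite_cosine_def cosine_kernel_eq)
  finally have main: "complex_of_real c * (LINT x|gauss. f x) = composite_cosine M l P v * (\<Prod>a\<in>UNIV. tail_moment a (l $ a + of_nat (N + k)))" .
  have inner: "(LINT x|gauss. f (v ** z + (x - v ** (transpose v ** x)))) = P v * gauss_det k z * gram_power l z" for z
    unfolding f_def vz by (simp only: integral_mult_left_zero H_polynomial_partial_average[OF P v])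
  have "(LINT x|gauss. f x) = (LINT z|gauss. P v * gauss_det k z * gram_power l z)"
    unfolding integral_gauss_resample[OF iso intf] inner ..
  also have "\<dots> = P v * (\<Prod>a\<in>UNIV. tail_fun a (l $ a) (herm k))"
  proof (cases "P v = 0")
    \<comment> \<open>Integrability of the square Gaussian integrand is inherited from
      \<open>f\<close> on division by \<open>P v\<close>. If \<open>P v = 0\<close>, both sides
      vanish.\<close>
    case False
    have "integrable gauss (\<lambda>z. LINT x|gauss. f (v ** z + (x - v ** (transpose v ** x))))"
      using gauss_pair.integrable_fst'[OF integrable_gauss_resample[OF iso intf]] by simp
    then have "integrable gauss (\<lambda>z. P v * (gauss_det k z * gram_power l z))"
      by (simp only: inner mult.assoc)
    from integrable_mult_right[OF this, of "inverse (P v)"]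
    have "integrable gauss (\<lambda>z. gauss_det k z * gram_power l z)"
      by (simp only: mult.assoc[symmetric] left_inverse[OF False] mult_1)
    from integral_gauss_det_gram_power[OF l k this] show ?thesis
      by (simp only: mult.assoc integral_mult_right_zero)
  qed simp
  finally show "complex_of_real (stiefel_mass CARD('n) CARD('m)) * (\<Prod>a\<in>(UNIV :: 'm set). tail_moment a (of_nat N)) *
        (P v * (\<Prod>a\<in>UNIV. tail_fun a (l $ a) (herm k)))
      = (\<Prod>a\<in>UNIV. tail_moment a (l $ a + of_nat (N + k))) * composite_cosine M l P v"
    using main by (simp add: c_def \<sigma>_def \<mu>N mult.commute)
qed

subsection \<open>The multiplier\<close>

text \<open>Translates the position p of an exponent into the tail dimension m + 1 - p of the
  Gaussian computation; the bound p - m - 1 on the real part becomes minus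
  \<open>card {a..}\<close>.\<close>

lemma position_add_card: "position (a::'m::{finite,linorder}) + card {a..} = CARD('m) + 1"
proof -
  have "card ({..a} \<union> {a..}) + card ({..a} \<inter> {a..}) = card {..a} + card {a..}"
    by (rule card_Un_Int[symmetric]) auto
  moreover have "{..a} \<union> {a..} = UNIV" "{..a} \<inter> {a..} = {a}" by auto
  ultimately show ?thesis by (simp add: position_def)
qed

lemma position_bounds: "position (a::'m::{finite,linorder}) \<in> {1..CARD('m)}"
proof -
  have "position a > 0" by (auto simp: position_def card_gt_0_iff)
  then show ?thesis using position_add_card[of a] card_atLeast_pos[of a] by simp
qed

lemma position_less: "a < b \<Longrightarrow> position (a::'m::{finite,linorder}) < position b"
  unfolding position_def by (rule psubset_card_mono) (auto simp: psubset_eq)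

lemma bij_betw_position: "bij_betw position (UNIV :: 'm::{finite,linorder} set) {1..CARD('m)}"
proof -
  have inj: "inj (position :: 'm \<Rightarrow> nat)"
    by (rule linorder_injI) (auto dest: position_less)
  moreover have "range (position :: 'm \<Rightarrow> nat) = {1..CARD('m)}"
    by (rule card_subset_eq) (use position_bounds[where 'm = 'm] card_image[OF inj] in \<open>auto simp del: atLeastAtMost_iff\<close>)
  ultimately show ?thesis by (simp add: bij_betw_def)
qed

lemma position_reverse_index: "position (reverse_index a) = CARD('m) + 1 - position (a::'m::{finite,linorder})"
proof -
  have "CARD('m) + 1 - position a \<in> range (position :: 'm \<Rightarrow> nat)"
    unfolding bij_betw_imp_surj_on[OF bij_betw_position[where 'm = 'm]] using position_bounds[of a] by auto
  then obtain b :: 'm where "CARD('m) + 1 - position a = position b" by (rule imageE) blast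
  then have b: "position b = CARD('m) + 1 - position a" by (rule sym)
  show ?thesis
    unfolding reverse_index_def
  proof (rule theI[of _ b])
    show "c = b" if "position c = CARD('m) + 1 - position a" for c
      using injD[OF bij_betw_imp_inj_on[OF bij_betw_position[where 'm = 'm]], of c b] that b by simp
  qed (rule b)
qed

lemma bij_reverse_index: "bij (reverse_index :: 'm::{finite,linorder} \<Rightarrow> 'm)"
proof -
  have "reverse_index (reverse_index a) = a" for a :: 'm
  proof -
    have "position (reverse_index (reverse_index a)) = position a"
      using position_bounds[of a] by (simp add: position_reverse_index)
    then show ?thesis using bij_betw_imp_inj_on[OF bij_betw_position[where 'm = 'm]] by (simp add: inj_eq)
  qed
  then show ?thesis by (rule involuntory_imp_bij)
qed

lemma stiefel_mass_eq:
  "stiefel_mass n CARD('m::{finite,linorder}) = (\<Prod>a\<in>(UNIV :: 'm set). sphere_area (n - position a))"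
  unfolding stiefel_mass_def
  by (rule prod.reindex_bij_betw[OF bij_betw_position, symmetric])

lemma Re_pos_not_nonpos_Ints: "Re w > 0 \<Longrightarrow> w \<notin> \<int>\<^sub>\<le>\<^sub>0"
  by (auto elim!: nonpos_Ints_cases)

lemma sphere_area_pos: "sphere_area i > 0"
  by (simp add: sphere_area_def Gamma_real_pos)

text \<open>The formula for \<mu> with the critical gamma quotient written as a Pochhammer symbol
  and the denominator through the entire function \<open>rGamma\<close>. It is regular on the whole
  region of the theorem, including points where single gamma factors of \<mu> have poles.\<close>

definition multiplier :: "nat \<Rightarrow> nat \<Rightarrow> (complex, 'm::{finite,linorder}) vec \<Rightarrow> complex" where
  "multiplier N j l = (\<Prod>a\<in>UNIV. Gamma ((l $ a + of_nat (card {a..})) / 2)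
      * pochhammer (- (l $ a + of_nat (card {a..}) - 1) / 2) j
      * rGamma ((l $ a + of_nat (N + 2 * j) + of_nat (card {a..})) / 2))"

text \<open>In the reversed factors, index \<open>a\<close> meets the component at
  \<open>reverse_index a\<close>, whose tail dimension is \<open>position a\<close>. So all four
  gamma products can be indexed by the components of \<open>l\<close> and compared factor by
  factor.\<close>

lemma Gamma_Omega_arg_add:
  fixes l :: "(complex, 'm::{finite,linorder}) vec"
  shows "Gamma_Omega_arg (l + vec (of_nat CARD('m))) a = (l $ a + of_nat (card {a..})) / 2"
    and "N + CARD('m) = n \<Longrightarrow> Gamma_Omega_arg (l + vec (of_nat k) + vec (of_nat n)) a
      = (l $ a + of_nat (N + k) + of_nat (card {a..})) / 2"
    and "Gamma_Omega_arg (vec (of_nat k) - reverse_vec l) a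
      = - (l $ reverse_index a + of_nat (card {reverse_index a..}) - 1) / 2 + of_nat k / 2"
    and "Gamma_Omega_arg (- reverse_vec l) a = - (l $ reverse_index a + of_nat (card {reverse_index a..}) - 1) / 2"
proof -
  have c: "complex_of_nat (card {a..}) = of_nat CARD('m) + 1 - of_nat (position a)" for a :: 'm
    using position_add_card[of a, THEN arg_cong, of complex_of_nat] by (simp add: algebra_simps)
  have r: "complex_of_nat (position (reverse_index a)) = of_nat CARD('m) + 1 - of_nat (position a)"
    using position_bounds[of a] by (simp add: position_reverse_index of_nat_diff)
  show "Gamma_Omega_arg (l + vec (of_nat CARD('m))) a = (l $ a + of_nat (card {a..})) / 2"
    by (simp add: Gamma_Omega_arg_def c algebra_simps)
  show "Gamma_Omega_arg (l + vec (of_nat k) + vec (of_nat n)) a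
      = (l $ a + of_nat (N + k) + of_nat (card {a..})) / 2" if "N + CARD('m) = n"
    by (simp add: Gamma_Omega_arg_def c that[symmetric] algebra_simps)
  show "Gamma_Omega_arg (vec (of_nat k) - reverse_vec l) a
      = - (l $ reverse_index a + of_nat (card {reverse_index a..}) - 1) / 2 + of_nat k / 2"
    "Gamma_Omega_arg (- reverse_vec l) a = - (l $ reverse_index a + of_nat (card {reverse_index a..}) - 1) / 2"
    unfolding c r by (simp_all add: Gamma_Omega_arg_def reverse_vec_def field_simps)
qed

lemma mu_quotient_eq_multiplier:
  fixes l :: "(complex, 'm::{finite,linorder}) vec"
  assumes n: "N + CARD('m) = n" and l: "l \<in> mu_regular n (2 * j)"
  shows "mu_quotient n (2 * j) l = multiplier N j l"
proof -
  let ?w = "\<lambda>a. - (l $ a + of_nat (card {a..}) - 1) / 2"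
  define C where "C = complex_of_real (pi powr (real CARD('m) * (real CARD('m) - 1) / 4))"
  have C: "C \<noteq> 0" by (simp add: C_def)
  define G1 where "G1 = (\<Prod>a\<in>(UNIV :: 'm set). Gamma ((l $ a + of_nat (card {a..})) / 2))"
  define G2 where "G2 = (\<Prod>a\<in>(UNIV :: 'm set). Gamma (?w a + of_nat j))"
  define G3 where "G3 = (\<Prod>a\<in>(UNIV :: 'm set). Gamma (?w a))"
  define G4 where "G4 = (\<Prod>a\<in>(UNIV :: 'm set). Gamma ((l $ a + of_nat (N + 2 * j) + of_nat (card {a..})) / 2))"
  have rev: "(\<Prod>a\<in>UNIV. f (reverse_index a)) = (\<Prod>a\<in>(UNIV :: 'm set). f a)" for f :: "'m \<Rightarrow> complex"
    using prod.reindex_bij_betw[OF bij_reverse_index, of f] by simp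
  have "Gamma_Omega (l + vec (of_nat CARD('m))) = C * G1"
    by (simp add: Gamma_Omega_def C_def G1_def Gamma_Omega_arg_add)
  moreover have "Gamma_Omega (vec (of_nat (2 * j)) - reverse_vec l) = C * G2"
    unfolding Gamma_Omega_def Gamma_Omega_arg_add(3) C_def[symmetric] rev[of "\<lambda>a. Gamma (?w a + of_nat (2 * j) / 2)"]
    by (simp add: G2_def)
  moreover have "Gamma_Omega (- reverse_vec l) = C * G3"
    unfolding Gamma_Omega_def Gamma_Omega_arg_add(4) C_def[symmetric] rev[of "\<lambda>a. Gamma (?w a)"] G3_def ..
  moreover have "Gamma_Omega (l + vec (of_nat (2 * j)) + vec (of_nat n)) = C * G4"
    unfolding Gamma_Omega_def Gamma_Omega_arg_add(2)[OF n] C_def[symmetric] G4_def ..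
  ultimately have "mu_quotient n (2 * j) l = (C * G1 * (C * G2)) / (C * G3 * (C * G4))"
    by (simp only: mu_quotient_def)
  also have "\<dots> = G1 * (G2 / G3) * (1 / G4)" using C by simp
  also have "G2 / G3 = (\<Prod>a\<in>(UNIV :: 'm set). pochhammer (?w a) j)"
    unfolding G2_def G3_def prod_dividef[symmetric]
  proof (rule prod.cong[OF refl])
    fix a :: 'm
    obtain b where b: "a = reverse_index b" using bij_reverse_index by (metis bij_pointE)
    have "Gamma_Omega_arg (- reverse_vec l) b \<notin> \<int>\<^sub>\<le>\<^sub>0"
      using l by (simp add: mu_regular_def Gamma_Omega_regular_def)
    then have "?w a \<notin> \<int>\<^sub>\<le>\<^sub>0" unfolding Gamma_Omega_arg_add(4) b .
    then show "Gamma (?w a + of_nat j) / Gamma (?w a) = pochhammer (?w a) j"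
      by (rule pochhammer_Gamma[symmetric])
  qed
  also have "1 / G4 = (\<Prod>a\<in>(UNIV :: 'm set). rGamma ((l $ a + of_nat (N + 2 * j) + of_nat (card {a..})) / 2))"
    unfolding G4_def rGamma_inverse_Gamma inverse_eq_divide prod_dividef by (simp only: prod.neutral_const)
  finally show ?thesis by (simp add: multiplier_def G1_def prod.distrib)
qed

text \<open>Moving every component by the same small imaginary amount, avoiding finitely many
  values, makes all gamma arguments nonreal and so avoids all poles. This makes the limit that
  defines \<open>mu\<close> unique.\<close>

lemma islimpt_mu_regular:
  fixes l :: "(complex, 'm::{finite,linorder}) vec"
  shows "l islimpt mu_regular n k"
  unfolding islimpt_approachable
proof (intro allI impI)
  fix e :: real assume e: "e > 0"
  define u :: "(complex, 'm) vec" where "u = vec \<i>"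
  define d where "d = e / (norm u + 1)"
  have d: "d > 0" unfolding d_def by (rule divide_pos_pos) (use e in \<open>auto intro: add_nonneg_pos\<close>)
  define Z where "Z = (\<lambda>a. - Im (l $ a)) ` (UNIV :: 'm set)"
  have "infinite ({0<..<d} - Z)"
    using d by (simp add: Z_def infinite_Ioo)
  then obtain t where t: "t \<in> {0<..<d}" "t \<notin> Z"
    by (metis DiffE ex_in_conv finite.emptyI)
  define x where "x = l + t *\<^sub>R u"
  have Im0: "Im (l $ a) + t \<noteq> 0" for a
  proof
    assume "Im (l $ a) + t = 0"
    then have "t = - Im (l $ a)" by simp
    then show False using t(2) by (simp add: Z_def)
  qed
  have xa: "Im (x $ a) \<noteq> 0" for a
    using Im0[of a] by (simp add: x_def u_def)
  have np: "w \<notin> \<int>\<^sub>\<le>\<^sub>0" if "Im w \<noteq> 0" for w :: complex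
    using that by (auto elim!: nonpos_Ints_cases)
  have "x \<in> mu_regular n k"
    unfolding mu_regular_def Gamma_Omega_regular_def
    by (auto simp: Gamma_Omega_arg_def reverse_vec_def xa intro!: np)
  moreover have "x \<noteq> l" using xa t(1) by (auto simp: x_def u_def vec_eq_iff)
  moreover have "dist x l < e"
  proof -
    have "dist x l = t * norm u" using t by (simp add: x_def dist_norm)
    also have "\<dots> \<le> t * (norm u + 1)" using t by (intro mult_left_mono) auto
    also have "\<dots> < d * (norm u + 1)"
      using t by (intro mult_strict_right_mono) (auto intro: add_nonneg_pos)
    also have "\<dots> = e"
      using add_nonneg_pos[OF norm_ge_zero[of u] zero_less_one] by (simp add: d_def)
    finally show ?thesis .
  qed
  ultimately show "\<exists>x'\<in>mu_regular n k. x' \<noteq> l \<and> dist x' l < e" by blast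
qed

text \<open>\<open>multiplier\<close> is continuous at \<open>l\<close>, as its gamma arguments have
  positive real part there and its other factors are entire, and it agrees with the quotient at
  regular points. Hence it is the limit.\<close>

lemma mu_eq_multiplier:
  fixes l :: "(complex, 'm::{finite,linorder}) vec"
  assumes n: "N + CARD('m) = n" and l: "\<And>a. Re (l $ a) > - real (card {a..})"
  shows "mu n (2 * j) l = multiplier N j l"
proof -
  let ?F = "at l within mu_regular n (2 * j)"
  have c: "((\<lambda>x. x $ a) \<longlongrightarrow> l $ a) ?F" for a
    by (intro tendsto_vec_nth tendsto_ident_at)
  have tendsto_rGamma: "((\<lambda>x. rGamma (f x)) \<longlongrightarrow> rGamma w) F" if "(f \<longlongrightarrow> w) F"
    for f :: "(complex, 'm) vec \<Rightarrow> complex" and w F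
    by (rule isCont_tendsto_compose[OF _ that]) (simp add: isCont_rGamma)
  have "(multiplier N j \<longlongrightarrow> multiplier N j l) ?F"
    unfolding multiplier_def[abs_def] pochhammer_prod
  proof (intro tendsto_prod tendsto_mult tendsto_Gamma tendsto_rGamma tendsto_divide tendsto_add tendsto_minus tendsto_diff tendsto_const c)
    fix a :: 'm
    have "Re ((l $ a + of_nat (card {a..})) / 2) > 0" using l[of a] by simp
    then show "(l $ a + of_nat (card {a..})) / 2 \<notin> \<int>\<^sub>\<le>\<^sub>0" by (rule Re_pos_not_nonpos_Ints)
  qed auto
  moreover have "eventually (\<lambda>x. multiplier N j x = mu_quotient n (2 * j) x) ?F"
    using mu_quotient_eq_multiplier[OF n] by (simp add: eventually_at_filter)
  ultimately have "(mu_quotient n (2 * j) \<longlongrightarrow> multiplier N j l) ?F"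
    by (rule Lim_transform_eventually)
  moreover have "\<not> trivial_limit ?F"
    using islimpt_mu_regular by (simp add: trivial_limit_within)
  ultimately show ?thesis unfolding mu_def by (rule tendsto_Lim[rotated])
qed

theorem corollary5p3:
  fixes M :: "(real^('m::{finite,linorder})^'n) measure"
    and l :: "complex^('m::{finite,linorder})"
    and P :: "real^('m::{finite,linorder})^'n \<Rightarrow> complex"
    and k :: nat
  assumes "CARD('n) > CARD('m)"
    and "is_stiefel_measure M"
    and "\<And>j. Re (l $ j) > real (position j) - real CARD('m) - 1"
    and "H_polynomial k P"
    and "v \<in> stiefel"
  shows "integrable M (\<lambda>w. P w * cosine_kernel l v w) \<and>
    composite_cosine M l P v =
      (complex_of_real (pi powr (real CARD('m) * (real CARD('n) - real CARD('m)) / 2)) *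
        \<i> ^ (k * CARD('m)) * complex_of_real (stiefel_mass CARD('m) CARD('m))) *
      mu CARD('n) k l * P v"
proof (cases "even k")
  case False
  then have "P = (\<lambda>_. 0)" using H_polynomial_odd_zero[OF assms(4)] by auto
  then show ?thesis by (simp add: composite_cosine_def)
next
  case True
  then obtain j where j: "k = 2 * j" by auto
  define N where "N = CARD('n) - CARD('m)"
  have N: "N + CARD('m) = CARD('n)" "N > 0" using assms(1) by (auto simp: N_def)
  have pos: "real (position a) = real CARD('m) + 1 - real (card {a..})" for a :: 'm
    using position_add_card[of a] by linarith
  have l: "Re (l $ a) > - real (card {a..})" for a
    using assms(3)[of a] pos[of a] by simp
  have mass: "stiefel_mass CARD('n) CARD('m) > 0"
    unfolding stiefel_mass_def by (intro prod_pos) (simp add: sphere_area_pos)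
  note main = composite_cosine_H_polynomial[OF N assms(2) l assms(4) True assms(5) mass]
  let ?\<nu> = "\<lambda>a::'m. card {a..}"
  let ?q = "\<lambda>a. Gamma ((l $ a + of_nat (?\<nu> a)) / 2) * pochhammer (- (l $ a + of_nat (?\<nu> a) - 1) / 2) j
      * rGamma ((l $ a + of_nat (N + 2 * j) + of_nat (?\<nu> a)) / 2)"
  let ?g = "\<lambda>a. Gamma ((of_nat N + of_nat (?\<nu> a)) / 2) / Gamma (of_nat (?\<nu> a) / 2) :: complex"
  \<comment> \<open>Row by row, \<open>herm k\<close> contributes (-2)^j. The factor 2^j and the
    powers of 2 in the two moments on the left make up the power of 2 in the moment on the right, so
    only (-1)^j survives.\<close>
  have step: "tail_moment a (of_nat N) * tail_fun a (l $ a) (herm k) = tail_moment a (l $ a + of_nat (N + k)) * ((-1) ^ j * ?g a * ?q a)" for a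
  proof -
    have c: "?\<nu> a > 0" by (rule card_atLeast_pos)
    have RN: "Re (of_nat N) > - real (?\<nu> a)" using c by simp
    have Rl: "Re (l $ a + of_nat (N + k)) > - real (?\<nu> a)" using l[of a] by simp
    define w where "w = (l $ a + of_nat (N + k) + of_nat (?\<nu> a)) / 2"
    have "Re w > 0" using Rl by (simp add: w_def)
    then have w: "w \<notin> \<int>\<^sub>\<le>\<^sub>0" by (rule Re_pos_not_nonpos_Ints)
    have \<nu>: "(of_nat (?\<nu> a) / 2 :: complex) \<notin> \<int>\<^sub>\<le>\<^sub>0" using c by (intro Re_pos_not_nonpos_Ints) simp
    have G\<nu>: "Gamma (of_nat (?\<nu> a) / 2 :: complex) \<noteq> 0" using \<nu> by (simp add: Gamma_eq_zero_iff)
    have Gw: "Gamma w * rGamma w = 1" using w by (simp add: rGamma_inverse_Gamma Gamma_eq_zero_iff)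
    have p2: "2 powr ((l $ a + of_nat (N + k)) / 2) = 2 powr (of_nat N / 2) * 2 powr (l $ a / 2) * (2::complex) ^ j"
    proof -
      have "(l $ a + of_nat (N + k)) / 2 = of_nat N / 2 + l $ a / 2 + of_nat j"
        by (simp add: j field_simps)
      then show ?thesis by (simp only: powr_add powr_nat) simp
    qed
    have m2: "(-2 :: complex) ^ j = (-1) ^ j * 2 ^ j" by (metis power_mult_distrib mult_minus1)
    show ?thesis
      unfolding j tail_fun_herm_even[OF l] unfolding j[symmetric]
      unfolding tail_moment_eq[OF RN] tail_moment_eq[OF l] tail_moment_eq[OF Rl] w_def[symmetric] p2 m2
      using Gw G\<nu> by (simp add: field_simps)
  qed
  have nz: "(\<Prod>a\<in>UNIV. tail_moment a (l $ a + of_nat (N + k))) \<noteq> 0"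
  proof -
    have "tail_moment a (l $ a + of_nat (N + k)) \<noteq> 0" for a
      by (rule tail_moment_nonzero) (use l[of a] in simp)
    then show ?thesis by simp
  qed
  \<comment> \<open>With \<nu> the tail dimension, the sphere area on the left has Gamma((N + \<nu>)
    / 2) in its denominator. The moment of order \<open>N\<close> exchanges it for Gamma(\<nu> / 2),
    which belongs to the sphere for m in place of n, and a factor pi^(N/2) is left over.\<close>
  have area: "complex_of_real (sphere_area (CARD('n) - position a)) * ?g a
      = complex_of_real (pi powr (real N / 2)) * complex_of_real (sphere_area (CARD('m) - position a))" for a :: 'm
  proof -
    have c: "?\<nu> a > 0" by (rule card_atLeast_pos)
    have 1: "real (CARD('n) - position a) + 1 = real N + real (?\<nu> a)"
      using position_bounds[of a] position_add_card[of a] N by simp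
    have 2: "real (CARD('m) - position a) + 1 = real (?\<nu> a)"
      using position_bounds[of a] position_add_card[of a] by simp
    have G: "?g a = complex_of_real (Gamma ((real N + real (?\<nu> a)) / 2) / Gamma (real (?\<nu> a) / 2))"
      by (simp add: Gamma_complex_of_real[symmetric])
    have "Gamma ((real N + real (?\<nu> a)) / 2) > 0" using c by (intro Gamma_real_pos) simp
    then have "sphere_area (CARD('n) - position a) * (Gamma ((real N + real (?\<nu> a)) / 2) / Gamma (real (?\<nu> a) / 2))
      = pi powr (real N / 2) * sphere_area (CARD('m) - position a)"
      unfolding sphere_area_def 1 2 by (simp add: add_divide_distrib powr_add)
    then show ?thesis unfolding G by (metis of_real_mult)
  qed
  have "complex_of_real (stiefel_mass CARD('n) CARD('m)) * (\<Prod>a\<in>(UNIV :: 'm set). tail_moment a (of_nat N)) * (P v * (\<Prod>a\<in>(UNIV :: 'm set). tail_fun a (l $ a) (herm k)))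
    = complex_of_real (stiefel_mass CARD('n) CARD('m)) * P v * (\<Prod>a\<in>(UNIV :: 'm set). tail_moment a (of_nat N) * tail_fun a (l $ a) (herm k))"
    by (simp add: prod.distrib mult_ac)
  also have "\<dots> = (\<Prod>a\<in>(UNIV :: 'm set). tail_moment a (l $ a + of_nat (N + k))) *
      ((\<Prod>a\<in>(UNIV :: 'm set). (-1) ^ j) * (complex_of_real (stiefel_mass CARD('n) CARD('m)) * (\<Prod>a\<in>(UNIV :: 'm set). ?g a)) * (\<Prod>a\<in>(UNIV :: 'm set). ?q a) * P v)"
    unfolding step prod.distrib by (simp only: mult_ac)
  finally have T: "composite_cosine M l P v
      = (\<Prod>a\<in>(UNIV :: 'm set). (-1) ^ j) * (complex_of_real (stiefel_mass CARD('n) CARD('m)) * (\<Prod>a\<in>(UNIV :: 'm set). ?g a)) * multiplier N j l * P v"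
    unfolding main(2) multiplier_def using nz by (simp only: mult_cancel_left) simp
  have "complex_of_real (stiefel_mass CARD('n) CARD('m)) * (\<Prod>a\<in>(UNIV :: 'm set). ?g a)
      = (\<Prod>a\<in>(UNIV :: 'm set). complex_of_real (pi powr (real N / 2)) * complex_of_real (sphere_area (CARD('m) - position a)))"
    unfolding stiefel_mass_eq of_real_prod prod.distrib[symmetric] by (rule prod.cong[OF refl area])
  also have "\<dots> = complex_of_real (pi powr (real N / 2)) ^ CARD('m) * complex_of_real (stiefel_mass CARD('m) CARD('m))"
    unfolding stiefel_mass_eq[where 'm = 'm] of_real_prod prod.distrib by simp
  also have "complex_of_real (pi powr (real N / 2)) ^ CARD('m) = complex_of_real (pi powr (real CARD('m) * (real CARD('n) - real CARD('m)) / 2))"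
  proof -
    have "(pi powr (real N / 2)) ^ CARD('m) = pi powr (real N / 2 * real CARD('m))"
      unfolding powr_powr[symmetric] by (rule powr_realpow[symmetric]) simp
    moreover have "real N / 2 * real CARD('m) = real CARD('m) * (real CARD('n) - real CARD('m)) / 2"
      using N by (simp add: of_nat_diff N_def)
    ultimately show ?thesis by (metis of_real_power)
  qed
  finally have c: "complex_of_real (stiefel_mass CARD('n) CARD('m)) * (\<Prod>a\<in>(UNIV :: 'm set). ?g a)
      = complex_of_real (pi powr (real CARD('m) * (real CARD('n) - real CARD('m)) / 2)) * complex_of_real (stiefel_mass CARD('m) CARD('m))" .
  \<comment> \<open>As k = 2 j, the sign (-1)^(j m) is the power k m of the imaginary unit.\<close>
  have i: "(\<Prod>a\<in>(UNIV :: 'm set). (-1) ^ j) = \<i> ^ (k * CARD('m))"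
    by (simp add: j power_mult)
  have mu: "mu CARD('n) k l = multiplier N j l"
    unfolding j by (rule mu_eq_multiplier[OF N(1) l])
  have "composite_cosine M l P v =
      (complex_of_real (pi powr (real CARD('m) * (real CARD('n) - real CARD('m)) / 2)) *
        \<i> ^ (k * CARD('m)) * complex_of_real (stiefel_mass CARD('m) CARD('m))) *
      mu CARD('n) k l * P v"
    unfolding T c i mu by (simp only: mult_ac)
  with main(1) show ?thesis by blast
qed

end
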